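(* Let $\theta>0$ and let $\tilde W_n'=\frac{W_n'-\mathbb E W_n'}{n^2}$, $\tilde T_n'=\frac{T_n'-\mathbb E T_n'}{n}$ for the Hoppe tree with parameter $\theta$. Then $(\tilde W_n',\tilde T_n')^t$ converges in distribution and with second moments to a random vector $(\tilde W',\tilde T')^t$ whose law satisfies $$\begin{pmatrix}\tilde W'\\ \tilde T'\end{pmatrix}\overset{d}{=}\begin{pmatrix}(1-V)^2 & V(1-V)\\ 0 & 1-V\end{pmatrix}\begin{pmatrix}\tilde W'\\ \tilde T'\end{pmatrix}+\begin{pmatrix}V^2 & V(1-V)\\ 0 & V\end{pmatrix}\begin{pmatrix}\tilde W\\ \tilde T\end{pmatrix}+b^\ast,$$ $$b^\ast=\begin{pmatrix}\Big(\frac{\theta+5}{\theta+1}-\frac{2\theta+4}{\theta+1}V\Big)V+\mathcal E(V)+\big(\Psi(\theta+1)-\Psi(2)\big)V\\[2pt] V+\mathcal E(V)+\big(\Psi(\theta+1)-\Psi(2)\big)V\end{pmatrix},$$ where $V\sim\beta(1,\theta)$, and $(\tilde W',\tilde T')$, $(\tilde W,\tilde T)$, $V$ are independent, with $(\tilde W,\tilde T)$ having the limit law for the random recursive tree described in the context. This law of $(\tilde W',\tilde T')$ is the unique solution of this equation among centered probability distributions on $\mathbb R^2$ with finite second moments.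
   Context: Let $(J_k)_{k\ge1}$ be independent with $\Pr(J_k=0)=\frac{\theta}{\theta+k-1}$ and $\Pr(J_k=i)=\frac{1}{\theta+k-1}$ for $i\in\{1,\dots,k-1\}$. The Hoppe tree with $n$ vertices has vertex set $\{0,\dots,n-1\}$, root $0$, parent of $k\ge1$ equal to $J_k$; for $\theta=1$ it is the random recursive tree. $T_n=\sum_{k=0}^{n-1}D_k$ ($D_k$ the depth of $k$) is the total length and $W_n=\sum_{0\le i<j\le n-1}\operatorname{dist}(i,j)$ the Wiener index; primes denote quantities for the Hoppe tree with parameter $\theta$, unprimed ones for the random recursive tree. $\mathcal E(v)=v\log v+(1-v)\log(1-v)$, $\Psi$ is the digamma function, $\beta(1,\theta)$ has density $\theta(1-v)^{\theta-1}$ on $(0,1)$. Known input (Neininger 2002): for the random recursive tree, $\big(\frac{W_n-\mathbb EW_n}{n^2},\frac{T_n-\mathbb ET_n}{n}\big)$ converges in distribution and with second moments to $(\tilde W,\tilde T)$, whose law is the unique centered finite-second-moment solution of $\begin{pmatrix}\tilde W\\ \tilde T\end{pmatrix}\overset d=\begin{pmatrix}(1-U)^2&U(1-U)\\0&1-U\end{pmatrix}\begin{pmatrix}\tilde W^\ast\\ \tilde T^\ast\end{pmatrix}+\begin{pmatrix}U^2&U(1-U)\\0&U\end{pmatrix}\begin{pmatrix}\tilde W\\ \tilde T\end{pmatrix}+\begin{pmatrix}3U(1-U)+\mathcal E(U)\\ U+\mathcal E(U)\end{pmatrix}$, with $(\tilde W,\tilde T),(\tilde W^\ast,\tilde T^\ast),U$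 independent, $(\tilde W^\ast,\tilde T^\ast)\overset d=(\tilde W,\tilde T)$, $U\sim\mathcal U[0,1]$. Convergence "with second moments" means convergence in distribution together with convergence of all second moments. *)

theory Defs
  imports "HOL-Probability.Probability"
begin

text \<open>Hoppe tree: J k is the parent of vertex k (1 \<le> k < n); outside {1..<n}, J is 0.\<close>

definition hoppe_J :: "real \<Rightarrow> nat \<Rightarrow> nat pmf" where
  "hoppe_J \<theta> k = embed_pmf (\<lambda>i. if i = 0 then \<theta> / (\<theta> + real k - 1)
                                 else if i < k then 1 / (\<theta> + real k - 1) else 0)"

definition hoppe_tree :: "real \<Rightarrow> nat \<Rightarrow> (nat \<Rightarrow> nat) pmf" where
  "hoppe_tree \<theta> n = Pi_pmf {1..<n} 0 (hoppe_J \<theta>)"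

definition depth :: "(nat \<Rightarrow> nat) \<Rightarrow> nat \<Rightarrow> nat" where
  "depth J k = (LEAST m. (J ^^ m) k = 0)"

definition tree_dist :: "(nat \<Rightarrow> nat) \<Rightarrow> nat \<Rightarrow> nat \<Rightarrow> nat" where
  "tree_dist J i j = (LEAST d. \<exists>a b. a + b = d \<and> (J ^^ a) i = (J ^^ b) j)"

definition total_length :: "nat \<Rightarrow> (nat \<Rightarrow> nat) \<Rightarrow> nat" where
  "total_length n J = (\<Sum>k<n. depth J k)"

definition wiener :: "nat \<Rightarrow> (nat \<Rightarrow> nat) \<Rightarrow> nat" where
  "wiener n J = (\<Sum>i<n. \<Sum>j\<in>{i<..<n}. tree_dist J i j)"

definition scaled_WT :: "real \<Rightarrow> nat \<Rightarrow> (nat \<Rightarrow> nat) \<Rightarrow> real \<times> real" where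
  "scaled_WT \<theta> n J =
     ((real (wiener n J) - measure_pmf.expectation (hoppe_tree \<theta> n) (\<lambda>J'. real (wiener n J'))) / (real n)^2,
      (real (total_length n J) - measure_pmf.expectation (hoppe_tree \<theta> n) (\<lambda>J'. real (total_length n J'))) / real n)"

definition hoppe_law :: "real \<Rightarrow> nat \<Rightarrow> (real \<times> real) measure" where
  "hoppe_law \<theta> n = distr (measure_pmf (hoppe_tree \<theta> n)) borel (scaled_WT \<theta> n)"

definition weak_conv2 :: "(nat \<Rightarrow> (real \<times> real) measure) \<Rightarrow> (real \<times> real) measure \<Rightarrow> bool" where
  "weak_conv2 M N \<longleftrightarrow>
     (\<forall>f :: real \<times> real \<Rightarrow> real. continuous_on UNIV f \<and> bounded (range f) \<longrightarrow>
        (\<lambda>n. \<integral>x. f x \<partial>M n) \<longlonglongrightarrow> (\<integral>x. f x \<partial>N))"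

definition conv_dist_2mom :: "(nat \<Rightarrow> (real \<times> real) measure) \<Rightarrow> (real \<times> real) measure \<Rightarrow> bool" where
  "conv_dist_2mom M N \<longleftrightarrow> weak_conv2 M N \<and>
     (\<lambda>n. \<integral>x. (fst x)^2 \<partial>M n) \<longlonglongrightarrow> (\<integral>x. (fst x)^2 \<partial>N) \<and>
     (\<lambda>n. \<integral>x. fst x * snd x \<partial>M n) \<longlonglongrightarrow> (\<integral>x. fst x * snd x \<partial>N) \<and>
     (\<lambda>n. \<integral>x. (snd x)^2 \<partial>M n) \<longlonglongrightarrow> (\<integral>x. (snd x)^2 \<partial>N)"

definition centered_L2 :: "(real \<times> real) measure \<Rightarrow> bool" where
  "centered_L2 \<rho> \<longleftrightarrow> prob_space \<rho> \<and> sets \<rho> = sets borel \<and>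
     integrable \<rho> fst \<and> integrable \<rho> snd \<and>
     integrable \<rho> (\<lambda>x. (fst x)^2) \<and> integrable \<rho> (\<lambda>x. (snd x)^2) \<and>
     (\<integral>x. fst x \<partial>\<rho>) = 0 \<and> (\<integral>x. snd x \<partial>\<rho>) = 0"

definition beta1 :: "real \<Rightarrow> real measure" where
  "beta1 \<theta> = density lborel (\<lambda>v. ennreal (indicator {0<..<1} v * \<theta> * (1 - v) powr (\<theta> - 1)))"

definition entropy_fn :: "real \<Rightarrow> real" where
  "entropy_fn v = v * ln v + (1 - v) * ln (1 - v)"

definition hoppe_map :: "real \<Rightarrow> real \<times> real \<Rightarrow> real \<times> real \<Rightarrow> real \<Rightarrow> real \<times> real" where
  "hoppe_map \<theta> x' x v =
     (let c = entropy_fn v + (Digamma (\<theta> + 1) - Digamma 2) * v in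
      ((1 - v)^2 * fst x' + v * (1 - v) * snd x' + v^2 * fst x + v * (1 - v) * snd x
         + ((\<theta> + 5) / (\<theta> + 1) - (2 * \<theta> + 4) / (\<theta> + 1) * v) * v + c,
       (1 - v) * snd x' + v * snd x + v + c))"

definition hoppe_fixpoint :: "real \<Rightarrow> (real \<times> real) measure \<Rightarrow> (real \<times> real) measure \<Rightarrow> bool" where
  "hoppe_fixpoint \<theta> \<nu> \<rho> \<longleftrightarrow>
     distr (\<rho> \<Otimes>\<^sub>M \<nu> \<Otimes>\<^sub>M beta1 \<theta>) borel (\<lambda>(x', x, v). hoppe_map \<theta> x' x v) = \<rho>"

end

theory Submission
  imports Defs "HOL-Real_Asymp.Real_Asymp"
begin

text \<open>
  Vertex 1 splits a Hoppe tree into its own subtree, which is a random recursive tree, and the rest,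
  which is a smaller Hoppe tree; given the sizes these are independent, and the sizes form a Polya urn
  whose limiting proportion is \<open>\<beta>(1,\<theta>)\<close>. In the norm \<open>\<bar>w\<bar> + \<bar>t\<bar>\<close> the random affine map of the limit
  equation contracts its Hoppe argument by the factor \<open>1 - v\<^sup>2\<close>. Hence the equation has exactly one solution
  with finite mean, obtained from backward iteration, and the Wasserstein distances \<open>d n\<close> between the
  laws and this solution satisfy \<open>d n \<le> E [(1 - (K/n)\<^sup>2) d (n - K)] + o(1)\<close>, where \<open>K\<close> is the size of
  the first subtree; this forces \<open>d n \<rightarrow> 0\<close>. The second moments obey
  recursions of the same type because the cross terms of centered independent parts vanish.
\<close>
section \<open>Hoppe trees as binary trees\<close>

text \<open>The factor \<open>1 - v^2\<close> tends to 1 as \<open>v\<close> tends to 0, so the map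
  is no uniform contraction: only its mean over \<open>V\<close> is below 1. For finite trees the
  recursion is usable because no fixed size of either part keeps positive probability in the limit,
  so that early, uncontrolled distances are averaged away. A first-order metric is enough: the
  coefficients contract in mean without any centering, and in dual form no coupling has to be built.
  It does not control second moments. Their system is triangular, because the second row of the
  matrices ignores the first coordinate: E T^2 comes first, then E WT, then E W^2, each by a scalar
  linear recursion whose limit equals the corresponding moment of the fixed point. The law \<nu>
  enters through weak convergence and convergence of integrals; its integrability, its centering and
  the Wasserstein convergence towards it are derived from these. The entropy in the toll originates
  in the means, of order \<open>n ln n\<close> and \<open>n^2 ln n\<close>: in the recursion
  \<open>ln n\<close> cancels, while \<open>ln v\<close> and \<open>ln (1 - v)\<close>
  survive.\<close>

text \<open>\<open>Join s r\<close> hangs the root of \<open>s\<close> below the root of \<open>r\<close> as its oldest child, so the root of the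
  whole tree is the root of \<open>r\<close>.\<close>

datatype 'a tree = Root 'a | Join "'a tree" "'a tree"

primrec troot :: "'a tree \<Rightarrow> 'a" where
  "troot (Root a) = a"
| "troot (Join s r) = troot r"

primrec tsize :: "'a tree \<Rightarrow> nat" where
  "tsize (Root a) = 1"
| "tsize (Join s r) = tsize s + tsize r"

text \<open>Internal path length. Hanging \<open>s\<close> below the root of \<open>r\<close> lowers
  each of its \<open>tsize s\<close> vertices by one level, which is the last summand.\<close>

primrec tlen :: "'a tree \<Rightarrow> nat" where
  "tlen (Root a) = 0"
| "tlen (Join s r) = tlen s + tlen r + tsize s"

text \<open>Sum of distances over unordered pairs. A path from \<open>s\<close> to \<open>r\<close>
  climbs to the root of \<open>s\<close>, crosses one edge and descends from the root of
  \<open>r\<close>; summed over the \<open>tsize s * tsize r\<close> mixed pairs this yields the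
  last three terms.\<close>

primrec twiener :: "'a tree \<Rightarrow> nat" where
  "twiener (Root a) = 0"
| "twiener (Join s r) = twiener s + twiener r + tsize s * tlen r + tsize r * tlen s + tsize s * tsize r"

text \<open>The leaf \<open>Root a\<close> sits inside the \<open>Join\<close>s of all children of
  \<open>a\<close> already present, so rewriting it makes \<open>m\<close> the youngest child of
  \<open>j\<close>, consistent with \<open>Join\<close> adding the oldest one. Both branches are
  searched; with distinct labels only one of them changes.\<close>

primrec attach :: "'a \<Rightarrow> 'a \<Rightarrow> 'a tree \<Rightarrow> 'a tree" where
  "attach j m (Root a) = (if a = j then Join (Root m) (Root a) else Root a)"
| "attach j m (Join s r) = Join (attach j m s) (attach j m r)"

primrec distinct_labels :: "'a tree \<Rightarrow> bool" where
  "distinct_labels (Root a) = True"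
| "distinct_labels (Join s r) =
     (distinct_labels s \<and> distinct_labels r \<and> set_tree s \<inter> set_tree r = {})"

text \<open>Path length and Wiener index depend on the shape only. Labels would obstruct the
  recursion: the two parts of a split carry intertwined label sets, whereas their shapes are
  independent given the sizes.\<close>

abbreviation shape :: "'a tree \<Rightarrow> unit tree" where
  "shape \<equiv> map_tree (\<lambda>_. ())"

text \<open>The total weight of all one-vertex extensions of a tree, evaluated by \<open>F\<close>; the root has
  weight \<open>\<theta>\<close>, every other vertex has weight 1.\<close>

primrec grow :: "unit tree \<Rightarrow> real \<Rightarrow> (unit tree \<Rightarrow> real) \<Rightarrow> real" where
  "grow (Root a) \<theta> F = \<theta> * F (Join (Root ()) (Root ()))"
| "grow (Join s r) \<theta> F = grow s 1 (\<lambda>s'. F (Join s' r)) + grow r \<theta> (\<lambda>r'. F (Join s r'))"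

section \<open>Shapes and growth by one vertex\<close>

lemma tsize_shape [simp]: "tsize (shape t) = tsize t"
  by (induction t) auto

lemma tlen_shape [simp]: "tlen (shape t) = tlen t"
  by (induction t) auto

lemma twiener_shape [simp]: "twiener (shape t) = twiener t"
  by (induction t) auto

lemma finite_set_tree [simp]: "finite (set_tree t)"
  by (induction t) auto

lemma troot_in_set_tree [simp]: "troot t \<in> set_tree t"
  by (induction t) auto

lemma card_set_tree: "distinct_labels t \<Longrightarrow> card (set_tree t) = tsize t"
  by (induction t) (auto simp: card_Un_disjoint)

lemma attach_notin [simp]: "j \<notin> set_tree t \<Longrightarrow> attach j m t = t"
  by (induction t) auto

lemma set_attach: "j \<in> set_tree t \<Longrightarrow> set_tree (attach j m t) = insert m (set_tree t)"
proof (induction t)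
  case (Join s r)
  then show ?case by (cases "j \<in> set_tree s"; cases "j \<in> set_tree r") auto
qed auto

lemma troot_attach [simp]: "troot (attach j m t) = troot t"
  by (induction t) auto

lemma distinct_labels_attach:
  "distinct_labels t \<Longrightarrow> m \<notin> set_tree t \<Longrightarrow> distinct_labels (attach j m t)"
proof (induction t)
  case (Join s r)
  then show ?case
    by (cases "j \<in> set_tree s"; cases "j \<in> set_tree r") (auto simp: set_attach)
qed auto

text \<open>Passes from the choice of a parent label to the label-free \<open>grow\<close>. In
  \<open>Join s r\<close> the root of the whole tree lies in \<open>r\<close>, so the root of
  \<open>s\<close> is an ordinary vertex of weight 1: this is why \<open>s\<close> grows with
  parameter 1, that is, as a random recursive tree.\<close>

lemma sum_attach_eq_grow:
  assumes "distinct_labels t"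
  shows "(\<Sum>j\<in>set_tree t. (if j = troot t then \<theta> else 1) * F (shape (attach j m t))) = grow (shape t) \<theta> F"
  using assms
proof (induction t arbitrary: \<theta> F)
  case (Join s r)
  let ?w = "\<lambda>j. if j = troot r then \<theta> else 1"
  have d: "set_tree s \<inter> set_tree r = {}" using Join.prems by simp
  have "(\<Sum>j\<in>set_tree (Join s r). (if j = troot (Join s r) then \<theta> else 1) * F (shape (attach j m (Join s r))))
      = (\<Sum>j\<in>set_tree s. ?w j * F (Join (shape (attach j m s)) (shape (attach j m r))))
        + (\<Sum>j\<in>set_tree r. ?w j * F (Join (shape (attach j m s)) (shape (attach j m r))))"
    using d by (simp add: sum.union_disjoint)
  also have "(\<Sum>j\<in>set_tree s. ?w j * F (Join (shape (attach j m s)) (shape (attach j m r))))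
     = (\<Sum>j\<in>set_tree s. (if j = troot s then 1 else 1) * F (Join (shape (attach j m s)) (shape r)))"
  proof (intro sum.cong refl)
    fix j assume "j \<in> set_tree s"
    then have "j \<notin> set_tree r" using d by auto
    then have "j \<noteq> troot r" by auto
    with \<open>j \<notin> set_tree r\<close> show "?w j * F (Join (shape (attach j m s)) (shape (attach j m r)))
       = (if j = troot s then 1 else 1) * F (Join (shape (attach j m s)) (shape r))" by simp
  qed
  also have "\<dots> = grow (shape s) 1 (\<lambda>s'. F (Join s' (shape r)))"
    using Join.prems by (intro Join.IH(1)) auto
  also have "(\<Sum>j\<in>set_tree r. ?w j * F (Join (shape (attach j m s)) (shape (attach j m r))))
     = (\<Sum>j\<in>set_tree r. ?w j * F (Join (shape s) (shape (attach j m r))))"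
  proof (intro sum.cong refl)
    fix j assume "j \<in> set_tree r"
    then have "j \<notin> set_tree s" using d by auto
    then show "?w j * F (Join (shape (attach j m s)) (shape (attach j m r)))
       = ?w j * F (Join (shape s) (shape (attach j m r)))" by simp
  qed
  also have "\<dots> = grow (shape r) \<theta> (\<lambda>r'. F (Join (shape s) r'))"
    using Join.prems by (intro Join.IH(2)) auto
  finally show ?case by simp
qed simp

text \<open>One root of weight \<theta> and \<open>tsize t - 1\<close> further vertices of weight 1:
  this total is the denominator in the parent distribution.\<close>

lemma grow_const: "grow t \<theta> (\<lambda>_. c) = (\<theta> + real (tsize t) - 1) * c"
proof (induction t arbitrary: \<theta>)
  case (Join s r)
  show ?case by (simp add: Join.IH) (simp add: algebra_simps)
qed simp

lemma grow_add: "grow t \<theta> (\<lambda>x. F x + G x) = grow t \<theta> F + grow t \<theta> G"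
  by (induction t arbitrary: \<theta> F G) (auto simp: algebra_simps)

lemma grow_cmult: "grow t \<theta> (\<lambda>x. c * F x) = c * grow t \<theta> F"
  by (induction t arbitrary: \<theta> F) (auto simp: algebra_simps)

lemma grow_cong_size:
  "(\<And>x. tsize x = Suc (tsize t) \<Longrightarrow> F x = G x) \<Longrightarrow> grow t \<theta> F = grow t \<theta> G"
proof (induction t arbitrary: \<theta> F G)
  case (Join s r)
  have "grow s 1 (\<lambda>s'. F (Join s' r)) = grow s 1 (\<lambda>s'. G (Join s' r))"
    by (intro Join.IH(1) Join.prems) simp
  moreover have "grow r \<theta> (\<lambda>r'. F (Join s r')) = grow r \<theta> (\<lambda>r'. G (Join s r'))"
    by (intro Join.IH(2) Join.prems) simp
  ultimately show ?case by simp
qed simp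

lemma grow_tsize: "grow t \<theta> (\<lambda>x. real (tsize x)) = (\<theta> + real (tsize t) - 1) * (real (tsize t) + 1)"
proof -
  have "grow t \<theta> (\<lambda>x. real (tsize x)) = grow t \<theta> (\<lambda>x. real (tsize t) + 1)"
    by (intro grow_cong_size) simp
  then show ?thesis by (simp add: grow_const)
qed

text \<open>A new child of \<open>j\<close> lies one level deeper than \<open>j\<close>. Weighted
  over all \<open>j\<close>, the depths sum to \<open>tlen t\<close>, because the root, the only
  vertex whose weight may differ from 1, has depth 0.\<close>

lemma grow_tlen:
  "grow t \<theta> (\<lambda>x. real (tlen x)) = (\<theta> + real (tsize t)) * real (tlen t) + (\<theta> + real (tsize t) - 1)"
proof (induction t arbitrary: \<theta>)
  case (Join s r)
  have "grow s 1 (\<lambda>s'. real (tlen (Join s' r)))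
      = grow s 1 (\<lambda>s'. real (tlen s') + (real (tlen r) + real (tsize s')))"
    by (simp add: algebra_simps)
  then have "grow s 1 (\<lambda>s'. real (tlen (Join s' r))) = grow s 1 (\<lambda>s'. real (tlen s'))
      + (grow s 1 (\<lambda>_. real (tlen r)) + grow s 1 (\<lambda>s'. real (tsize s')))"
    by (simp only: grow_add)
  moreover have "grow r \<theta> (\<lambda>r'. real (tlen (Join s r')))
      = grow r \<theta> (\<lambda>r'. real (tlen r') + (real (tlen s) + real (tsize s)))"
    by (simp add: algebra_simps)
  then have "grow r \<theta> (\<lambda>r'. real (tlen (Join s r')))
      = grow r \<theta> (\<lambda>r'. real (tlen r')) + grow r \<theta> (\<lambda>_. real (tlen s) + real (tsize s))"
    by (simp only: grow_add)
  ultimately show ?case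
    using Join.IH(1)[of 1] Join.IH(2)[of \<theta>] 
    by (simp only: grow.simps grow_const grow_tsize) (simp add: algebra_simps)
qed simp

text \<open>A new child of \<open>j\<close> adds \<open>tsize t\<close> plus the sum of all
  distances from \<open>j\<close>. With weight 1 for every \<open>j\<close> the latter count each
  pair twice, giving \<open>2 * twiener t\<close>; the excess weight \<open>\<theta> - 1\<close> of
  the root contributes its own distance sum \<open>tlen t\<close>.\<close>

lemma grow_twiener:
  "grow t \<theta> (\<lambda>x. real (twiener x)) = (\<theta> + real (tsize t) + 1) * real (twiener t)
     + (\<theta> - 1) * real (tlen t) + real (tsize t) * (\<theta> + real (tsize t) - 1)"
proof (induction t arbitrary: \<theta>)
  case (Join s r)
  have "grow s 1 (\<lambda>s'. real (twiener (Join s' r)))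
      = grow s 1 (\<lambda>s'. real (twiener s') + (real (twiener r) + ((real (tlen r) + real (tsize r)) * real (tsize s')
            + real (tsize r) * real (tlen s'))))"
    by (simp add: algebra_simps)
  then have "grow s 1 (\<lambda>s'. real (twiener (Join s' r))) = grow s 1 (\<lambda>s'. real (twiener s'))
      + (grow s 1 (\<lambda>_. real (twiener r)) + ((real (tlen r) + real (tsize r)) * grow s 1 (\<lambda>s'. real (tsize s'))
      + real (tsize r) * grow s 1 (\<lambda>s'. real (tlen s'))))"
    by (simp only: grow_add grow_cmult)
  moreover have "grow r \<theta> (\<lambda>r'. real (twiener (Join s r')))
      = grow r \<theta> (\<lambda>r'. real (twiener r') + (real (twiener s) + ((real (tlen s) + real (tsize s)) * real (tsize r')
            + real (tsize s) * real (tlen r'))))"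
    by (simp add: algebra_simps)
  then have "grow r \<theta> (\<lambda>r'. real (twiener (Join s r')))
      = grow r \<theta> (\<lambda>r'. real (twiener r')) + (grow r \<theta> (\<lambda>_. real (twiener s))
        + ((real (tlen s) + real (tsize s)) * grow r \<theta> (\<lambda>r'. real (tsize r'))
      + real (tsize s) * grow r \<theta> (\<lambda>r'. real (tlen r'))))"
    by (simp only: grow_add grow_cmult)
  ultimately show ?case
    using Join.IH(1)[of 1] Join.IH(2)[of \<theta>]
    by (simp only: grow.simps grow_const grow_tsize grow_tlen) (simp add: algebra_simps)
qed simp

subsection \<open>Distances in labelled trees\<close>

text \<open>Compatibility of an arbitrary distance function with the recursive structure. It
  prescribes exactly what the recursions of \<open>tlen\<close> and \<open>twiener\<close> consume,
  so that paths under parent functions stay out of the summations.\<close>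

primrec tree_metric :: "('a \<Rightarrow> 'a \<Rightarrow> nat) \<Rightarrow> 'a tree \<Rightarrow> bool" where
  "tree_metric d (Root a) = (d a a = 0)"
| "tree_metric d (Join s r) = (tree_metric d s \<and> tree_metric d r \<and>
     (\<forall>x\<in>set_tree s. \<forall>y\<in>set_tree r. d x y = d x (troot s) + 1 + d y (troot r)))"

lemma tree_metric_root: "tree_metric d t \<Longrightarrow> d (troot t) (troot t) = 0"
  by (induction t) auto

lemma tree_metric_tlen:
  assumes "tree_metric d t" "distinct_labels t"
  shows "(\<Sum>x\<in>set_tree t. d x (troot t)) = tlen t"
  using assms
proof (induction t)
  case (Join s r)
  have "(\<Sum>x\<in>set_tree (Join s r). d x (troot (Join s r)))
      = (\<Sum>x\<in>set_tree s. d x (troot r)) + (\<Sum>x\<in>set_tree r. d x (troot r))"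
    using Join.prems by (simp add: sum.union_disjoint)
  also have "(\<Sum>x\<in>set_tree s. d x (troot r)) = (\<Sum>x\<in>set_tree s. d x (troot s) + 1)"
    using Join.prems tree_metric_root[of d r] by (intro sum.cong) auto
  finally show ?case
    using Join by (simp add: sum_Suc card_set_tree)
qed auto

lemma tree_metric_twiener:
  assumes "tree_metric d t" "distinct_labels t" and sym: "\<And>x y. d x y = d y x"
  shows "(\<Sum>x\<in>set_tree t. \<Sum>y\<in>set_tree t. d x y) = 2 * twiener t"
  using assms(1,2)
proof (induction t)
  case (Join s r)
  let ?S = "set_tree s" and ?R = "set_tree r"
  have dj: "?S \<inter> ?R = {}" using Join.prems by simp
  have cross: "(\<Sum>x\<in>?S. \<Sum>y\<in>?R. d x y) = tsize r * tlen s + tsize s * tsize r + tsize s * tlen r"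
  proof -
    have "(\<Sum>x\<in>?S. \<Sum>y\<in>?R. d x y) = (\<Sum>x\<in>?S. \<Sum>y\<in>?R. d x (troot s) + 1 + d y (troot r))"
      using Join.prems by (intro sum.cong) auto
    also have "\<dots> = tsize r * (\<Sum>x\<in>?S. d x (troot s)) + tsize s * tsize r + tsize s * (\<Sum>y\<in>?R. d y (troot r))"
      using Join.prems by (simp add: sum.distrib card_set_tree sum_Suc sum_distrib_left)
    finally show ?thesis
      using Join.prems by (simp add: tree_metric_tlen)
  qed
  have cross': "(\<Sum>x\<in>?R. \<Sum>y\<in>?S. d x y) = (\<Sum>x\<in>?S. \<Sum>y\<in>?R. d x y)"
    by (subst sum.swap) (intro sum.cong refl sym)
  have "(\<Sum>x\<in>set_tree (Join s r). \<Sum>y\<in>set_tree (Join s r). d x y)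
     = (\<Sum>x\<in>?S. \<Sum>y\<in>?S. d x y) + (\<Sum>x\<in>?S. \<Sum>y\<in>?R. d x y)
       + ((\<Sum>x\<in>?R. \<Sum>y\<in>?S. d x y) + (\<Sum>x\<in>?R. \<Sum>y\<in>?R. d x y))"
    using dj by (simp add: sum.union_disjoint sum.distrib)
  then show ?case
    using Join cross cross' by (simp add: algebra_simps)
qed auto

text \<open>The distances of \<open>m\<close> are those of \<open>j\<close> plus one on all of
  \<open>t\<close>. In a mixed pair both sides of the path formula contain exactly one such
  distance, so the formula for \<open>j\<close> carries over to \<open>m\<close>; the pair of
  \<open>m\<close> and \<open>j\<close> is settled where \<open>Root j\<close> is replaced.\<close>

lemma tree_metric_attach:
  assumes "tree_metric d t" "distinct_labels t" "j \<in> set_tree t" "m \<notin> set_tree t" "d m m = 0"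
    and "\<And>x. x \<in> set_tree t \<Longrightarrow> d m x = Suc (d j x)" and sym: "\<And>x y. d x y = d y x"
  shows "tree_metric d (attach j m t)"
  using assms(1-4,6)
proof (induction t)
  case (Root a)
  then show ?case using assms(5) by simp
next
  case (Join s r)
  show ?case
  proof (cases "j \<in> set_tree s")
    case True
    then have jr: "j \<notin> set_tree r" using Join.prems by auto
    have "tree_metric d (attach j m s)"
      using Join.prems True by (intro Join.IH(1)) auto
    moreover have "d m y = d m (troot s) + 1 + d y (troot r)" if "y \<in> set_tree r" for y
    proof -
      have "d m y = Suc (d j y)" "d m (troot s) = Suc (d j (troot s))"
        using Join.prems(5) that by auto
      moreover have "d j y = d j (troot s) + 1 + d y (troot r)"
        using Join.prems(1) True that by simp
      ultimately show ?thesis by simp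
    qed
    moreover have "d x y = d x (troot s) + 1 + d y (troot r)" if "x \<in> set_tree s" "y \<in> set_tree r" for x y
      using Join.prems(1) that by simp
    ultimately show ?thesis
      using Join.prems(1) by (simp add: set_attach[OF True] attach_notin[OF jr])
  next
    case False
    then have jr: "j \<in> set_tree r" using Join.prems by auto
    have "tree_metric d (attach j m r)"
      using Join.prems jr by (intro Join.IH(2)) auto
    moreover have "d x m = d x (troot s) + 1 + d m (troot r)" if "x \<in> set_tree s" for x
    proof -
      have "d x m = Suc (d x j)" "d m (troot r) = Suc (d j (troot r))"
        using Join.prems(5) that sym[of x m] sym[of x j] by auto
      moreover have "d x j = d x (troot s) + 1 + d j (troot r)"
        using Join.prems(1) jr that by simp
      ultimately show ?thesis by simp
    qed
    moreover have "d x y = d x (troot s) + 1 + d y (troot r)" if "x \<in> set_tree s" "y \<in> set_tree r" for x y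
      using Join.prems(1) that by simp
    ultimately show ?thesis
      using Join.prems(1) by (simp add: set_attach[OF jr] attach_notin[OF False])
  qed
qed

lemma tree_dist_sym: "tree_dist J x y = tree_dist J y x"
  unfolding tree_dist_def by (rule arg_cong[where f=Least]) (metis add.commute)

lemma tree_dist_self [simp]: "tree_dist J x x = 0"
  unfolding tree_dist_def by (rule Least_eq_0) auto

section \<open>Distances under a parent function\<close>

context
  fixes J :: "nat \<Rightarrow> nat"
  assumes J0: "J 0 = 0" and J_less: "\<And>k. k > 0 \<Longrightarrow> J k < k"
begin

lemma iterate_parent_le: "(J ^^ a) x \<le> x"
proof (induction a)
  case (Suc a)
  have "J ((J ^^ a) x) \<le> (J ^^ a) x"
    using J0 J_less[of "(J ^^ a) x"] by (cases "(J ^^ a) x = 0") auto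
  with Suc show ?case by simp
qed simp

lemma iterate_parent_root: "(J ^^ a) 0 = 0"
  by (induction a) (auto simp: J0)

lemma iterate_parent_eventually_root: "\<exists>a. (J ^^ a) x = 0"
proof (induction x rule: less_induct)
  case (less x)
  show ?case
  proof (cases "x = 0")
    case True
    then show ?thesis by (intro exI[of _ 0]) simp
  next
    case False
    then obtain a where "(J ^^ a) (J x) = 0" using less J_less by blast
    then show ?thesis by (intro exI[of _ "Suc a"]) (simp add: funpow_swap1)
  qed
qed

lemma tree_dist_exists: "\<exists>d a b. a + b = d \<and> (J ^^ a) x = (J ^^ b) y"
  using iterate_parent_eventually_root[of x] iterate_parent_eventually_root[of y] by metis

text \<open>Iterating the parent function never increases a vertex, so \<open>m\<close> is no
  ancestor of \<open>x < m\<close>. Hence every meeting of the two ancestral lines starts with the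
  step from \<open>m\<close> to \<open>J m\<close>, and removing it shifts the set of admissible
  lengths by one.\<close>

lemma tree_dist_child:
  assumes "x < m"
  shows "tree_dist J m x = Suc (tree_dist J (J m) x)"
proof -
  let ?P = "\<lambda>d. \<exists>a b. a + b = d \<and> (J ^^ a) m = (J ^^ b) x"
  let ?Q = "\<lambda>d. \<exists>a b. a + b = d \<and> (J ^^ a) (J m) = (J ^^ b) x"
  obtain d where d: "?P d" using tree_dist_exists by blast
  have ne: "(J ^^ b) x \<noteq> m" for b using iterate_parent_le[of b x] assms by linarith
  have "\<not> ?P 0" using assms by auto
  then have "(LEAST d. ?P d) = Suc (LEAST d. ?P (Suc d))"
    using d by (intro Least_Suc)
  moreover have "?P (Suc d) = ?Q d" for d
  proof
    assume "?P (Suc d)"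
    then obtain a b where ab: "a + b = Suc d" "(J ^^ a) m = (J ^^ b) x" by blast
    then obtain a' where "a = Suc a'" using ne[of b] by (cases a) auto
    then show "?Q d" using ab by (intro exI[of _ a'] exI[of _ b]) (simp add: funpow_swap1)
  next
    assume "?Q d"
    then obtain a b where "a + b = d" "(J ^^ a) (J m) = (J ^^ b) x" by blast
    then show "?P (Suc d)" by (intro exI[of _ "Suc a"] exI[of _ b]) (simp add: funpow_swap1)
  qed
  ultimately show ?thesis unfolding tree_dist_def by simp
qed

text \<open>The root is fixed by \<open>J\<close>, so steps taken from it are wasted and the minimal
  sum has \<open>b = 0\<close>.\<close>

lemma depth_eq_tree_dist: "depth J x = tree_dist J x 0"
  unfolding depth_def tree_dist_def
proof (rule Least_equality[symmetric], goal_cases)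
  case 1
  obtain a where "(J ^^ a) x = 0" using iterate_parent_eventually_root by blast
  then have "(J ^^ (LEAST m. (J ^^ m) x = 0)) x = 0" by (rule LeastI)
  then show ?case by (intro exI[of _ "LEAST m. (J ^^ m) x = 0"] exI[of _ 0]) simp
next
  case (2 d)
  then obtain a b where "a + b = d" "(J ^^ a) x = 0" by (auto simp: iterate_parent_root)
  then show ?case using Least_le[of "\<lambda>m. (J ^^ m) x = 0" a] by simp
qed

end

text \<open>Vertices are attached in order of arrival. Vertex 1 can only be a child of 0 and creates
  the outermost \<open>Join\<close>, which later attachments preserve: in
  \<open>encode J n = Join s r\<close> the left part \<open>s\<close> is the subtree of vertex 1.
  The value at 0 is a dummy.\<close>

primrec encode :: "(nat \<Rightarrow> nat) \<Rightarrow> nat \<Rightarrow> nat tree" where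
  "encode J 0 = Root 0"
| "encode J (Suc n) = (if n = 0 then Root 0 else attach (J n) n (encode J n))"

lemma encode_cong: "(\<And>k. k < n \<Longrightarrow> J k = J' k) \<Longrightarrow> encode J n = encode J' n"
  by (induction n) auto

lemma troot_encode [simp]: "troot (encode J n) = 0"
  by (induction n) auto

lemma encode_labels:
  assumes "\<And>k. k > 0 \<Longrightarrow> J k < k" "n > 0"
  shows "set_tree (encode J n) = {..<n} \<and> distinct_labels (encode J n)"
  using assms(2)
proof (induction n)
  case (Suc n)
  show ?case
  proof (cases "n = 0")
    case False
    then have "set_tree (encode J n) = {..<n}" "distinct_labels (encode J n)" "J n < n"
      using Suc.IH assms(1)[of n] by simp_all
    then show ?thesis
      using False set_attach[of "J n" "encode J n" n] distinct_labels_attach[of "encode J n" n]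
      by (simp add: lessThan_Suc)
  qed auto
qed simp

lemma tree_metric_encode:
  assumes "J 0 = 0" "\<And>k. k > 0 \<Longrightarrow> J k < k" "n > 0"
  shows "tree_metric (tree_dist J) (encode J n)"
  using assms(3)
proof (induction n)
  case (Suc n)
  show ?case
  proof (cases "n = 0")
    case False
    then have "set_tree (encode J n) = {..<n}" "distinct_labels (encode J n)" "J n < n"
      using encode_labels[of J n] assms by auto
    then have "tree_metric (tree_dist J) (attach (J n) n (encode J n))"
      using Suc.IH False tree_dist_child[OF assms(1,2)]
      by (intro tree_metric_attach tree_dist_sym) simp_all
    then show ?thesis using False by simp
  qed simp
qed simp

lemma total_length_eq_tlen:
  assumes "J 0 = 0" "\<And>k. k > 0 \<Longrightarrow> J k < k" "n > 0"
  shows "total_length n J = tlen (encode J n)"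
  using tree_metric_tlen[OF tree_metric_encode[OF assms]] encode_labels[of J n] assms
  by (simp add: total_length_def depth_eq_tree_dist)

lemma double_sum_symmetric:
  fixes d :: "nat \<Rightarrow> nat \<Rightarrow> nat"
  assumes "\<And>x y. d x y = d y x" "\<And>x. d x x = 0"
  shows "(\<Sum>x<n. \<Sum>y<n. d x y) = 2 * (\<Sum>i<n. \<Sum>j\<in>{i<..<n}. d i j)"
proof (induction n)
  case (Suc n)
  have "{i<..<Suc n} = insert n {i<..<n}" if "i < n" for i using that by auto
  then have "(\<Sum>i<n. \<Sum>j\<in>{i<..<Suc n}. d i j) = (\<Sum>i<n. d i n + (\<Sum>j\<in>{i<..<n}. d i j))"
    by (intro sum.cong refl) simp
  moreover have "{n<..<Suc n} = {}" by auto
  ultimately have "(\<Sum>i<Suc n. \<Sum>j\<in>{i<..<Suc n}. d i j) = (\<Sum>i<n. d i n + (\<Sum>j\<in>{i<..<n}. d i j))"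
    by simp
  moreover have "(\<Sum>x<Suc n. \<Sum>y<Suc n. d x y) = (\<Sum>x<n. \<Sum>y<n. d x y) + 2 * (\<Sum>i<n. d i n)"
  proof -
    have "(\<Sum>y<n. d n y) = (\<Sum>i<n. d i n)" by (intro sum.cong refl assms)
    then show ?thesis using assms(2) by (simp add: sum.distrib)
  qed
  ultimately show ?case using Suc by (simp add: sum.distrib)
qed simp

lemma wiener_eq_twiener:
  assumes "J 0 = 0" "\<And>k. k > 0 \<Longrightarrow> J k < k" "n > 0"
  shows "wiener n J = twiener (encode J n)"
proof -
  have "(\<Sum>x<n. \<Sum>y<n. tree_dist J x y) = 2 * twiener (encode J n)"
    using tree_metric_twiener[OF tree_metric_encode[OF assms]] encode_labels[of J n] assms tree_dist_sym
    by simp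
  moreover have "(\<Sum>x<n. \<Sum>y<n. tree_dist J x y) = 2 * wiener n J"
    unfolding wiener_def by (intro double_sum_symmetric tree_dist_sym) simp
  ultimately show ?thesis by simp
qed

section \<open>The size of the first subtree\<close>

lemma sets_beta1 [simp, measurable_cong]: "sets (beta1 \<theta>) = sets borel"
  by (simp add: beta1_def)

lemma space_beta1 [simp]: "space (beta1 \<theta>) = UNIV"
  by (simp add: beta1_def)

lemma AE_beta1: "AE v in beta1 \<theta>. 0 < v \<and> v < 1"
  unfolding beta1_def by (subst AE_density) (auto split: split_indicator)

lemma nn_integral_beta1_monomial:
  assumes "\<theta> > 0"
  shows "(\<integral>\<^sup>+v. ennreal (v ^ i * (1 - v) ^ j) \<partial>beta1 \<theta>) = ennreal (\<theta> * Beta (real i + 1) (\<theta> + real j))"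
proof -
  have I: "((\<lambda>v. \<theta> * (v powr (real i + 1 - 1) * (1 - v) powr (\<theta> + real j - 1))) has_integral
      \<theta> * Beta (real i + 1) (\<theta> + real j)) {0<..<1}"
    using has_integral_Beta_real[of "real i + 1" "\<theta> + real j"] assms
    by (intro has_integral_mult_right) (simp add: has_integral_Icc_iff_Ioo)
  have "(\<integral>\<^sup>+v. ennreal (v ^ i * (1 - v) ^ j) \<partial>beta1 \<theta>)
     = (\<integral>\<^sup>+v. ennreal (indicator {0<..<1} v * \<theta> * (1 - v) powr (\<theta> - 1)) * ennreal (v ^ i * (1 - v) ^ j) \<partial>lborel)"
    unfolding beta1_def by (subst nn_integral_density) auto
  also have "\<dots> = (\<integral>\<^sup>+v. ennreal (\<theta> * (v powr (real i + 1 - 1) * (1 - v) powr (\<theta> + real j - 1))) * indicator {0<..<1} v \<partial>lborel)"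
  proof (intro nn_integral_cong)
    fix v :: real
    show "ennreal (indicator {0<..<1} v * \<theta> * (1 - v) powr (\<theta> - 1)) * ennreal (v ^ i * (1 - v) ^ j)
       = ennreal (\<theta> * (v powr (real i + 1 - 1) * (1 - v) powr (\<theta> + real j - 1))) * indicator {0<..<1} v"
    proof (cases "v \<in> {0<..<1}")
      case True
      then have "(1 - v) powr (\<theta> + real j - 1) = (1 - v) powr (\<theta> - 1) * (1 - v) ^ j"
        by (simp add: powr_realpow[symmetric] powr_add[symmetric] algebra_simps)
      with True assms show ?thesis
        by (simp add: powr_realpow ennreal_mult'[symmetric] algebra_simps)
    qed simp
  qed
  also have "\<dots> = ennreal (\<theta> * Beta (real i + 1) (\<theta> + real j))"
    using assms by (intro nn_integral_has_integral_lebesgue'[OF _ I]) simp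
  finally show ?thesis .
qed

lemma Gamma_real_Suc: "(x::real) > 0 \<Longrightarrow> Gamma (x + 1) = x * Gamma x"
  by (intro Gamma_plus1) (auto elim!: nonpos_Ints_cases)

lemma prob_space_beta1:
  assumes "\<theta> > 0"
  shows "prob_space (beta1 \<theta>)"
proof
  have "Gamma \<theta> \<noteq> 0" using Gamma_real_pos[OF assms] by (rule less_imp_neq[symmetric])
  then have "Beta 1 \<theta> = 1 / \<theta>"
    using assms by (simp add: Beta_def Gamma_real_Suc add.commute[of 1 \<theta>])
  then show "emeasure (beta1 \<theta>) (space (beta1 \<theta>)) = 1"
    using nn_integral_beta1_monomial[OF assms, of 0 0] assms by simp
qed

lemma integrable_beta1:
  fixes f :: "real \<Rightarrow> real"
  assumes "\<theta> > 0" "f \<in> borel_measurable borel" "\<And>v. 0 \<le> v \<Longrightarrow> v \<le> 1 \<Longrightarrow> \<bar>f v\<bar> \<le> C"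
  shows "integrable (beta1 \<theta>) f"
proof -
  interpret prob_space "beta1 \<theta>" by (rule prob_space_beta1[OF assms(1)])
  show ?thesis
    using AE_beta1[of \<theta>] assms by (intro integrable_const_bound[where B=C]) auto
qed

lemma integral_beta1_mono:
  fixes f g :: "real \<Rightarrow> real"
  assumes "integrable (beta1 \<theta>) f" "integrable (beta1 \<theta>) g"
    and "\<And>v. 0 < v \<Longrightarrow> v < 1 \<Longrightarrow> f v \<le> g v"
  shows "(\<integral>v. f v \<partial>beta1 \<theta>) \<le> (\<integral>v. g v \<partial>beta1 \<theta>)"
  using AE_beta1[of \<theta>] assms by (intro integral_mono_AE) auto

lemma integral_beta1_less_1:
  fixes f :: "real \<Rightarrow> real"
  assumes "\<theta> > 0" "integrable (beta1 \<theta>) f" "\<And>v. 0 < v \<Longrightarrow> v < 1 \<Longrightarrow> f v < 1"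
  shows "(\<integral>v. f v \<partial>beta1 \<theta>) < 1"
proof -
  interpret prob_space "beta1 \<theta>" by (rule prob_space_beta1[OF assms(1)])
  have "AE v in beta1 \<theta>. f v < 1" using AE_beta1[of \<theta>] assms(3) by auto
  then have "(\<integral>v. f v \<partial>beta1 \<theta>) < (\<integral>v. 1 \<partial>beta1 \<theta>)"
    using assms emeasure_space_1 by (intro integral_less_AE_space) auto
  then show ?thesis using prob_space by simp
qed

lemma Bernstein_le_1: "0 \<le> v \<Longrightarrow> v \<le> 1 \<Longrightarrow> Bernstein N i v \<le> 1"
proof (cases "i \<le> N")
  case True
  assume v: "0 \<le> v" "v \<le> 1"
  then have "Bernstein N i v \<le> (\<Sum>k\<le>N. Bernstein N k v)"
    using True by (intro member_le_sum) (auto simp: Bernstein_nonneg)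
  then show ?thesis by simp
qed (simp add: Bernstein_def binomial_eq_0)

lemma borel_measurable_Bernstein [measurable]: "Bernstein N i \<in> borel_measurable borel"
  unfolding Bernstein_def[abs_def] by measurable

text \<open>The size of the subtree of vertex 1 in a Hoppe tree is governed by a Polya urn, hence it is
  a mixture of binomial distributions over \<open>V \<sim> \<beta>(1,\<theta>)\<close>.\<close>

definition split_weight :: "real \<Rightarrow> nat \<Rightarrow> nat \<Rightarrow> real" where
  "split_weight \<theta> N i = (\<integral>v. Bernstein N i v \<partial>beta1 \<theta>)"

lemma integrable_Bernstein_mult:
  assumes "\<theta> > 0" "f \<in> borel_measurable borel" "\<And>v. 0 \<le> v \<Longrightarrow> v \<le> 1 \<Longrightarrow> \<bar>f v\<bar> \<le> C"
  shows "integrable (beta1 \<theta>) (\<lambda>v. Bernstein N i v * f v)"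
proof (rule integrable_beta1[OF assms(1), where C=C])
  show "\<bar>Bernstein N i v * f v\<bar> \<le> C" if "0 \<le> v" "v \<le> 1" for v
    using mult_mono[OF Bernstein_le_1[OF that, of N i] assms(3)[OF that]] that
    by (simp add: abs_mult Bernstein_nonneg)
qed (use assms in measurable)

lemma integrable_Bernstein: "\<theta> > 0 \<Longrightarrow> integrable (beta1 \<theta>) (Bernstein N i)"
  using integrable_Bernstein_mult[of \<theta> "\<lambda>_. 1" 1 N i] by simp

lemma split_weight_nonneg: "split_weight \<theta> N i \<ge> 0"
  unfolding split_weight_def using AE_beta1[of \<theta>]
  by (intro integral_nonneg_AE) (auto simp: Bernstein_nonneg)

lemma sum_split_weight:
  assumes "\<theta> > 0"
  shows "(\<Sum>i\<le>N. split_weight \<theta> N i) = 1"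
proof -
  interpret prob_space "beta1 \<theta>" by (rule prob_space_beta1[OF assms(1)])
  have "(\<Sum>i\<le>N. split_weight \<theta> N i) = (\<integral>v. (\<Sum>i\<le>N. Bernstein N i v) \<partial>beta1 \<theta>)"
    unfolding split_weight_def by (rule Bochner_Integration.integral_sum[symmetric]) (rule integrable_Bernstein[OF assms])
  then show ?thesis using prob_space by simp
qed

text \<open>Beta-binomial weight: the factor \<open>fact i\<close> from the Beta integral cancels
  the one in the binomial coefficient.\<close>

lemma split_weight_eq_Gamma:
  assumes "\<theta> > 0" "i \<le> N"
  shows "split_weight \<theta> N i = \<theta> * (fact N / fact (N - i)) * (Gamma (\<theta> + real N - real i) / Gamma (\<theta> + real N + 1))"
proof -
  have "split_weight \<theta> N i = real (N choose i) * (\<integral>v. v ^ i * (1 - v) ^ (N - i) \<partial>beta1 \<theta>)"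
    unfolding split_weight_def Bernstein_def by (simp add: mult.assoc)
  also have "(\<integral>v. v ^ i * (1 - v) ^ (N - i) \<partial>beta1 \<theta>) = \<theta> * Beta (real i + 1) (\<theta> + real (N - i))"
  proof (subst integral_eq_nn_integral)
    show "AE v in beta1 \<theta>. 0 \<le> v ^ i * (1 - v) ^ (N - i)" using AE_beta1[of \<theta>] by auto
    show "enn2real (\<integral>\<^sup>+v. ennreal (v ^ i * (1 - v) ^ (N - i)) \<partial>beta1 \<theta>) = \<theta> * Beta (real i + 1) (\<theta> + real (N - i))"
      unfolding nn_integral_beta1_monomial[OF assms(1)]
      using assms by (intro enn2real_ennreal) (simp add: Beta_def Gamma_real_nonneg)
  qed simp
  also have "\<dots> = \<theta> * (fact i * Gamma (\<theta> + real N - real i) / Gamma (\<theta> + real N + 1))"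
    using assms Gamma_fact[of i, where 'a=real]
    by (simp add: Beta_def of_nat_diff algebra_simps)
  finally show ?thesis using assms(2)
    by (simp add: binomial_fact)
qed

lemma split_weight_outside: "N < i \<Longrightarrow> split_weight \<theta> N i = 0"
  unfolding split_weight_def by (simp add: Bernstein_def[abs_def] binomial_eq_0)

text \<open>One step of the urn. With \<open>N + 2\<close> vertices in total, index \<open>i\<close>
  stands for a first subtree of \<open>i + 1\<close> vertices. Index \<open>i\<close> is reached
  from \<open>i - 1\<close> by hitting that subtree, of weight \<open>i\<close> at that time, or
  kept by hitting the rest, of weight \<open>\<theta> + N - i\<close>; the total weight is
  \<open>\<theta> + N + 1\<close>.\<close>

lemma split_weight_Suc:
  assumes "\<theta> > 0" "i \<le> Suc N"
  shows "(\<theta> + real N + 1) * split_weight \<theta> (Suc N) i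
    = (if i = 0 then 0 else real i * split_weight \<theta> N (i - 1)) + (\<theta> + real N - real i) * split_weight \<theta> N i"
proof -
  let ?G = "Gamma (\<theta> + real N + 1)"
  have "?G \<noteq> 0" using assms by (intro less_imp_neq[symmetric] Gamma_real_pos) simp
  then have G: "?G \<noteq> 0" "Gamma (\<theta> + real (Suc N) + 1) = (\<theta> + real N + 1) * ?G"
    using assms Gamma_real_Suc[of "\<theta> + real N + 1"]
    by (auto simp: add_ac)
  \<comment> \<open>The Gamma factor shared by all three terms, in the last one after the functional
    equation of Gamma. What remains is an identity between factorials.\<close>
  define H where "H = Gamma (\<theta> + real (Suc N) - real i)"
  have lhs: "(\<theta> + real N + 1) * split_weight \<theta> (Suc N) i = \<theta> * (fact (Suc N) / fact (Suc N - i)) * (H / ?G)"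
  proof -
    have cancel: "c * (x * y * (z / (c * g))) = x * y * (z / g)" if "c \<noteq> 0" for c x y z g :: real
      using that by simp
    show ?thesis
      unfolding split_weight_eq_Gamma[OF assms] G(2) H_def[symmetric] using assms(1) by (intro cancel) simp
  qed
  have t1: "(if i = 0 then 0 else real i * split_weight \<theta> N (i - 1)) = real i * (\<theta> * (fact N / fact (Suc N - i)) * (H / ?G))"
  proof (cases i)
    case (Suc i')
    then have i': "i' \<le> N" using assms by simp
    show ?thesis unfolding Suc using split_weight_eq_Gamma[OF assms(1) i']
      by (simp add: H_def Suc add_diff_eq)
  qed simp
  show ?thesis
  proof (cases "i \<le> N")
    case True
    have H: "H = (\<theta> + real N - real i) * Gamma (\<theta> + real N - real i)"
      unfolding H_def using Gamma_real_Suc[of "\<theta> + real N - real i"] assms True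
      by (auto simp: algebra_simps)
    have t2: "(\<theta> + real N - real i) * split_weight \<theta> N i = \<theta> * (fact N / fact (N - i)) * (H / ?G)"
      unfolding split_weight_eq_Gamma[OF assms(1) True] H by simp
    have "fact (Suc N - i) = (real N - real i + 1) * fact (N - i)"
      using True by (simp add: Suc_diff_le of_nat_diff algebra_simps)
    moreover have "(x + c) * f / (c * g) = x * (f / (c * g)) + f / g" if "c \<noteq> 0" for x c f g :: real
      using that by (simp add: add_divide_distrib distrib_right)
    from this[of "real N - real i + 1" "real i" "fact N" "fact (N - i)"]
    have "(1 + real N) * fact N / ((real N - real i + 1) * fact (N - i))
      = real i * (fact N / ((real N - real i + 1) * fact (N - i))) + (fact N / fact (N - i) :: real)"
      using True by (simp add: add.commute)
    ultimately have "fact (Suc N) / fact (Suc N - i) = real i * (fact N / fact (Suc N - i)) + (fact N / fact (N - i) :: real)"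
      by simp
    then show ?thesis unfolding lhs t1 t2 by (simp add: algebra_simps)
  next
    case False
    then have "i = Suc N" using assms by simp
    then show ?thesis unfolding lhs t1 by (simp add: split_weight_outside)
  qed
qed

lemma split_weight_0_0: "\<theta> > 0 \<Longrightarrow> split_weight \<theta> 0 0 = 1"
  using sum_split_weight[of \<theta> 0] by simp

text \<open>Finite analogue of \<open>V\<close>: \<open>i + 1\<close> vertices of the first subtree
  out of \<open>N + 2\<close>, since both parts of a split have at least one vertex.\<close>

abbreviation share :: "nat \<Rightarrow> nat \<Rightarrow> real" where
  "share N i \<equiv> real (Suc i) / real (N + 2)"

section \<open>Concentration of the split around V\<close>

lemma share_bounds: "i \<le> N \<Longrightarrow> 0 < share N i \<and> share N i < 1"
  by (auto simp: field_simps)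

text \<open>Variance of a binomial proportion, adapted to the shift from \<open>i / N\<close> to
  \<open>share N i\<close>. Expanding the square leaves \<open>N v (1 - v) + (1 - 2 v)^2\<close>
  over \<open>(N + 2)^2\<close>, with numerator at most \<open>N + 2\<close>.\<close>

lemma Bernstein_variance:
  assumes "0 \<le> v" "v \<le> 1"
  shows "(\<Sum>i\<le>N. Bernstein N i v * (share N i - v)\<^sup>2) \<le> 1 / real (N + 2)"
proof -
  let ?n = "real N + 2"
  have "(\<Sum>i\<le>N. Bernstein N i v * (share N i - v)\<^sup>2) =
     (\<Sum>i\<le>N. (real i * (real i - 1) * Bernstein N i v + (3 - 2 * ?n * v) * (real i * Bernstein N i v)
        + (1 - ?n * v)\<^sup>2 * Bernstein N i v) / ?n\<^sup>2)"
    by (intro sum.cong refl) (simp add: power2_eq_square divide_simps, simp add: algebra_simps)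
  also have "\<dots> = (real N * (real N - 1) * v\<^sup>2 + (3 - 2 * ?n * v) * (real N * v) + (1 - ?n * v)\<^sup>2) / ?n\<^sup>2"
    by (simp only: sum_divide_distrib[symmetric] sum.distrib sum_distrib_left[symmetric]
        sum_kk_Bernstein sum_k_Bernstein sum_Bernstein) simp
  also have "\<dots> = (real N * (v * (1 - v)) + (1 - 2 * v)\<^sup>2) / ?n\<^sup>2"
    by (simp add: power2_eq_square algebra_simps)
  also have "\<dots> \<le> ?n / ?n\<^sup>2"
  proof (intro divide_right_mono)
    have "v * (1 - v) \<le> 1 * 1" using assms by (intro mult_mono) auto
    then have "real N * (v * (1 - v)) \<le> real N * 1" by (intro mult_left_mono) auto
    moreover have "(1 - 2 * v)\<^sup>2 \<le> 1" using assms by (intro abs_square_le_1[THEN iffD2]) auto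
    ultimately show "real N * (v * (1 - v)) + (1 - 2 * v)\<^sup>2 \<le> ?n" by simp
  qed simp
  finally show ?thesis by (simp add: power2_eq_square add.commute)
qed

text \<open>Chebyshev's inequality, as in Bernstein's proof of the Weierstrass theorem: near the
  diagonal \<open>g\<close> is small, away from it \<open>g\<close> is at most
  \<open>M (u - v)^2 / d^2\<close>, and the averaged square is controlled by
  \<open>Bernstein_variance\<close>.\<close>

lemma split_average_null:
  assumes "\<theta> > 0" and [measurable]: "\<And>u. g u \<in> borel_measurable borel"
    and bnd: "\<And>u v. \<lbrakk>u \<in> {0..1}; v \<in> {0..1}\<rbrakk> \<Longrightarrow> 0 \<le> g u v \<and> g u v \<le> (M::real)"
    and small: "\<And>e. e > 0 \<Longrightarrow> \<exists>d>0. \<forall>u\<in>{0..1}. \<forall>v\<in>{0..1}. \<bar>u - v\<bar> < d \<longrightarrow> g u v \<le> e"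
  shows "(\<lambda>N. \<Sum>i\<le>N. \<integral>v. Bernstein N i v * g (share N i) v \<partial>beta1 \<theta>) \<longlonglongrightarrow> 0"
proof (rule LIMSEQ_I)
  interpret prob_space "beta1 \<theta>" by (rule prob_space_beta1[OF assms(1)])
  fix e :: real assume "e > 0"
  then obtain d where d: "d > 0" "\<And>u v. \<lbrakk>u \<in> {0..1}; v \<in> {0..1}; \<bar>u - v\<bar> < d\<rbrakk> \<Longrightarrow> g u v \<le> e / 2"
    using small[of "e / 2"] by auto
  have M: "M \<ge> 0" using bnd[of 0 0] by auto
  have le: "g u v \<le> e / 2 + M / d\<^sup>2 * (u - v)\<^sup>2" if "u \<in> {0..1}" "v \<in> {0..1}" for u v
  proof (cases "\<bar>u - v\<bar> < d")
    case True
    have "0 \<le> M / d\<^sup>2 * (u - v)\<^sup>2" using M by simp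
    then show ?thesis using d(2)[OF that True] by linarith
  next
    case False
    then have "d\<^sup>2 \<le> (u - v)\<^sup>2" using d(1) by (intro power2_le_iff_abs_le[THEN iffD2, of "\<bar>u - v\<bar>" d, simplified] | simp add: abs_le_square_iff[symmetric])+
    then have "M * 1 \<le> M * ((u - v)\<^sup>2 / d\<^sup>2)" using d(1) M by (intro mult_left_mono) auto
    then have "M \<le> M / d\<^sup>2 * (u - v)\<^sup>2" by simp
    then show ?thesis using bnd[OF that] \<open>e > 0\<close> by linarith
  qed
  obtain n0 :: nat where n0: "real n0 > M / d\<^sup>2 * 2 / e" using reals_Archimedean2 by blast
  show "\<exists>n0. \<forall>N\<ge>n0. norm ((\<Sum>i\<le>N. \<integral>v. Bernstein N i v * g (share N i) v \<partial>beta1 \<theta>) - 0) < e"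
  proof (intro exI allI impI)
    fix N assume N: "N \<ge> n0"
    let ?S = "\<lambda>v. \<Sum>i\<le>N. Bernstein N i v * g (share N i) v"
    have fr: "share N i \<in> {0..1}" if "i \<le> N" for i using share_bounds[OF that] by auto
    have int: "integrable (beta1 \<theta>) (\<lambda>v. Bernstein N i v * g (share N i) v)" if "i \<le> N" for i
      using bnd[OF fr[OF that]] by (intro integrable_Bernstein_mult[where C=M] assms) (auto simp: abs_le_iff)
    have eq: "(\<Sum>i\<le>N. \<integral>v. Bernstein N i v * g (share N i) v \<partial>beta1 \<theta>) = (\<integral>v. ?S v \<partial>beta1 \<theta>)"
      using int by (intro Bochner_Integration.integral_sum[symmetric]) auto
    have "(\<integral>v. ?S v \<partial>beta1 \<theta>) \<le> (\<integral>v. e / 2 + M / d\<^sup>2 * (1 / real (N + 2)) \<partial>beta1 \<theta>)"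
    proof (intro integral_beta1_mono)
      show "integrable (beta1 \<theta>) ?S" using int by (intro Bochner_Integration.integrable_sum) auto
      fix v :: real assume v: "0 < v" "v < 1"
      have "?S v \<le> (\<Sum>i\<le>N. Bernstein N i v * (e / 2 + M / d\<^sup>2 * (share N i - v)\<^sup>2))"
        using v fr by (intro sum_mono mult_left_mono le Bernstein_nonneg) auto
      also have "\<dots> = e / 2 * (\<Sum>i\<le>N. Bernstein N i v) + M / d\<^sup>2 * (\<Sum>i\<le>N. Bernstein N i v * (share N i - v)\<^sup>2)"
        by (simp only: sum_distrib_left sum.distrib[symmetric]) (intro sum.cong refl, simp add: algebra_simps)
      also have "\<dots> \<le> e / 2 * 1 + M / d\<^sup>2 * (1 / real (N + 2))"
        using v M \<open>e > 0\<close> by (intro add_mono mult_left_mono Bernstein_variance) auto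
      finally show "?S v \<le> e / 2 + M / d\<^sup>2 * (1 / real (N + 2))" by simp
    qed simp
    also have "\<dots> = e / 2 + M / d\<^sup>2 * (1 / real (N + 2))" using prob_space by simp
    also have "\<dots> < e"
    proof -
      have "real n0 < real (N + 2)" using N by simp
      then have "M / d\<^sup>2 * 2 / e < real (N + 2)" using n0 by linarith
      moreover have "c * (1 / n) < e / 2" if "c * 2 / e < n" "n > 0" for c n
        using that \<open>e > 0\<close> by (simp add: field_simps)
      ultimately have "M / d\<^sup>2 * (1 / real (N + 2)) < e / 2" by (metis of_nat_0_less_iff zero_less_numeral add_pos_pos trans_less_add2)
      then show ?thesis by linarith
    qed
    finally have "(\<integral>v. ?S v \<partial>beta1 \<theta>) < e" .
    moreover have "0 \<le> (\<integral>v. ?S v \<partial>beta1 \<theta>)"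
      using AE_beta1[of \<theta>] bnd fr by (intro integral_nonneg_AE) (auto intro!: sum_nonneg mult_nonneg_nonneg Bernstein_nonneg)
    ultimately show "norm ((\<Sum>i\<le>N. \<integral>v. Bernstein N i v * g (share N i) v \<partial>beta1 \<theta>) - 0) < e"
      unfolding eq by simp
  qed
qed

text \<open>Since the Bernstein polynomials sum to 1, the integral of \<open>h\<close> splits with
  the same weights and both quantities are compared at the same \<open>v\<close>. The bound is kept
  in terms of increments of \<open>h\<close>, so that a modulus common to a whole class of functions
  can be inserted later.\<close>

lemma split_sum_error:
  assumes "\<theta> > 0" and [measurable]: "h \<in> borel_measurable borel" and M: "\<And>v. v \<in> {0..1} \<Longrightarrow> \<bar>h v\<bar> \<le> M"
  shows "\<bar>(\<Sum>i\<le>N. split_weight \<theta> N i * h (share N i)) - (\<integral>v. h v \<partial>beta1 \<theta>)\<bar>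
     \<le> (\<Sum>i\<le>N. \<integral>v. Bernstein N i v * \<bar>h (share N i) - h v\<bar> \<partial>beta1 \<theta>)"
proof -
  have int: "integrable (beta1 \<theta>) (\<lambda>v. Bernstein N i v * h v)" for i
    using M by (intro integrable_Bernstein_mult[where C=M] assms(1,2)) auto
  have "(\<integral>v. h v \<partial>beta1 \<theta>) = (\<integral>v. (\<Sum>i\<le>N. Bernstein N i v * h v) \<partial>beta1 \<theta>)"
    by (simp add: sum_distrib_right[symmetric])
  also have "\<dots> = (\<Sum>i\<le>N. \<integral>v. Bernstein N i v * h v \<partial>beta1 \<theta>)"
    by (intro Bochner_Integration.integral_sum int)
  finally have "(\<Sum>i\<le>N. split_weight \<theta> N i * h (share N i)) - (\<integral>v. h v \<partial>beta1 \<theta>)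
     = (\<Sum>i\<le>N. (\<integral>v. Bernstein N i v * h (share N i) \<partial>beta1 \<theta>) - (\<integral>v. Bernstein N i v * h v \<partial>beta1 \<theta>))"
    by (simp add: sum_subtractf split_weight_def)
  also have "\<dots> = (\<Sum>i\<le>N. \<integral>v. Bernstein N i v * (h (share N i) - h v) \<partial>beta1 \<theta>)"
  proof (intro sum.cong refl)
    fix i
    show "(\<integral>v. Bernstein N i v * h (share N i) \<partial>beta1 \<theta>) - (\<integral>v. Bernstein N i v * h v \<partial>beta1 \<theta>)
       = (\<integral>v. Bernstein N i v * (h (share N i) - h v) \<partial>beta1 \<theta>)"
      using int integrable_Bernstein[OF assms(1)]
      by (subst Bochner_Integration.integral_diff[symmetric]) (auto simp: algebra_simps)
  qed
  also have "\<bar>\<dots>\<bar> \<le> (\<Sum>i\<le>N. \<bar>\<integral>v. Bernstein N i v * (h (share N i) - h v) \<partial>beta1 \<theta>\<bar>)"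
    by (rule sum_abs)
  also have "\<dots> \<le> (\<Sum>i\<le>N. \<integral>v. Bernstein N i v * \<bar>h (share N i) - h v\<bar> \<partial>beta1 \<theta>)"
  proof (intro sum_mono)
    fix i
    have "\<bar>\<integral>v. Bernstein N i v * (h (share N i) - h v) \<partial>beta1 \<theta>\<bar> \<le> (\<integral>v. \<bar>Bernstein N i v * (h (share N i) - h v)\<bar> \<partial>beta1 \<theta>)"
      by (rule integral_abs_bound)
    also have "\<dots> = (\<integral>v. Bernstein N i v * \<bar>h (share N i) - h v\<bar> \<partial>beta1 \<theta>)"
      using AE_beta1[of \<theta>] by (intro integral_cong_AE) (auto simp: abs_mult Bernstein_nonneg)
    finally show "\<bar>\<integral>v. Bernstein N i v * (h (share N i) - h v) \<partial>beta1 \<theta>\<bar> \<le> (\<integral>v. Bernstein N i v * \<bar>h (share N i) - h v\<bar> \<partial>beta1 \<theta>)" .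
  qed
  finally show ?thesis .
qed

lemma split_sum_tendsto:
  assumes "\<theta> > 0" and [measurable]: "h \<in> borel_measurable borel" and cont: "continuous_on {0..1} h"
  shows "(\<lambda>N. \<Sum>i\<le>N. split_weight \<theta> N i * h (share N i)) \<longlonglongrightarrow> (\<integral>v. h v \<partial>beta1 \<theta>)"
proof -
  have "bounded (h ` {0..1})" by (intro compact_imp_bounded compact_continuous_image cont) simp
  then obtain M where M: "\<And>v. v \<in> {0..1} \<Longrightarrow> \<bar>h v\<bar> \<le> M"
    unfolding bounded_iff real_norm_def by blast
  have uc: "uniformly_continuous_on {0..1} h"
    by (intro compact_uniformly_continuous cont) simp
  have "(\<lambda>N. \<Sum>i\<le>N. \<integral>v. Bernstein N i v * \<bar>h (share N i) - h v\<bar> \<partial>beta1 \<theta>) \<longlonglongrightarrow> 0"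
  proof (rule split_average_null[OF assms(1), where M = "2 * M"])
    show "0 \<le> \<bar>h u - h v\<bar> \<and> \<bar>h u - h v\<bar> \<le> 2 * M" if "u \<in> {0..1}" "v \<in> {0..1}" for u v
      using M[OF that(1)] M[OF that(2)] by auto
    fix e :: real assume "e > 0"
    then obtain d where "d > 0" "\<And>u v. \<lbrakk>u \<in> {0..1}; v \<in> {0..1}; dist v u < d\<rbrakk> \<Longrightarrow> dist (h v) (h u) < e"
      using uc unfolding uniformly_continuous_on_def by meson
    then show "\<exists>d>0. \<forall>u\<in>{0..1}. \<forall>v\<in>{0..1}. \<bar>u - v\<bar> < d \<longrightarrow> \<bar>h u - h v\<bar> \<le> e"
      by (intro exI[of _ d]) (auto simp: dist_real_def abs_minus_commute intro: less_imp_le)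
  qed simp
  moreover note split_sum_error[OF assms(1,2) M]
  ultimately have "(\<lambda>N. (\<Sum>i\<le>N. split_weight \<theta> N i * h (share N i)) - (\<integral>v. h v \<partial>beta1 \<theta>)) \<longlonglongrightarrow> 0"
    by (intro Lim_null_comparison[where f="\<lambda>N. _ N - _"]) (auto intro!: always_eventually)
  then show ?thesis by (rule LIM_zero_cancel)
qed

section \<open>Vanishing weights and the recursions they drive\<close>

lemma Bernstein_tendsto_0:
  assumes "0 < v" "v < 1"
  shows "(\<lambda>N. Bernstein N i v) \<longlonglongrightarrow> 0"
proof (rule Lim_null_comparison)
  show "\<forall>\<^sub>F N in sequentially. norm (Bernstein N i v) \<le> real N ^ i * (1 - v) ^ N / (1 - v) ^ i"
    using eventually_ge_at_top[of i]
  proof eventually_elim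
    case (elim N)
    have "real (N choose i) \<le> real N ^ i"
      using binomial_le_pow[OF elim] by (metis of_nat_le_iff of_nat_power)
    moreover have "v ^ i \<le> 1" using assms by (simp add: power_le_one)
    ultimately have "real (N choose i) * v ^ i \<le> real N ^ i * 1" using assms by (intro mult_mono) auto
    then have "real (N choose i) * v ^ i * (1 - v) ^ (N - i) \<le> real N ^ i * 1 * (1 - v) ^ (N - i)"
      using assms by (intro mult_right_mono) auto
    moreover have "(1 - v) ^ (N - i) = (1 - v) ^ N / (1 - v) ^ i"
      using assms elim by (simp add: power_diff)
    ultimately show ?case using assms by (simp add: Bernstein_def)
  qed
  have "(\<lambda>N. real N ^ i * (1 - v) ^ N) \<longlonglongrightarrow> 0"
    using assms by real_asymp
  then show "(\<lambda>N. real N ^ i * (1 - v) ^ N / (1 - v) ^ i) \<longlonglongrightarrow> 0"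
    using tendsto_divide_zero by blast
qed

lemma integral_Bernstein_tendsto_0:
  assumes "\<theta> > 0" "\<And>v. \<lbrakk>0 < v; v < 1\<rbrakk> \<Longrightarrow> (\<lambda>N. Bernstein N (j N) v) \<longlonglongrightarrow> 0"
  shows "(\<lambda>N. split_weight \<theta> N (j N)) \<longlonglongrightarrow> 0"
proof -
  interpret prob_space "beta1 \<theta>" by (rule prob_space_beta1[OF assms(1)])
  have "(\<lambda>N. \<integral>v. Bernstein N (j N) v \<partial>beta1 \<theta>) \<longlonglongrightarrow> (\<integral>v. 0 \<partial>beta1 \<theta>)"
  proof (rule integral_dominated_convergence[where w = "\<lambda>_. 1"])
    show "AE v in beta1 \<theta>. (\<lambda>N. Bernstein N (j N) v) \<longlonglongrightarrow> 0"
      using AE_beta1[of \<theta>] assms(2) by auto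
    show "AE v in beta1 \<theta>. norm (Bernstein N (j N) v) \<le> 1" for N
      using AE_beta1[of \<theta>] by (auto simp: Bernstein_nonneg Bernstein_le_1)
  qed auto
  then show ?thesis by (simp add: split_weight_def)
qed

lemma split_weight_tendsto_0: "\<theta> > 0 \<Longrightarrow> (\<lambda>N. split_weight \<theta> N i) \<longlonglongrightarrow> 0"
  by (intro integral_Bernstein_tendsto_0 Bernstein_tendsto_0)

text \<open>Reflecting \<open>v\<close> to \<open>1 - v\<close> turns the last indices into the
  first ones; these are the splits that leave a rest of bounded size.\<close>

lemma split_weight_reflected_tendsto_0:
  assumes "\<theta> > 0"
  shows "(\<lambda>N. split_weight \<theta> N (N - i)) \<longlonglongrightarrow> 0"
proof (intro integral_Bernstein_tendsto_0 assms)
  fix v :: real assume v: "0 < v" "v < 1"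
  have "(\<lambda>N. Bernstein N i (1 - v)) \<longlonglongrightarrow> 0" using v by (intro Bernstein_tendsto_0) auto
  then show "(\<lambda>N. Bernstein N (N - i) v) \<longlonglongrightarrow> 0"
  proof (rule Lim_transform_eventually)
    show "\<forall>\<^sub>F N in sequentially. Bernstein N i (1 - v) = Bernstein N (N - i) v"
      using eventually_ge_at_top[of i]
      by eventually_elim (simp add: Bernstein_def binomial_symmetric[symmetric])
  qed
qed

text \<open>Toeplitz's lemma: finitely many early terms lose their weight, the others are
  small.\<close>

lemma weighted_sum_null:
  fixes w :: "nat \<Rightarrow> nat \<Rightarrow> real"
  assumes "\<And>N i. w N i \<ge> 0" "\<And>N. (\<Sum>i\<le>N. w N i) = 1" "\<And>i. (\<lambda>N. w N i) \<longlonglongrightarrow> 0" "z \<longlonglongrightarrow> 0"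
  shows "(\<lambda>N. \<Sum>i\<le>N. w N i * z i) \<longlonglongrightarrow> 0"
proof (rule LIMSEQ_I)
  fix e :: real assume e: "e > 0"
  then obtain m where m: "\<And>i. i \<ge> m \<Longrightarrow> \<bar>z i\<bar> < e / 2"
    using LIMSEQ_D[OF assms(4), of "e / 2"] by auto
  have "(\<lambda>N. \<Sum>i<m. w N i * \<bar>z i\<bar>) \<longlonglongrightarrow> (\<Sum>i<m. 0 * \<bar>z i\<bar>)"
    by (intro tendsto_intros assms)
  then have "(\<lambda>N. \<Sum>i<m. w N i * \<bar>z i\<bar>) \<longlonglongrightarrow> 0" by simp
  then obtain n0 where n0: "\<And>N. N \<ge> n0 \<Longrightarrow> \<bar>\<Sum>i<m. w N i * \<bar>z i\<bar>\<bar> < e / 2"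
    using LIMSEQ_D[of "\<lambda>N. \<Sum>i<m. w N i * \<bar>z i\<bar>" 0 "e / 2"] e unfolding real_norm_def diff_zero by (meson half_gt_zero)
  show "\<exists>n0. \<forall>N\<ge>n0. norm ((\<Sum>i\<le>N. w N i * z i) - 0) < e"
  proof (intro exI allI impI)
    fix N assume N: "N \<ge> n0 + m"
    have "\<bar>\<Sum>i\<le>N. w N i * z i\<bar> \<le> (\<Sum>i\<le>N. \<bar>w N i * z i\<bar>)" by (rule sum_abs)
    also have "\<dots> \<le> (\<Sum>i\<le>N. w N i * (e / 2) + (if i < m then w N i * \<bar>z i\<bar> else 0))"
    proof (intro sum_mono)
      fix i
      have "w N i * \<bar>z i\<bar> \<le> w N i * (e / 2)" if "\<not> i < m"
        using assms(1)[of N i] m[of i] that by (intro mult_left_mono) auto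
      then show "\<bar>w N i * z i\<bar> \<le> w N i * (e / 2) + (if i < m then w N i * \<bar>z i\<bar> else 0)"
        using assms(1)[of N i] e by (auto simp: abs_mult)
    qed
    also have "\<dots> = e / 2 + (\<Sum>i\<in>{i\<in>{..N}. i < m}. w N i * \<bar>z i\<bar>)"
      by (simp add: sum.distrib sum_distrib_right[symmetric] assms(2) sum_divide_distrib[symmetric] flip: sum.inter_filter)
    also have "{i\<in>{..N}. i < m} = {..<m}" using N by auto
    also have "e / 2 + (\<Sum>i<m. w N i * \<bar>z i\<bar>) < e" using n0[of N] N by auto
    finally show "norm ((\<Sum>i\<le>N. w N i * z i) - 0) < e" by simp
  qed
qed

lemma split_sum_null:
  assumes "\<theta> > 0" "z \<longlonglongrightarrow> 0"
  shows "(\<lambda>N. \<Sum>i\<le>N. split_weight \<theta> N i * z i) \<longlonglongrightarrow> 0"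
  using assms by (intro weighted_sum_null split_weight_nonneg sum_split_weight split_weight_tendsto_0)

lemma split_sum_reflected_null:
  assumes "\<theta> > 0" "z \<longlonglongrightarrow> 0"
  shows "(\<lambda>N. \<Sum>i\<le>N. split_weight \<theta> N i * z (N - i)) \<longlonglongrightarrow> 0"
proof -
  have "(\<lambda>N. \<Sum>i\<le>N. split_weight \<theta> N (N - i) * z i) \<longlonglongrightarrow> 0"
    using assms sum.nat_diff_reindex[of "\<lambda>i. split_weight \<theta> N i" "Suc N" for N] sum_split_weight[OF assms(1)]
    by (intro weighted_sum_null split_weight_nonneg split_weight_reflected_tendsto_0)
       (auto simp: lessThan_Suc_atMost)
  moreover have "(\<Sum>i\<le>N. split_weight \<theta> N i * z (N - i)) = (\<Sum>i\<le>N. split_weight \<theta> N (N - i) * z i)" for N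
    by (rule sum.reindex_bij_witness[of _ "\<lambda>i. N - i" "\<lambda>i. N - i"]) auto
  ultimately show ?thesis by simp
qed

text \<open>The limit superior \<open>L\<close> of \<open>d\<close> satisfies
  \<open>L \<le> q L\<close>, hence is 0. Its finiteness comes first, as an a priori bound
  \<open>B\<close> by strong induction; then the asymptotic bound is lowered from \<open>C\<close>
  to \<open>r C\<close>, repeatedly and starting from \<open>B\<close>. Early terms, of which only
  \<open>B\<close> is known, have vanishing weight.\<close>

lemma recursion_null:
  fixes a :: "nat \<Rightarrow> nat \<Rightarrow> real" and e d :: "nat \<Rightarrow> real"
  assumes a: "\<And>N i. a N i \<ge> 0" "\<And>i. (\<lambda>N. a N i) \<longlonglongrightarrow> 0" "(\<lambda>N. \<Sum>i\<le>N. a N i) \<longlonglongrightarrow> q" "q < 1"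
    and d: "\<And>n. d n \<ge> 0" and rec: "\<And>N. d (Suc N) \<le> (\<Sum>i\<le>N. a N i * d i) + e N" and e: "e \<longlonglongrightarrow> 0"
  shows "d \<longlonglongrightarrow> 0"
proof -
  obtain r where r: "q < r" "r < 1" using dense[OF a(4)] by blast
  have q0: "q \<ge> 0" by (rule LIMSEQ_le_const[OF a(3)]) (auto intro: sum_nonneg a)
  have "\<forall>\<^sub>F N in sequentially. (\<Sum>i\<le>N. a N i) < r" "\<forall>\<^sub>F N in sequentially. e N < 1"
    using order_tendstoD(2)[OF a(3) r(1)] order_tendstoD(2)[OF e, of 1] by auto
  then obtain N0 where N0: "\<And>N. N \<ge> N0 \<Longrightarrow> (\<Sum>i\<le>N. a N i) < r" "\<And>N. N \<ge> N0 \<Longrightarrow> e N < 1"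
    unfolding eventually_sequentially by (metis nle_le order_trans)
  \<comment> \<open>The entry \<open>1 / (1 - r)\<close> makes \<open>r * B + 1 \<le> B\<close>,
    which closes the induction beyond \<open>N0\<close>; the other entries cover the start.\<close>
  define B where "B = Max (insert (1 / (1 - r)) (d ` {..N0}))"
  have B: "1 / (1 - r) \<le> B" "\<And>n. n \<le> N0 \<Longrightarrow> d n \<le> B"
    unfolding B_def by (auto intro!: Max_ge simp del: Max_insert)
  have "B > 0" using B(1) r by (smt (verit) zero_less_divide_1_iff)
  have dB: "d n \<le> B" for n
  proof (induction n rule: less_induct)
    case (less n)
    show ?case
    proof (cases "n \<le> N0")
      case False
      then obtain N where N: "n = Suc N" "N \<ge> N0" by (cases n) auto
      have "d n \<le> (\<Sum>i\<le>N. a N i * d i) + e N" using rec N by simp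
      also have "(\<Sum>i\<le>N. a N i * d i) \<le> (\<Sum>i\<le>N. a N i * B)"
        using less N a by (intro sum_mono mult_left_mono) auto
      also have "\<dots> \<le> r * B" using N0(1)[OF N(2)] \<open>B > 0\<close> by (simp add: sum_distrib_right[symmetric])
      finally have "d n \<le> r * B + 1" using N0(2)[OF N(2)] by simp
      also have "\<dots> \<le> B" using B(1) r by (simp add: field_simps)
      finally show ?thesis .
    qed (use B in auto)
  qed
  \<comment> \<open>\<open>C\<close> plays the role of a bound on the limit superior; the slack
    \<open>x\<close> expresses this without forming one.\<close>
  have step: "\<forall>x>0. \<forall>\<^sub>F n in sequentially. d n \<le> r * C + x"
    if C: "\<forall>x>0. \<forall>\<^sub>F n in sequentially. d n \<le> C + x" "C \<ge> 0" for C
  proof (intro allI impI)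
    fix x :: real assume x: "x > 0"
    obtain m where m: "\<And>n. n \<ge> m \<Longrightarrow> d n \<le> C + x / 3"
      using C(1)[rule_format, of "x / 3"] x unfolding eventually_sequentially by auto
    have "(\<lambda>N. \<Sum>i<m. a N i * B) \<longlonglongrightarrow> (\<Sum>i<m. 0 * B)" by (intro tendsto_intros a)
    then have "\<forall>\<^sub>F N in sequentially. (\<Sum>i<m. a N i * B) < x / 3"
      using x by (intro order_tendstoD(2)[of _ 0]) auto
    moreover have "\<forall>\<^sub>F N in sequentially. e N < x / 3" using x by (intro order_tendstoD(2)[OF e]) auto
    moreover have "\<forall>\<^sub>F N in sequentially. N \<ge> N0 + m" by (rule eventually_ge_at_top)
    ultimately have "\<forall>\<^sub>F N in sequentially. d (Suc N) \<le> r * C + x"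
    proof eventually_elim
      case (elim N)
      have "(\<Sum>i\<le>N. a N i * d i) \<le> (\<Sum>i\<le>N. a N i * (C + x / 3) + (if i < m then a N i * B else 0))"
      proof (intro sum_mono)
        fix i
        have "a N i * d i \<le> a N i * B" "i \<ge> m \<Longrightarrow> a N i * d i \<le> a N i * (C + x / 3)" "0 \<le> a N i * (C + x / 3)"
          using a(1)[of N i] dB[of i] m[of i] C(2) x by (auto intro!: mult_left_mono)
        then show "a N i * d i \<le> a N i * (C + x / 3) + (if i < m then a N i * B else 0)" by auto
      qed
      also have "\<dots> = (\<Sum>i\<le>N. a N i) * (C + x / 3) + (\<Sum>i\<in>{i\<in>{..N}. i < m}. a N i * B)"
        by (simp only: sum.distrib sum_distrib_right sum.inter_filter finite_atMost)
      also have "{i\<in>{..N}. i < m} = {..<m}" using elim by auto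
      also have "(\<Sum>i\<le>N. a N i) * (C + x / 3) \<le> r * (C + x / 3)"
        using N0(1)[of N] elim C(2) x by (intro mult_right_mono) auto
      finally have "(\<Sum>i\<le>N. a N i * d i) \<le> r * (C + x / 3) + x / 3" using elim by simp
      moreover have "r * (x / 3) \<le> 1 * (x / 3)" using r x by (intro mult_right_mono) auto
      ultimately show ?case using rec[of N] elim by (simp add: algebra_simps)
    qed
    then show "\<forall>\<^sub>F n in sequentially. d n \<le> r * C + x"
      by (rule eventually_sequentially_Suc[THEN iffD1])
  qed
  have iter: "\<forall>x>0. \<forall>\<^sub>F n in sequentially. d n \<le> r ^ k * B + x" for k
  proof (induction k)
    case 0
    then show ?case using dB by (auto intro!: always_eventually order_trans[OF dB])
  next
    case (Suc k)
    have "0 \<le> r ^ k * B" using r q0 \<open>B > 0\<close> by simp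
    then show ?case using step[OF Suc] by (simp add: mult.assoc)
  qed
  show ?thesis
  proof (rule LIMSEQ_I)
    fix x :: real assume x: "x > 0"
    have "(\<lambda>k. r ^ k * B) \<longlonglongrightarrow> 0 * B" using r q0 by (intro tendsto_intros LIMSEQ_realpow_zero) auto
    then have "\<forall>\<^sub>F k in sequentially. r ^ k * B < x / 2" using x by (intro order_tendstoD(2)[of _ 0]) auto
    then obtain k where k: "r ^ k * B < x / 2" by (auto simp: eventually_sequentially)
    obtain m where "\<And>n. n \<ge> m \<Longrightarrow> d n \<le> r ^ k * B + x / 4"
      using iter[rule_format, of "x / 4" k] x unfolding eventually_sequentially by auto
    then have "d n < x" if "n \<ge> m" for n
      using k x by (intro le_less_trans[OF \<open>\<And>n. n \<ge> m \<Longrightarrow> d n \<le> r ^ k * B + x / 4\<close>[OF that]]) linarith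
    then show "\<exists>m. \<forall>n\<ge>m. norm (d n - 0) < x"
      using d by auto
  qed
qed

text \<open>The unknown is evaluated at the size \<open>N - i + 1\<close> of the rest, so the
  weights are reflected to \<open>j = N - i\<close>. As this size is at least 1,
  \<open>recursion_null\<close> is applied to the sequence shifted by one.\<close>

lemma split_recursion_null:
  assumes \<theta>: "\<theta> > 0" and \<alpha>: "\<alpha> \<in> borel_measurable borel" "continuous_on {0..1} \<alpha>"
      "\<And>v. \<lbrakk>0 \<le> v; v \<le> 1\<rbrakk> \<Longrightarrow> 0 \<le> \<alpha> v \<and> \<alpha> v \<le> 1" "(\<integral>v. \<alpha> v \<partial>beta1 \<theta>) < 1"
    and d: "\<And>n. d n \<ge> 0" and e: "e \<longlonglongrightarrow> 0"
    and rec: "\<And>N. d (N + 2) \<le> (\<Sum>i\<le>N. split_weight \<theta> N i * (\<alpha> (share N i) * d (Suc (N - i)))) + e N"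
  shows "d \<longlonglongrightarrow> 0"
proof -
  let ?a = "\<lambda>N j. split_weight \<theta> N (N - j) * \<alpha> (share N (N - j))"
  have \<alpha>01: "0 \<le> \<alpha> (share N (N - j))" "\<alpha> (share N (N - j)) \<le> 1" for N j
    using share_bounds[of "N - j" N] by (auto intro!: \<alpha>(3)[THEN conjunct1] \<alpha>(3)[THEN conjunct2] simp del: of_nat_Suc of_nat_add)
  have "(\<lambda>n. d (Suc n)) \<longlonglongrightarrow> 0"
  proof (rule recursion_null[where a="?a" and q="\<integral>v. \<alpha> v \<partial>beta1 \<theta>", OF _ _ _ \<alpha>(4) d _ e])
    show "?a N j \<ge> 0" for N j using split_weight_nonneg \<alpha>01 by (intro mult_nonneg_nonneg)
    show "(\<lambda>N. ?a N j) \<longlonglongrightarrow> 0" for j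
    proof (rule Lim_null_comparison[OF _ split_weight_reflected_tendsto_0[OF \<theta>]])
      show "\<forall>\<^sub>F N in sequentially. norm (?a N j) \<le> split_weight \<theta> N (N - j)"
        using \<alpha>01 split_weight_nonneg by (intro always_eventually allI) (simp only: real_norm_def abs_mult abs_of_nonneg mult_right_le_one_le)
    qed
    have reflect: "(\<Sum>j\<le>N. f (N - j) j) = (\<Sum>i\<le>N. f i (N - i))" for f :: "nat \<Rightarrow> nat \<Rightarrow> real" and N
      by (rule sum.reindex_bij_witness[of _ "\<lambda>i. N - i" "\<lambda>i. N - i"]) auto
    show "(\<lambda>N. \<Sum>j\<le>N. ?a N j) \<longlonglongrightarrow> (\<integral>v. \<alpha> v \<partial>beta1 \<theta>)"
      unfolding reflect[of "\<lambda>i _. split_weight \<theta> N i * \<alpha> (share N i)" N for N]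
      by (rule split_sum_tendsto[OF \<theta> \<alpha>(1,2)])
    show "d (Suc (Suc N)) \<le> (\<Sum>j\<le>N. ?a N j * d (Suc j)) + e N" for N
      unfolding reflect[of "\<lambda>i j. split_weight \<theta> N i * \<alpha> (share N i) * d (Suc j)"]
      using rec[of N] by (simp add: mult.assoc)
  qed
  then show ?thesis by (rule LIMSEQ_imp_Suc)
qed

lemma split_recursion_tendsto:
  assumes \<theta>: "\<theta> > 0" and \<alpha>: "\<alpha> \<in> borel_measurable borel" "continuous_on {0..1} \<alpha>"
      "\<And>v. \<lbrakk>0 \<le> v; v \<le> 1\<rbrakk> \<Longrightarrow> 0 \<le> \<alpha> v \<and> \<alpha> v \<le> 1" "(\<integral>v. \<alpha> v \<partial>beta1 \<theta>) < 1"
    and g: "g \<longlonglongrightarrow> G"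
    and rec: "\<And>N. a (N + 2) = (\<Sum>i\<le>N. split_weight \<theta> N i * (\<alpha> (share N i) * a (Suc (N - i)))) + g N"
  shows "a \<longlonglongrightarrow> G / (1 - (\<integral>v. \<alpha> v \<partial>beta1 \<theta>))"
proof -
  define q where "q = (\<integral>v. \<alpha> v \<partial>beta1 \<theta>)"
  \<comment> \<open>The only possible limit: letting \<open>N\<close> tend to infinity in the
    recursion gives \<open>A = q A + G\<close>. The deviation \<open>a n - A\<close> obeys the same
    recursion with a toll tending to 0.\<close>
  define A where "A = G / (1 - q)"
  have A: "A * q + G - A = 0" using \<alpha>(4) by (simp add: A_def q_def[symmetric] field_simps)
  define e where "e N = A * (\<Sum>i\<le>N. split_weight \<theta> N i * \<alpha> (share N i)) + g N - A" for N
  have "e \<longlonglongrightarrow> A * q + G - A"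
    unfolding e_def q_def by (intro tendsto_intros split_sum_tendsto \<theta> \<alpha> g)
  then have e: "(\<lambda>N. \<bar>e N\<bar>) \<longlonglongrightarrow> 0" unfolding A by (rule tendsto_rabs_zero)
  have "(\<lambda>n. \<bar>a n - A\<bar>) \<longlonglongrightarrow> 0"
  proof (rule split_recursion_null[OF \<theta> \<alpha> _ e])
    fix N
    have "a (N + 2) - A = (\<Sum>i\<le>N. split_weight \<theta> N i * (\<alpha> (share N i) * (a (Suc (N - i)) - A))) + e N"
    proof -
      have "(\<Sum>i\<le>N. split_weight \<theta> N i * (\<alpha> (share N i) * (a (Suc (N - i)) - A)))
          = (\<Sum>i\<le>N. split_weight \<theta> N i * (\<alpha> (share N i) * a (Suc (N - i)))) - A * (\<Sum>i\<le>N. split_weight \<theta> N i * \<alpha> (share N i))"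
        unfolding sum_distrib_left sum_subtractf[symmetric] by (intro sum.cong refl) (simp add: algebra_simps)
      then show ?thesis unfolding rec e_def by simp
    qed
    also have "\<bar>\<dots>\<bar> \<le> (\<Sum>i\<le>N. \<bar>split_weight \<theta> N i * (\<alpha> (share N i) * (a (Suc (N - i)) - A))\<bar>) + \<bar>e N\<bar>"
      by (rule order_trans[OF abs_triangle_ineq add_right_mono[OF sum_abs]])
    also have "(\<Sum>i\<le>N. \<bar>split_weight \<theta> N i * (\<alpha> (share N i) * (a (Suc (N - i)) - A))\<bar>)
        = (\<Sum>i\<le>N. split_weight \<theta> N i * (\<alpha> (share N i) * \<bar>a (Suc (N - i)) - A\<bar>))"
    proof (intro sum.cong refl)
      fix i assume "i \<in> {..N}"
      then have "0 \<le> \<alpha> (share N i)" using share_bounds[of i N] \<alpha>(3)[of "share N i"] by simp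
      then show "\<bar>split_weight \<theta> N i * (\<alpha> (share N i) * (a (Suc (N - i)) - A))\<bar>
          = split_weight \<theta> N i * (\<alpha> (share N i) * \<bar>a (Suc (N - i)) - A\<bar>)"
        using split_weight_nonneg[of \<theta> N i] by (simp only: abs_mult abs_of_nonneg)
    qed
    finally show "\<bar>a (N + 2) - A\<bar> \<le> (\<Sum>i\<le>N. split_weight \<theta> N i * (\<alpha> (share N i) * \<bar>a (Suc (N - i)) - A\<bar>)) + \<bar>e N\<bar>" .
  qed (rule abs_ge_zero | assumption)+
  then show ?thesis unfolding q_def[symmetric] A_def[symmetric]
    by (simp add: tendsto_rabs_zero_iff LIM_zero_iff)
qed

lemma continuous_unit_bounded:
  fixes h :: "real \<Rightarrow> real"
  assumes "continuous_on {0..1} h"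
  obtains M where "\<And>v. \<lbrakk>0 \<le> v; v \<le> 1\<rbrakk> \<Longrightarrow> \<bar>h v\<bar> \<le> M"
proof -
  have "bounded (h ` {0..1})" by (intro compact_imp_bounded compact_continuous_image assms) simp
  then show ?thesis using that unfolding bounded_iff real_norm_def by (metis atLeastAtMost_iff image_eqI)
qed

text \<open>Writing the factor as \<open>L\<close> plus a null sequence separates an average of
  \<open>h\<close> from an error killed by Toeplitz's lemma. The two forms serve factors attached to
  the first subtree and to the rest.\<close>

lemma split_sum_product_tendsto:
  assumes \<theta>: "\<theta> > 0" and h: "h \<in> borel_measurable borel" "continuous_on {0..1} h" and z: "z \<longlonglongrightarrow> L"
  shows "(\<lambda>N. \<Sum>i\<le>N. split_weight \<theta> N i * (h (share N i) * z (Suc i))) \<longlonglongrightarrow> (\<integral>v. h v \<partial>beta1 \<theta>) * L"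
    and "(\<lambda>N. \<Sum>i\<le>N. split_weight \<theta> N i * (h (share N i) * z (Suc (N - i)))) \<longlonglongrightarrow> (\<integral>v. h v \<partial>beta1 \<theta>) * L"
proof -
  obtain M where M: "\<And>v. \<lbrakk>0 \<le> v; v \<le> 1\<rbrakk> \<Longrightarrow> \<bar>h v\<bar> \<le> M" using continuous_unit_bounded[OF h(2)] by blast
  have z0: "(\<lambda>n. \<bar>z (Suc n) - L\<bar>) \<longlonglongrightarrow> 0"
    by (intro tendsto_rabs_zero LIM_zero LIMSEQ_Suc z)
  have main: "(\<lambda>N. \<Sum>i\<le>N. split_weight \<theta> N i * (h (share N i) * y N i)) \<longlonglongrightarrow> (\<integral>v. h v \<partial>beta1 \<theta>) * L"
    if y: "(\<lambda>N. \<Sum>i\<le>N. split_weight \<theta> N i * \<bar>y N i - L\<bar>) \<longlonglongrightarrow> 0" for y :: "nat \<Rightarrow> nat \<Rightarrow> real"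
  proof -
    have "(\<lambda>N. \<Sum>i\<le>N. split_weight \<theta> N i * (h (share N i) * (y N i - L))) \<longlonglongrightarrow> 0"
    proof (rule Lim_null_comparison)
      show "\<forall>\<^sub>F N in sequentially. norm (\<Sum>i\<le>N. split_weight \<theta> N i * (h (share N i) * (y N i - L)))
          \<le> M * (\<Sum>i\<le>N. split_weight \<theta> N i * \<bar>y N i - L\<bar>)"
      proof (intro always_eventually allI)
        fix N
        have "\<bar>\<Sum>i\<le>N. split_weight \<theta> N i * (h (share N i) * (y N i - L))\<bar>
            \<le> (\<Sum>i\<le>N. \<bar>split_weight \<theta> N i * (h (share N i) * (y N i - L))\<bar>)" by (rule sum_abs)
        also have "\<dots> \<le> (\<Sum>i\<le>N. split_weight \<theta> N i * (M * \<bar>y N i - L\<bar>))"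
        proof (intro sum_mono)
          fix i assume "i \<in> {..N}"
          then have "\<bar>h (share N i)\<bar> \<le> M" using share_bounds[of i N] by (intro M) (simp_all del: of_nat_Suc of_nat_add)
          then show "\<bar>split_weight \<theta> N i * (h (share N i) * (y N i - L))\<bar> \<le> split_weight \<theta> N i * (M * \<bar>y N i - L\<bar>)"
            unfolding abs_mult abs_of_nonneg[OF split_weight_nonneg]
            by (intro mult_left_mono mult_right_mono split_weight_nonneg) auto
        qed
        finally show "norm (\<Sum>i\<le>N. split_weight \<theta> N i * (h (share N i) * (y N i - L)))
            \<le> M * (\<Sum>i\<le>N. split_weight \<theta> N i * \<bar>y N i - L\<bar>)"
          by (simp add: sum_distrib_left mult_ac)
      qed
      show "(\<lambda>N. M * (\<Sum>i\<le>N. split_weight \<theta> N i * \<bar>y N i - L\<bar>)) \<longlonglongrightarrow> 0"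
        using tendsto_mult_right_zero[OF y] .
    qed
    moreover have "(\<lambda>N. (\<Sum>i\<le>N. split_weight \<theta> N i * h (share N i)) * L) \<longlonglongrightarrow> (\<integral>v. h v \<partial>beta1 \<theta>) * L"
      by (intro tendsto_intros split_sum_tendsto \<theta> h)
    ultimately have "(\<lambda>N. (\<Sum>i\<le>N. split_weight \<theta> N i * h (share N i)) * L
        + (\<Sum>i\<le>N. split_weight \<theta> N i * (h (share N i) * (y N i - L)))) \<longlonglongrightarrow> (\<integral>v. h v \<partial>beta1 \<theta>) * L + 0"
      by (intro tendsto_add)
    moreover have "(\<Sum>i\<le>N. split_weight \<theta> N i * h (share N i)) * L
        + (\<Sum>i\<le>N. split_weight \<theta> N i * (h (share N i) * (y N i - L))) = (\<Sum>i\<le>N. split_weight \<theta> N i * (h (share N i) * y N i))" for N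
      unfolding sum_distrib_right sum.distrib[symmetric] by (intro sum.cong refl) (simp add: algebra_simps)
    ultimately show ?thesis by (simp only: add_0_right)
  qed
  show "(\<lambda>N. \<Sum>i\<le>N. split_weight \<theta> N i * (h (share N i) * z (Suc i))) \<longlonglongrightarrow> (\<integral>v. h v \<partial>beta1 \<theta>) * L"
    by (rule main[OF split_sum_null[OF \<theta> z0]])
  show "(\<lambda>N. \<Sum>i\<le>N. split_weight \<theta> N i * (h (share N i) * z (Suc (N - i)))) \<longlonglongrightarrow> (\<integral>v. h v \<partial>beta1 \<theta>) * L"
    by (rule main[OF split_sum_reflected_null[OF \<theta> z0]])
qed

text \<open>Made for the tolls, which depend on \<open>N\<close> as well as on \<open>i\<close> and
  approach a function of the share uniformly in \<open>i\<close>.\<close>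

lemma split_sum_uniform_tendsto:
  assumes \<theta>: "\<theta> > 0" and h: "h \<in> borel_measurable borel" "continuous_on {0..1} h"
    and p: "\<And>x. x > 0 \<Longrightarrow> \<forall>\<^sub>F N in sequentially. \<forall>i\<le>N. \<bar>p N i - h (share N i)\<bar> \<le> x"
  shows "(\<lambda>N. \<Sum>i\<le>N. split_weight \<theta> N i * p N i) \<longlonglongrightarrow> (\<integral>v. h v \<partial>beta1 \<theta>)"
proof -
  have "(\<lambda>N. \<Sum>i\<le>N. split_weight \<theta> N i * (p N i - h (share N i))) \<longlonglongrightarrow> 0"
  proof (rule tendstoI)
    fix x :: real assume x: "x > 0"
    show "\<forall>\<^sub>F N in sequentially. dist (\<Sum>i\<le>N. split_weight \<theta> N i * (p N i - h (share N i))) 0 < x"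
      using p[OF half_gt_zero[OF x]]
    proof eventually_elim
      case (elim N)
      have "\<bar>\<Sum>i\<le>N. split_weight \<theta> N i * (p N i - h (share N i))\<bar> \<le> (\<Sum>i\<le>N. \<bar>split_weight \<theta> N i * (p N i - h (share N i))\<bar>)"
        by (rule sum_abs)
      also have "\<dots> \<le> (\<Sum>i\<le>N. split_weight \<theta> N i * (x / 2))"
      proof (intro sum_mono)
        fix i assume "i \<in> {..N}"
        then have "\<bar>p N i - h (share N i)\<bar> \<le> x / 2" using elim by blast
        then show "\<bar>split_weight \<theta> N i * (p N i - h (share N i))\<bar> \<le> split_weight \<theta> N i * (x / 2)"
          unfolding abs_mult abs_of_nonneg[OF split_weight_nonneg] by (intro mult_left_mono split_weight_nonneg)
      qed
      also have "\<dots> = x / 2" by (simp only: sum_distrib_right[symmetric] sum_split_weight[OF \<theta>])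
      finally show ?case using x by simp
    qed
  qed
  from tendsto_add[OF this split_sum_tendsto[OF \<theta> h]] show ?thesis
    by (simp add: sum.distrib[symmetric] right_diff_distrib)
qed

section \<open>Recursive decomposition\<close>

context
  fixes \<theta> :: real
  assumes \<theta>: "\<theta> > 0"
begin

lemma pmf_hoppe_J:
  assumes "k \<ge> 1"
  shows "pmf (hoppe_J \<theta> k) i = (if i = 0 then \<theta> / (\<theta> + real k - 1) else if i < k then 1 / (\<theta> + real k - 1) else 0)"
    (is "_ = ?f i")
  unfolding hoppe_J_def
proof (rule pmf_embed_pmf)
  show nonneg: "0 \<le> ?f x" for x using assms \<theta> by auto
  have "(\<integral>\<^sup>+x. ennreal (?f x) \<partial>count_space UNIV) = (\<Sum>x<k. ennreal (?f x))"
    using assms by (intro nn_integral_count_space') auto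
  also have "\<dots> = ennreal (\<Sum>x<k. ?f x)"
    by (intro sum_ennreal nonneg)
  also have "(\<Sum>x<k. ?f x) = \<theta> / (\<theta> + real k - 1) + (\<Sum>x\<in>{1..<k}. 1 / (\<theta> + real k - 1))"
  proof -
    have "{..<k} = insert 0 {1..<k}" using assms by auto
    then show ?thesis by simp
  qed
  also have "\<dots> = (\<theta> + real k - 1) / (\<theta> + real k - 1)"
    using assms by (simp add: add_divide_distrib[symmetric] of_nat_diff algebra_simps)
  also have "\<dots> = 1" using assms \<theta> by simp
  finally show "(\<integral>\<^sup>+x. ennreal (?f x) \<partial>count_space UNIV) = 1" by simp
qed

lemma set_pmf_hoppe_J: "k \<ge> 1 \<Longrightarrow> set_pmf (hoppe_J \<theta> k) \<subseteq> {..<k}"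
  by (auto simp: set_pmf_eq pmf_hoppe_J split: if_splits)

lemma hoppe_tree_support:
  assumes "J \<in> set_pmf (hoppe_tree \<theta> n)"
  shows "J 0 = 0" "k > 0 \<Longrightarrow> J k < k"
proof -
  have J: "J \<in> PiE_dflt {1..<n} 0 (set_pmf \<circ> hoppe_J \<theta>)"
    using assms unfolding hoppe_tree_def by (simp add: set_Pi_pmf)
  then show "J 0 = 0" by (auto simp: PiE_dflt_def)
  assume "k > 0"
  then show "J k < k"
    using J set_pmf_hoppe_J[of k]
    by (cases "k < n") (auto simp: PiE_dflt_def Suc_le_eq subset_iff)
qed

lemma finite_set_pmf_hoppe_tree: "finite (set_pmf (hoppe_tree \<theta> n))"
  unfolding hoppe_tree_def
  by (subst set_Pi_pmf) (auto intro!: finite_PiE_dflt finite_subset[OF set_pmf_hoppe_J])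

end

section \<open>Laws of shapes and their decomposition\<close>

definition shape_pmf :: "real \<Rightarrow> nat \<Rightarrow> unit tree pmf" where
  "shape_pmf \<theta> n = map_pmf (\<lambda>J. shape (encode J n)) (hoppe_tree \<theta> n)"

abbreviation shape_exp :: "real \<Rightarrow> nat \<Rightarrow> (unit tree \<Rightarrow> real) \<Rightarrow> real" where
  "shape_exp \<theta> n F \<equiv> measure_pmf.expectation (shape_pmf \<theta> n) F"

lemma finite_set_pmf_shape: "\<theta> > 0 \<Longrightarrow> finite (set_pmf (shape_pmf \<theta> n))"
  by (simp add: shape_pmf_def finite_set_pmf_hoppe_tree)

lemma integrable_shape [simp]: "\<theta> > 0 \<Longrightarrow> integrable (measure_pmf (shape_pmf \<theta> n)) (F :: _ \<Rightarrow> real)"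
  by (intro integrable_measure_pmf_finite finite_set_pmf_shape)

lemma tsize_shape_pmf:
  assumes "\<theta> > 0" "n > 0" "t \<in> set_pmf (shape_pmf \<theta> n)"
  shows "tsize t = n"
proof -
  obtain J where J: "J \<in> set_pmf (hoppe_tree \<theta> n)" "t = shape (encode J n)"
    using assms(3) by (auto simp: shape_pmf_def)
  then show ?thesis
    using encode_labels[of J n] hoppe_tree_support[OF assms(1) J(1)] assms(2) card_set_tree[of "encode J n"]
    by simp
qed

lemma shape_exp_cong:
  assumes "\<theta> > 0" "n > 0" "\<And>t. tsize t = n \<Longrightarrow> F t = G t"
  shows "shape_exp \<theta> n F = shape_exp \<theta> n G"
  using tsize_shape_pmf[OF assms(1,2)] assms(3)
  by (intro integral_cong_AE) (auto intro!: AE_pmfI)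

lemma shape_exp_1: "shape_exp \<theta> 1 F = F (Root ())"
  by (simp add: shape_pmf_def hoppe_tree_def)

text \<open>The parent of the new vertex \<open>n\<close> is independent of the earlier parents, so
  the additional factor of the product law acts on the shape as the Markov step \<open>grow\<close>,
  normalised by the total weight.\<close>

lemma shape_exp_Suc:
  assumes "\<theta> > 0" "n > 0"
  shows "shape_exp \<theta> (Suc n) F = shape_exp \<theta> n (\<lambda>t. grow t \<theta> F) / (\<theta> + real n - 1)"
proof -
  have ins: "{1..<Suc n} = insert n {1..<n}" using assms by auto
  have "hoppe_tree \<theta> (Suc n) = map_pmf (\<lambda>(y, J). J(n := y)) (pair_pmf (hoppe_J \<theta> n) (hoppe_tree \<theta> n))"
    unfolding hoppe_tree_def ins by (rule Pi_pmf_insert) auto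
  also have "\<dots> = bind_pmf (hoppe_tree \<theta> n) (\<lambda>J. map_pmf (\<lambda>y. J(n := y)) (hoppe_J \<theta> n))"
    unfolding pair_pmf_def map_bind_pmf map_pmf_def bind_return_pmf bind_assoc_pmf
    by (subst bind_commute_pmf) (simp add: bind_return_pmf)
  finally have "shape_pmf \<theta> (Suc n)
     = bind_pmf (hoppe_tree \<theta> n) (\<lambda>J. map_pmf (\<lambda>y. shape (encode (J(n := y)) (Suc n))) (hoppe_J \<theta> n))"
    unfolding shape_pmf_def by (simp add: map_bind_pmf pmf.map_comp o_def del: encode.simps)
  then have "shape_exp \<theta> (Suc n) F = (\<Sum>J\<in>set_pmf (hoppe_tree \<theta> n). pmf (hoppe_tree \<theta> n) J *
      measure_pmf.expectation (hoppe_J \<theta> n) (\<lambda>y. F (shape (encode (J(n := y)) (Suc n)))))"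
    using set_pmf_hoppe_J[OF assms(1), of n] assms finite_subset[OF set_pmf_hoppe_J[OF assms(1), of n]]
    by (simp only:) (subst pmf_expectation_bind[OF finite_set_pmf_hoppe_tree[OF assms(1)]], auto)
  also have "\<dots> = (\<Sum>J\<in>set_pmf (hoppe_tree \<theta> n). pmf (hoppe_tree \<theta> n) J *
      (grow (shape (encode J n)) \<theta> F / (\<theta> + real n - 1)))"
  proof (intro sum.cong refl arg_cong2[where f="(*)"])
    fix J assume J: "J \<in> set_pmf (hoppe_tree \<theta> n)"
    have lab: "set_tree (encode J n) = {..<n}" "distinct_labels (encode J n)"
      using encode_labels[of J n] hoppe_tree_support[OF assms(1) J] assms(2) by auto
    have "measure_pmf.expectation (hoppe_J \<theta> n) (\<lambda>y. F (shape (encode (J(n := y)) (Suc n))))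
       = (\<Sum>y<n. pmf (hoppe_J \<theta> n) y * F (shape (encode (J(n := y)) (Suc n))))"
      using set_pmf_hoppe_J[OF assms(1), of n] assms(2)
      by (subst integral_measure_pmf_real[where A="{..<n}"]) (auto simp: mult.commute)
    also have "\<dots> = (\<Sum>y\<in>set_tree (encode J n). (if y = troot (encode J n) then \<theta> else 1)
        * F (shape (attach y n (encode J n))) / (\<theta> + real n - 1))"
      unfolding lab
    proof (intro sum.cong refl)
      fix y assume "y \<in> {..<n}"
      moreover have "encode (J(n := y)) n = encode J n" by (intro encode_cong) auto
      ultimately show "pmf (hoppe_J \<theta> n) y * F (shape (encode (J(n := y)) (Suc n))) =
         (if y = troot (encode J n) then \<theta> else 1) * F (shape (attach y n (encode J n))) / (\<theta> + real n - 1)"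
        using assms by (simp add: pmf_hoppe_J)
    qed
    also have "\<dots> = grow (shape (encode J n)) \<theta> F / (\<theta> + real n - 1)"
      by (simp only: sum_divide_distrib[symmetric] sum_attach_eq_grow[OF lab(2)])
    finally show "measure_pmf.expectation (hoppe_J \<theta> n) (\<lambda>y. F (shape (encode (J(n := y)) (Suc n))))
       = grow (shape (encode J n)) \<theta> F / (\<theta> + real n - 1)" .
  qed
  also have "\<dots> = measure_pmf.expectation (hoppe_tree \<theta> n) (\<lambda>J. grow (shape (encode J n)) \<theta> F / (\<theta> + real n - 1))"
    by (subst integral_measure_pmf_real[OF finite_set_pmf_hoppe_tree[OF assms(1)]]) (auto simp: mult.commute)
  also have "\<dots> = shape_exp \<theta> n (\<lambda>t. grow t \<theta> F) / (\<theta> + real n - 1)"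
    by (simp add: shape_pmf_def)
  finally show ?thesis .
qed

lemma shape_exp_grow:
  assumes "\<theta> > 0" "n > 0"
  shows "shape_exp \<theta> n (\<lambda>t. grow t \<theta> F) = (\<theta> + real n - 1) * shape_exp \<theta> (Suc n) F"
  using shape_exp_Suc[OF assms, of F] assms by simp

text \<open>\<open>grow\<close> is a finite linear combination of evaluations, hence commutes with
  the expectation.\<close>

lemma shape_exp_grow_swap:
  assumes "\<theta> > 0"
  shows "shape_exp \<theta> n (\<lambda>r. grow t c (\<lambda>x. G x r)) = grow t c (\<lambda>x. shape_exp \<theta> n (G x))"
proof (induction t arbitrary: c G)
  case (Root a)
  then show ?case using assms by simp
next
  case (Join s r)
  show ?case using assms by (simp add: Join.IH)
qed

text \<open>Conditional independence of the two parts, obtained from growth: on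
  \<open>Join s r\<close> the step \<open>grow\<close> is a step in \<open>s\<close> with parameter
  1 plus a step in \<open>r\<close> with parameter \<theta>. A mixture of product laws therefore
  remains one, and its weights change exactly by the urn recursion \<open>split_weight_Suc\<close>.
  The induction has to run for all \<open>F\<close> at once, since it is applied to
  \<open>grow t \<theta> F\<close> as a function of \<open>t\<close>.\<close>

theorem shape_exp_split:
  assumes "\<theta> > 0"
  shows "shape_exp \<theta> (N + 2) F = (\<Sum>i\<le>N. split_weight \<theta> N i *
     shape_exp 1 (Suc i) (\<lambda>s. shape_exp \<theta> (Suc (N - i)) (\<lambda>r. F (Join s r))))"
proof (induction N arbitrary: F)
  case 0
  have "shape_exp \<theta> 2 F = F (Join (Root ()) (Root ()))"
    using shape_exp_Suc[OF assms, of 1 F] assms by (simp add: shape_exp_1[unfolded One_nat_def] numeral_2_eq_2)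
  then show ?case
    using assms by (simp add: split_weight_0_0 shape_exp_1[unfolded One_nat_def] numeral_2_eq_2)
next
  case (Suc N)
  let ?a = "\<lambda>i j. shape_exp 1 i (\<lambda>s. shape_exp \<theta> j (\<lambda>r. F (Join s r)))"
  have pos: "\<theta> + real N + 1 > 0" using assms by simp
  have step: "shape_exp 1 (Suc i) (\<lambda>s. shape_exp \<theta> (Suc (N - i)) (\<lambda>r. grow (Join s r) \<theta> F))
      = real (Suc i) * ?a (Suc (Suc i)) (Suc (N - i)) + (\<theta> + real N - real i) * ?a (Suc i) (Suc (Suc (N - i)))"
    if "i \<le> N" for i
  proof -
    have "shape_exp 1 (Suc i) (\<lambda>s. shape_exp \<theta> (Suc (N - i)) (\<lambda>r. grow (Join s r) \<theta> F))
      = shape_exp 1 (Suc i) (\<lambda>s. grow s 1 (\<lambda>s'. shape_exp \<theta> (Suc (N - i)) (\<lambda>r. F (Join s' r)))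
          + (\<theta> + real (Suc (N - i)) - 1) * shape_exp \<theta> (Suc (Suc (N - i))) (\<lambda>r. F (Join s r)))"
      using assms by (simp add: shape_exp_grow_swap shape_exp_grow)
    also have "\<dots> = shape_exp 1 (Suc i) (\<lambda>s. grow s 1 (\<lambda>s'. shape_exp \<theta> (Suc (N - i)) (\<lambda>r. F (Join s' r))))
          + (\<theta> + real (Suc (N - i)) - 1) * ?a (Suc i) (Suc (Suc (N - i)))"
      by (subst Bochner_Integration.integral_add) auto
    also have "\<dots> = real (Suc i) * ?a (Suc (Suc i)) (Suc (N - i)) + (\<theta> + real N - real i) * ?a (Suc i) (Suc (Suc (N - i)))"
      using that by (subst shape_exp_grow) (auto simp: of_nat_diff)
    finally show ?thesis .
  qed
  have "(\<theta> + real N + 1) * shape_exp \<theta> (Suc N + 2) F = shape_exp \<theta> (N + 2) (\<lambda>t. grow t \<theta> F)"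
    using shape_exp_grow[OF assms, of "N + 2" F] by (simp add: add_ac)
  also have "\<dots> = (\<Sum>i\<le>N. split_weight \<theta> N i * (real (Suc i) * ?a (Suc (Suc i)) (Suc (N - i))))
      + (\<Sum>i\<le>N. split_weight \<theta> N i * ((\<theta> + real N - real i) * ?a (Suc i) (Suc (Suc (N - i)))))"
    unfolding Suc.IH sum.distrib[symmetric] distrib_left[symmetric]
    by (intro sum.cong refl arg_cong2[where f="(*)"] step) simp
  \<comment> \<open>Growth of \<open>s\<close> moves index \<open>i\<close> to \<open>i + 1\<close>;
    shifting the summation aligns both sums on the sizes in the new tree.\<close>
  also have "(\<Sum>i\<le>N. split_weight \<theta> N i * (real (Suc i) * ?a (Suc (Suc i)) (Suc (N - i))))
     = (\<Sum>i\<le>Suc N. (if i = 0 then 0 else real i * split_weight \<theta> N (i - 1)) * ?a (Suc i) (Suc (Suc N - i)))"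
    unfolding sum.atMost_Suc_shift by (simp add: mult_ac)
  \<comment> \<open>The added term at \<open>Suc N\<close> is 0 because \<open>split_weight\<close>
    vanishes beyond \<open>N\<close>.\<close>
  also have "(\<Sum>i\<le>N. split_weight \<theta> N i * ((\<theta> + real N - real i) * ?a (Suc i) (Suc (Suc (N - i)))))
     = (\<Sum>i\<le>Suc N. (\<theta> + real N - real i) * split_weight \<theta> N i * ?a (Suc i) (Suc (Suc N - i)))"
    by (simp add: split_weight_outside mult_ac) (intro sum.cong refl, simp add: Suc_diff_le)
  also have "(\<Sum>i\<le>Suc N. (if i = 0 then 0 else real i * split_weight \<theta> N (i - 1)) * ?a (Suc i) (Suc (Suc N - i))) + \<dots>
     = (\<Sum>i\<le>Suc N. ((\<theta> + real N + 1) * split_weight \<theta> (Suc N) i) * ?a (Suc i) (Suc (Suc N - i)))"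
    unfolding sum.distrib[symmetric] distrib_right[symmetric]
    by (intro sum.cong refl arg_cong2[where f="(*)"] split_weight_Suc[OF assms, symmetric]) simp
  also have "\<dots> = (\<theta> + real N + 1) * (\<Sum>i\<le>Suc N. split_weight \<theta> (Suc N) i * ?a (Suc i) (Suc (Suc N - i)))"
    by (simp only: sum_distrib_left mult.assoc)
  finally show ?case using pos by simp
qed

section \<open>A Wasserstein metric on the plane\<close>

lemma borel_measurable_fst_real [measurable]: "(fst :: real \<times> real \<Rightarrow> real) \<in> borel_measurable borel"
  by (intro borel_measurable_continuous_onI continuous_intros)

lemma borel_measurable_snd_real [measurable]: "(snd :: real \<times> real \<Rightarrow> real) \<in> borel_measurable borel"
  by (intro borel_measurable_continuous_onI continuous_intros)

text \<open>The l1 norm: Lipschitz bounds of linear maps reduce to absolute column sums.\<close>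

definition taxi :: "real \<times> real \<Rightarrow> real" where
  "taxi x = \<bar>fst x\<bar> + \<bar>snd x\<bar>"

lemma taxi_nonneg [simp]: "taxi x \<ge> 0"
  by (simp add: taxi_def)

lemma taxi_0 [simp]: "taxi 0 = 0"
  by (simp add: taxi_def)

lemma taxi_minus_commute: "taxi (x - y) = taxi (y - x)"
  by (simp add: taxi_def abs_minus_commute)

lemma taxi_triangle: "taxi (x - z) \<le> taxi (x - y) + taxi (y - z)"
  unfolding taxi_def by simp

lemma norm_le_taxi: "norm x \<le> taxi x"
  using norm_Pair_le[of "fst x" "snd x"] by (simp add: taxi_def)

lemma taxi_le_norm: "taxi x \<le> 2 * norm x"
  using norm_fst_le[of "fst x" "snd x"] norm_snd_le[of "snd x" "fst x"] by (simp add: taxi_def)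

lemma continuous_on_taxi [continuous_intros]:
  "continuous_on S f \<Longrightarrow> continuous_on S (\<lambda>x. taxi (f x))"
  unfolding taxi_def by (intro continuous_intros)

lemma borel_measurable_taxi [measurable]: "taxi \<in> borel_measurable borel"
  unfolding taxi_def[abs_def] by measurable

definition lip_taxi :: "real \<Rightarrow> (real \<times> real \<Rightarrow> real) \<Rightarrow> bool" where
  "lip_taxi c f \<longleftrightarrow> (\<forall>x y. \<bar>f x - f y\<bar> \<le> c * taxi (x - y))"

lemma lip_taxiD: "lip_taxi c f \<Longrightarrow> \<bar>f x - f y\<bar> \<le> c * taxi (x - y)"
  unfolding lip_taxi_def by blast

lemma lip_taxi_continuous:
  assumes "lip_taxi c f" "c \<ge> 0"
  shows "continuous_on UNIV f"
proof (rule lipschitz_on_continuous_on)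
  show "(c * 2)-lipschitz_on UNIV f"
  proof (rule lipschitz_onI)
    fix x y
    have "\<bar>f x - f y\<bar> \<le> c * taxi (x - y)" using assms(1) by (rule lip_taxiD)
    also have "\<dots> \<le> c * (2 * norm (x - y))" by (intro mult_left_mono taxi_le_norm assms)
    finally show "dist (f x) (f y) \<le> c * 2 * dist x y" by (simp add: dist_norm)
  qed (use assms in simp)
qed

lemma lip_taxi_measurable: "lip_taxi c f \<Longrightarrow> c \<ge> 0 \<Longrightarrow> f \<in> borel_measurable borel"
  by (intro borel_measurable_continuous_onI lip_taxi_continuous)

definition finite_mean :: "(real \<times> real) measure \<Rightarrow> bool" where
  "finite_mean M \<longleftrightarrow> prob_space M \<and> sets M = sets borel \<and> integrable M fst \<and> integrable M snd"

lemma finite_mean_taxi: "finite_mean M \<Longrightarrow> integrable M taxi"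
  unfolding finite_mean_def taxi_def[abs_def] by auto

lemma finite_mean_space: "finite_mean M \<Longrightarrow> space M = UNIV"
  unfolding finite_mean_def using sets_eq_imp_space_eq[of M borel] by simp

lemma finite_meanI:
  assumes "prob_space M" "sets M = sets borel" "integrable M taxi"
  shows "finite_mean M"
proof -
  note [measurable_cong] = assms(2)
  have "integrable M fst" by (rule Bochner_Integration.integrable_bound[OF assms(3)]) (auto simp: taxi_def)
  moreover have "integrable M snd" by (rule Bochner_Integration.integrable_bound[OF assms(3)]) (auto simp: taxi_def)
  ultimately show ?thesis using assms by (simp add: finite_mean_def)
qed

lemma lip_taxi_integrable:
  assumes "finite_mean M" "lip_taxi c f" "c \<ge> 0"
  shows "integrable M f"
proof -
  interpret prob_space M using assms by (simp add: finite_mean_def)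
  have s [measurable_cong]: "sets M = sets borel" using assms by (simp add: finite_mean_def)
  have [measurable]: "f \<in> borel_measurable borel" using assms by (intro lip_taxi_measurable)
  have "integrable M (\<lambda>x. \<bar>f 0\<bar> + c * taxi x)" using finite_mean_taxi[OF assms(1)] by simp
  then show ?thesis
  proof (rule Bochner_Integration.integrable_bound)
    have "\<bar>f x\<bar> \<le> \<bar>f 0\<bar> + c * taxi x" for x
      using lip_taxiD[OF assms(2), of x 0] by simp
    then show "AE x in M. norm (f x) \<le> norm (\<bar>f 0\<bar> + c * taxi x)"
      using assms(3) by (auto intro!: always_eventually simp: abs_of_nonneg)
  qed measurable
qed

text \<open>Kantorovich-Rubinstein dual of the transport distance for \<open>taxi\<close>: with a
  supremum over test functions a recursion for integrals becomes one for distances. The real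
  supremum is meaningful only for a bounded set of values, hence the restriction to
  \<open>finite_mean\<close> in the rules below.\<close>

definition wasserstein :: "(real \<times> real) measure \<Rightarrow> (real \<times> real) measure \<Rightarrow> real" where
  "wasserstein M N = (SUP f\<in>Collect (lip_taxi 1). \<bar>(\<integral>x. f x \<partial>M) - (\<integral>x. f x \<partial>N)\<bar>)"

text \<open>Subtracting \<open>f 0\<close> from both integrals leaves a bound uniform in
  \<open>f\<close>, so the supremum is finite.\<close>

lemma wasserstein_bound:
  assumes "finite_mean M" "finite_mean N" "lip_taxi 1 f"
  shows "\<bar>(\<integral>x. f x \<partial>M) - (\<integral>x. f x \<partial>N)\<bar> \<le> (\<integral>x. taxi x \<partial>M) + (\<integral>x. taxi x \<partial>N)"
proof -
  have *: "\<bar>(\<integral>x. f x \<partial>M) - f 0\<bar> \<le> (\<integral>x. taxi x \<partial>M)" if "finite_mean M" for M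
  proof -
    interpret prob_space M using that by (simp add: finite_mean_def)
    note int = lip_taxi_integrable[OF that assms(3)]
    have "(\<integral>x. f x \<partial>M) - f 0 = (\<integral>x. f x - f 0 \<partial>M)"
      using int by (simp add: prob_space)
    also have "\<bar>\<dots>\<bar> \<le> (\<integral>x. \<bar>f x - f 0\<bar> \<partial>M)" by (rule integral_abs_bound)
    also have "\<dots> \<le> (\<integral>x. taxi x \<partial>M)"
      using int finite_mean_taxi[OF that] lip_taxiD[OF assms(3), of _ 0] by (intro integral_mono) auto
    finally show ?thesis .
  qed
  show ?thesis using *[OF assms(1)] *[OF assms(2)] by linarith
qed

lemma wasserstein_upper:
  assumes "finite_mean M" "finite_mean N" "lip_taxi 1 f"
  shows "\<bar>(\<integral>x. f x \<partial>M) - (\<integral>x. f x \<partial>N)\<bar> \<le> wasserstein M N"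
  unfolding wasserstein_def
  by (rule cSUP_upper) (use assms in \<open>auto intro!: bdd_aboveI2 wasserstein_bound\<close>)

lemma wasserstein_scaled:
  assumes "finite_mean M" "finite_mean N" "lip_taxi c f" "c \<ge> 0"
  shows "\<bar>(\<integral>x. f x \<partial>M) - (\<integral>x. f x \<partial>N)\<bar> \<le> c * wasserstein M N"
proof (cases "c = 0")
  case True
  then have "f x = f 0" for x using lip_taxiD[OF assms(3), of x 0] by simp
  then have "f = (\<lambda>_. f 0)" by blast
  moreover have "measure M (space M) = 1" "measure N (space N) = 1"
    using assms(1,2) prob_space.prob_space by (auto simp: finite_mean_def)
  ultimately have "(\<integral>x. f x \<partial>M) = f 0" "(\<integral>x. f x \<partial>N) = f 0"
    using lebesgue_integral_const[of M "f 0"] lebesgue_integral_const[of N "f 0"] by simp_all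
  then show ?thesis using True by simp
next
  case False
  then have c: "c > 0" using assms(4) by simp
  then have "lip_taxi 1 (\<lambda>x. f x / c)"
    using assms(3) by (auto simp: lip_taxi_def field_simps simp flip: diff_divide_distrib)
  from wasserstein_upper[OF assms(1,2) this] show ?thesis
    using c by (simp add: field_simps flip: diff_divide_distrib)
qed

lemma lip_taxi_const: "lip_taxi 1 (\<lambda>_. c)"
  by (simp add: lip_taxi_def)

lemma wasserstein_least:
  assumes "\<And>f. lip_taxi 1 f \<Longrightarrow> \<bar>(\<integral>x. f x \<partial>M) - (\<integral>x. f x \<partial>N)\<bar> \<le> C"
  shows "wasserstein M N \<le> C"
  unfolding wasserstein_def by (rule cSUP_least) (use assms lip_taxi_const[of 0] in auto)

lemma wasserstein_nonneg:
  assumes "finite_mean M" "finite_mean N"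
  shows "wasserstein M N \<ge> 0"
  using wasserstein_upper[OF assms lip_taxi_const] abs_ge_zero order_trans by blast

lemma dist_le_taxi: "dist x y \<le> taxi (x - y)"
  by (simp add: dist_norm norm_le_taxi)

text \<open>Closed sets form an intersection-stable generator. The indicator of a closed set is the
  pointwise limit of the cutoffs \<open>max 0 (1 - m * infdist x X)\<close>, whose growing Lipschitz
  constants \<open>m\<close> do no harm when the distance is 0.\<close>

lemma wasserstein_eq_0:
  assumes M: "finite_mean M" and N: "finite_mean N" and eq: "wasserstein M N \<le> 0"
  shows "M = N"
proof (rule measure_eqI_generator_eq[where \<Omega>=UNIV and E="Collect closed" and A="\<lambda>_. UNIV"])
  interpret M: prob_space M using M by (simp add: finite_mean_def)
  interpret N: prob_space N using N by (simp add: finite_mean_def)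
  have sM [measurable_cong]: "sets M = sets borel" and sN [measurable_cong]: "sets N = sets borel"
    using M N by (auto simp: finite_mean_def)
  have sp: "space M = UNIV" "space N = UNIV" using finite_mean_space M N by auto
  show "emeasure M X = emeasure N X" if "X \<in> Collect closed" for X
  proof (cases "X = {}")
    case False
    have X: "closed X" using that by simp
    define f where "f m x = max 0 (1 - real m * infdist x X)" for m :: nat and x :: "real \<times> real"
    have lip: "lip_taxi (real m) (f m)" for m
      unfolding lip_taxi_def
    proof (intro allI)
      fix x y :: "real \<times> real"
      have "\<bar>infdist x X - infdist y X\<bar> \<le> dist x y"
        by (smt (verit, best) dist_commute infdist_triangle)
      then have "real m * \<bar>infdist x X - infdist y X\<bar> \<le> real m * taxi (x - y)"
        using dist_le_taxi[of x y] by (intro mult_left_mono) auto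
      moreover have "\<bar>f m x - f m y\<bar> \<le> \<bar>real m * infdist x X - real m * infdist y X\<bar>"
        unfolding f_def by linarith
      ultimately show "\<bar>f m x - f m y\<bar> \<le> real m * taxi (x - y)"
        by (simp add: abs_mult flip: right_diff_distrib)
    qed
    have [measurable]: "f m \<in> borel_measurable borel" for m using lip by (rule lip_taxi_measurable) simp
    have eqf: "(\<integral>x. f m x \<partial>M) = (\<integral>x. f m x \<partial>N)" for m
    proof -
      have "real m * wasserstein M N \<le> 0" using eq by (intro mult_nonneg_nonpos) auto
      then show ?thesis using wasserstein_scaled[OF M N lip[of m]] by simp
    qed
    have lim: "(\<lambda>m. f m x) \<longlonglongrightarrow> indicator X x" for x
    proof (cases "x \<in> X")
      case True
      then show ?thesis by (simp add: f_def)
    next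
      case False
      then have "infdist x X > 0" using X \<open>X \<noteq> {}\<close>
        by (metis in_closed_iff_infdist_zero infdist_nonneg less_eq_real_def)
      then have "real m * infdist x X \<ge> 1" if "m \<ge> nat \<lceil>1 / infdist x X\<rceil>" for m
      proof -
        have "1 / infdist x X \<le> real m" using that by linarith
        then show ?thesis using \<open>infdist x X > 0\<close> by (simp add: field_simps)
      qed
      then have "\<forall>\<^sub>F m in sequentially. f m x = 0"
        unfolding f_def using eventually_ge_at_top[of "nat \<lceil>1 / infdist x X\<rceil>"]
        by (auto elim!: eventually_mono)
      then show ?thesis using False by (simp add: tendsto_eventually)
    qed
    have f01: "\<bar>f m x\<bar> \<le> 1" for m x by (simp add: f_def infdist_nonneg)
    have XMN: "X \<in> sets M" "X \<in> sets N" using X sM sN by (auto intro: borel_closed)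
    have "(\<lambda>m. \<integral>x. f m x \<partial>M) \<longlonglongrightarrow> (\<integral>x. indicator X x \<partial>M)"
      by (rule integral_dominated_convergence[where w="\<lambda>_. 1"])
         (use lim f01 XMN in \<open>auto simp del: split_paired_All\<close>)
    moreover have "(\<lambda>m. \<integral>x. f m x \<partial>N) \<longlonglongrightarrow> (\<integral>x. indicator X x \<partial>N)"
      by (rule integral_dominated_convergence[where w="\<lambda>_. 1"])
         (use lim f01 XMN in \<open>auto simp del: split_paired_All\<close>)
    ultimately have "(\<integral>x. indicat_real X x \<partial>M) = (\<integral>x. indicat_real X x \<partial>N)"
      unfolding eqf by (rule LIMSEQ_unique)
    then show ?thesis using XMN sp
      by (simp add: M.emeasure_eq_measure N.emeasure_eq_measure)
  qed simp
  show "Int_stable (Collect (closed :: (real \<times> real) set \<Rightarrow> bool))" by (auto simp: Int_stable_def)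
  show "sets M = sigma_sets UNIV (Collect closed)" "sets N = sigma_sets UNIV (Collect closed)"
    using sM sN by (simp_all add: borel_eq_closed)
  show "emeasure M UNIV \<noteq> \<infinity>" for i :: nat by simp
qed auto

section \<open>Weak convergence and Wasserstein convergence\<close>

lemma bounded_integrable:
  fixes f :: "real \<times> real \<Rightarrow> real"
  assumes "prob_space M" "sets M = sets borel" "f \<in> borel_measurable borel" "\<And>x. \<bar>f x\<bar> \<le> B"
  shows "integrable M f"
proof -
  interpret prob_space M by fact
  note [measurable_cong] = assms(2)
  show ?thesis using assms by (intro integrable_const_bound[where B=B]) auto
qed

text \<open>A bounded continuous \<open>f\<close> is the pointwise limit from below of its Lipschitz
  envelopes \<open>g m\<close>, the inf-convolutions with \<open>m * taxi\<close>. Wasserstein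
  convergence handles each \<open>g m\<close>, and \<open>g m \<le> f\<close> gives the lower half
  of weak convergence; the upper half is the same applied to \<open>- f\<close>.\<close>

lemma weak_liminf_of_wasserstein:
  fixes f :: "real \<times> real \<Rightarrow> real"
  assumes M: "\<And>n. finite_mean (M n)" and N: "finite_mean N"
    and lim: "(\<lambda>n. wasserstein (M n) N) \<longlonglongrightarrow> 0"
    and cont: "continuous_on UNIV f" and B: "\<And>x. \<bar>f x\<bar> \<le> B" and e: "e > 0"
  shows "\<forall>\<^sub>F n in sequentially. (\<integral>x. f x \<partial>M n) > (\<integral>x. f x \<partial>N) - e"
proof -
  interpret N: prob_space N using N by (simp add: finite_mean_def)
  have sN [measurable_cong]: "sets N = sets borel" using N by (auto simp: finite_mean_def)
  have [measurable]: "f \<in> borel_measurable borel" using cont by (rule borel_measurable_continuous_onI)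
  define g where "g m x = (INF y. f y + real m * taxi (x - y))" for m :: nat and x
  have bdd: "bdd_below (range (\<lambda>y. f y + real m * taxi (x - y)))" for m x
  proof (rule bdd_belowI2[where m="-B"])
    fix y show "- B \<le> f y + real m * taxi (x - y)"
      using B[of y] mult_nonneg_nonneg[of "real m" "taxi (x - y)", OF of_nat_0_le_iff taxi_nonneg] by linarith
  qed
  have g_le: "g m x \<le> f y + real m * taxi (x - y)" for m x y
    unfolding g_def by (rule cINF_lower[OF bdd]) simp
  have g_le_f: "g m x \<le> f x" for m x using g_le[of m x x] by simp
  have g_ge: "c \<le> g m x" if "\<And>y. c \<le> f y + real m * taxi (x - y)" for c m x
    unfolding g_def using that by (intro cINF_greatest) auto
  have g_low: "- B \<le> g m x" for m x
  proof (rule g_ge)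
    fix y show "- B \<le> f y + real m * taxi (x - y)"
      using B[of y] mult_nonneg_nonneg[of "real m" "taxi (x - y)", OF of_nat_0_le_iff taxi_nonneg] by linarith
  qed
  have gB: "\<bar>g m x\<bar> \<le> B" for m x using g_low[of m x] g_le_f[of m x] B[of x] by (simp add: abs_le_iff)
  have lip: "lip_taxi (real m) (g m)" for m
    unfolding lip_taxi_def
  proof (intro allI)
    have *: "g m x - real m * taxi (x - z) \<le> g m z" for x z
    proof (rule g_ge)
      fix y
      have "real m * taxi (x - y) \<le> real m * (taxi (x - z) + taxi (z - y))"
        by (intro mult_left_mono taxi_triangle) simp
      then show "g m x - real m * taxi (x - z) \<le> f y + real m * taxi (z - y)"
        using g_le[of m x y] by (simp add: distrib_left)
    qed
    fix x z
    show "\<bar>g m x - g m z\<bar> \<le> real m * taxi (x - z)"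
      using *[of x z] *[of z x] taxi_minus_commute[of x z] by (simp add: abs_le_iff)
  qed
  have [measurable]: "g m \<in> borel_measurable borel" for m using lip by (rule lip_taxi_measurable) simp
  have glim: "(\<lambda>m. g m x) \<longlonglongrightarrow> f x" for x
  proof (rule LIMSEQ_I)
    fix r :: real assume r: "r > 0"
    obtain d where d: "d > 0" "\<And>y. dist y x < d \<Longrightarrow> \<bar>f y - f x\<bar> < r / 2"
      using cont r unfolding continuous_on_iff by (metis UNIV_I dist_real_def half_gt_zero)
    \<comment> \<open>A point at distance at least \<open>d\<close> is charged at least
      \<open>m * d\<close>, which makes up for the largest possible drop \<open>2 * B\<close> of
      \<open>f\<close>; so only points near \<open>x\<close> matter in the infimum.\<close>
    obtain m0 :: nat where m0: "real m0 \<ge> 2 * B / d" using real_arch_simple by blast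
    show "\<exists>m0. \<forall>m\<ge>m0. norm (g m x - f x) < r"
    proof (intro exI allI impI)
      fix m assume m: "m \<ge> m0"
      have "f x - r / 2 \<le> g m x"
      proof (rule g_ge)
        fix y
        show "f x - r / 2 \<le> f y + real m * taxi (x - y)"
        proof (cases "dist y x < d")
          case True
          have "0 \<le> real m * taxi (x - y)" by simp
          then show ?thesis using d(2)[OF True] by linarith
        next
          case False
          then have "d \<le> taxi (x - y)" using dist_le_taxi[of x y] by (simp add: dist_commute)
          then have "real m * d \<le> real m * taxi (x - y)" by (intro mult_left_mono) auto
          moreover have "2 * B / d \<le> real m" using m m0 by (meson of_nat_mono order_trans)
          then have "2 * B \<le> real m * d" using d(1) by (simp add: field_simps)
          ultimately show ?thesis using B[of x] B[of y] r by (simp add: abs_le_iff)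
        qed
      qed
      then show "norm (g m x - f x) < r" using g_le_f[of m x] r by simp
    qed
  qed
  have "(\<lambda>m. \<integral>x. g m x \<partial>N) \<longlonglongrightarrow> (\<integral>x. f x \<partial>N)"
    by (rule integral_dominated_convergence[where w="\<lambda>_. B"]) (use glim gB in auto)
  then have "\<forall>\<^sub>F m in sequentially. (\<integral>x. g m x \<partial>N) > (\<integral>x. f x \<partial>N) - e / 2"
    using e by (intro order_tendstoD(1)) auto
  then obtain m where m: "(\<integral>x. g m x \<partial>N) > (\<integral>x. f x \<partial>N) - e / 2"
    by (auto simp: eventually_sequentially)
  have "(\<lambda>n. real m * wasserstein (M n) N) \<longlonglongrightarrow> real m * 0" by (intro tendsto_intros lim)
  then have "\<forall>\<^sub>F n in sequentially. real m * wasserstein (M n) N < e / 2"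
    using e by (intro order_tendstoD(2)) auto
  then show ?thesis
  proof eventually_elim
    case (elim n)
    have pn: "prob_space (M n)" "sets (M n) = sets borel" using M[of n] by (auto simp: finite_mean_def)
    have "(\<integral>x. g m x \<partial>M n) \<le> (\<integral>x. f x \<partial>M n)"
      by (intro integral_mono g_le_f bounded_integrable[OF pn, where B=B] gB B) measurable
    then show ?case using wasserstein_scaled[OF M[of n] N lip[of m]] elim m by (simp add: abs_le_iff)
  qed
qed

lemma weak_conv2_of_wasserstein:
  assumes M: "\<And>n. finite_mean (M n)" and N: "finite_mean N"
    and lim: "(\<lambda>n. wasserstein (M n) N) \<longlonglongrightarrow> 0"
  shows "weak_conv2 M N"
  unfolding weak_conv2_def
proof (intro allI impI, elim conjE)
  fix f :: "real \<times> real \<Rightarrow> real"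
  assume cont: "continuous_on UNIV f" and "bounded (range f)"
  then obtain B where B: "\<And>x. \<bar>f x\<bar> \<le> B" unfolding bounded_iff by auto
  have cont': "continuous_on UNIV (\<lambda>x. - f x)" using cont by (intro continuous_intros)
  have B': "\<bar>- f x\<bar> \<le> B" for x using B by simp
  show "(\<lambda>n. \<integral>x. f x \<partial>M n) \<longlonglongrightarrow> (\<integral>x. f x \<partial>N)"
  proof (rule tendstoI)
    fix e :: real assume e: "e > 0"
    show "\<forall>\<^sub>F n in sequentially. dist (\<integral>x. f x \<partial>M n) (\<integral>x. f x \<partial>N) < e"
      using weak_liminf_of_wasserstein[OF M N lim cont B e] weak_liminf_of_wasserstein[OF M N lim cont' B' e]
      by eventually_elim (simp add: dist_real_def abs_less_iff)
  qed
qed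

text \<open>Fatou's lemma for weak limits: the truncations \<open>min (g x) r\<close> are admissible
  test functions, and monotone convergence removes \<open>r\<close>. It supplies integrability under
  the limit law, which cannot be read off from integrals, as a non-integrable function has integral
  0 by convention.\<close>

lemma weak_conv2_integrable:
  fixes g :: "real \<times> real \<Rightarrow> real"
  assumes M: "\<And>n. prob_space (M n) \<and> sets (M n) = sets borel \<and> integrable (M n) g"
    and N: "prob_space N" "sets N = sets borel" and w: "weak_conv2 M N"
    and g: "continuous_on UNIV g" "\<And>x. g x \<ge> 0" and K: "\<forall>\<^sub>F n in sequentially. (\<integral>x. g x \<partial>M n) \<le> K"
  shows "integrable N g" "(\<integral>x. g x \<partial>N) \<le> K"
proof -
  note [measurable_cong] = N(2)
  have [measurable]: "g \<in> borel_measurable borel" using g(1) by (rule borel_measurable_continuous_onI)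
  define h where "h r x = min (g x) (real r)" for r :: nat and x
  have [measurable]: "h r \<in> borel_measurable borel" for r unfolding h_def by measurable
  have hint: "integrable P (h r)" if "prob_space P" "sets P = sets borel" for r P
    using that g(2) by (intro bounded_integrable[where B="real r"]) (auto simp: h_def)
  have le: "(\<integral>x. h r x \<partial>N) \<le> K" for r
  proof -
    have "(\<lambda>n. \<integral>x. h r x \<partial>M n) \<longlonglongrightarrow> (\<integral>x. h r x \<partial>N)"
    proof (rule w[unfolded weak_conv2_def, rule_format], intro conjI)
      show "continuous_on UNIV (h r)" unfolding h_def by (intro continuous_intros g)
      show "bounded (range (h r))" using g(2) by (auto simp: bounded_iff h_def intro!: exI[of _ "real r"])
    qed
    moreover have "\<forall>\<^sub>F n in sequentially. (\<integral>x. h r x \<partial>M n) \<le> K"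
      using K
    proof eventually_elim
      case (elim n)
      have "(\<integral>x. h r x \<partial>M n) \<le> (\<integral>x. g x \<partial>M n)"
        using M[of n] by (intro integral_mono hint) (auto simp: h_def)
      then show ?case using elim by simp
    qed
    ultimately show ?thesis by (rule tendsto_upperbound) simp
  qed
  have inc: "incseq (\<lambda>r. \<integral>x. h r x \<partial>N)"
    by (intro incseq_SucI integral_mono hint N) (auto simp: h_def)
  then obtain L where L: "(\<lambda>r. \<integral>x. h r x \<partial>N) \<longlonglongrightarrow> L"
    using incseq_convergent[of "\<lambda>r. \<integral>x. h r x \<partial>N" K] le by blast
  have hl: "(\<lambda>r. h r x) \<longlonglongrightarrow> g x" for x
  proof (rule tendsto_eventually)
    show "\<forall>\<^sub>F r in sequentially. h r x = g x"
      unfolding h_def using eventually_ge_at_top[of "nat \<lceil>g x\<rceil>"] by eventually_elim linarith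
  qed
  have mono: "AE x in N. mono (\<lambda>r. h r x)" by (auto simp: h_def incseq_def)
  have hl': "AE x in N. (\<lambda>r. h r x) \<longlonglongrightarrow> g x" using hl by simp
  have gN: "g \<in> borel_measurable N" by measurable
  show "integrable N g"
    by (rule integrable_monotone_convergence[OF _ mono hl' L gN]) (intro hint N)
  have "integral\<^sup>L N g = L"
    by (rule integral_monotone_convergence[OF _ mono hl' L gN]) (intro hint N)
  then show "(\<integral>x. g x \<partial>N) \<le> K" using LIMSEQ_le_const2[OF L] le by auto
qed

lemma taxi_square_le: "(taxi x)\<^sup>2 \<le> 2 * (fst x)\<^sup>2 + 2 * (snd x)\<^sup>2"
proof -
  have "0 \<le> (\<bar>fst x\<bar> - \<bar>snd x\<bar>)\<^sup>2" by simp
  then show ?thesis by (simp add: taxi_def power2_eq_square algebra_simps)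
qed

text \<open>On a compact set, all functions that are 1-Lipschitz and vanish at the origin are approximated
  simultaneously by combinations of one finite partition of unity.\<close>

lemma wasserstein_of_weak_conv2:
  assumes M: "\<And>n. prob_space (M n) \<and> sets (M n) = sets borel \<and> integrable (M n) (\<lambda>x. (taxi x)\<^sup>2)"
    and N: "prob_space N" "sets N = sets borel" "integrable N (\<lambda>x. (taxi x)\<^sup>2)"
    and fM: "\<And>n. finite_mean (M n)" and fN: "finite_mean N"
    and w: "weak_conv2 M N" and K: "\<And>n. (\<integral>x. (taxi x)\<^sup>2 \<partial>M n) \<le> K" "(\<integral>x. (taxi x)\<^sup>2 \<partial>N) \<le> K"
  shows "(\<lambda>n. wasserstein (M n) N) \<longlonglongrightarrow> 0"
proof (rule tendstoI)
  fix e' :: real assume e': "e' > 0"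
  \<comment> \<open>Each of the two laws contributes \<open>4 * e\<close> from the partition and
    \<open>e\<close> from the tail, the finitely many test functions a further \<open>e\<close>: in
    total \<open>11 * e < e'\<close>.\<close>
  define e where "e = e' / 12"
  have e: "e > 0" using e' by (simp add: e_def)
  \<comment> \<open>Outside \<open>S\<close> a 1-Lipschitz function vanishing at 0 is at most
    \<open>taxi x \<le> (taxi x)^2 / R\<close> in absolute value, so the tails cost at most
    \<open>K / R \<le> e\<close>.\<close>
  define R where "R = \<bar>K\<bar> / e + 1"
  have R: "R > 0" using e by (simp add: R_def add_nonneg_pos)
  have KR: "K / R \<le> e"
  proof -
    have "K \<le> e * R" using e by (simp add: R_def distrib_left)
    then show ?thesis using R by (simp add: field_simps)
  qed
  define S where "S = {x :: real \<times> real. taxi x \<le> R}"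
  have "closed S" unfolding S_def by (intro closed_Collect_le continuous_intros)
  moreover have "bounded S" unfolding S_def bounded_iff using norm_le_taxi order_trans by blast
  ultimately have "compact S" by (simp add: compact_eq_bounded_closed)
  then obtain P where P: "finite P" "S \<subseteq> (\<Union>p\<in>P. ball p e)"
    using e unfolding compact_eq_totally_bounded by blast
  define \<phi> where "\<phi> p x = max 0 (2 * e - dist x p)" for p x :: "real \<times> real"
  define \<Phi> where "\<Phi> x = (\<Sum>p\<in>P. \<phi> p x)" for x
  \<comment> \<open>The denominator never vanishes, and on \<open>S\<close> it equals
    \<open>\<Phi> x\<close>, since some bump is at least \<open>e\<close> there. The weights are
    thus continuous everywhere and sum to 1 on \<open>S\<close>.\<close>
  define \<psi> where "\<psi> p x = \<phi> p x / max e (\<Phi> x)" for p x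
  have \<phi>0: "\<phi> p x \<ge> 0" for p x by (simp add: \<phi>_def)
  have \<Phi>0: "\<Phi> x \<ge> 0" for x unfolding \<Phi>_def by (intro sum_nonneg \<phi>0)
  have \<psi>0: "\<psi> p x \<ge> 0" for p x using e \<phi>0 by (simp add: \<psi>_def le_max_iff_disj)
  have sum\<psi>: "(\<Sum>p\<in>P. \<psi> p x) = \<Phi> x / max e (\<Phi> x)" for x
    unfolding \<psi>_def \<Phi>_def by (simp add: sum_divide_distrib)
  have sum1: "(\<Sum>p\<in>P. \<psi> p x) \<le> 1" for x unfolding sum\<psi> using e by (auto simp: divide_le_eq_1 max_def)
  have \<psi>1: "\<psi> p x \<le> 1" if "p \<in> P" for p x
    using member_le_sum[of p P "\<lambda>p. \<psi> p x"] that P(1) \<psi>0 sum1[of x] by simp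
  have sum_S: "(\<Sum>p\<in>P. \<psi> p x) = 1" if "x \<in> S" for x
  proof -
    have "x \<in> (\<Union>p\<in>P. ball p e)" using P(2) that by blast
    then obtain p where p: "p \<in> P" "dist p x < e" unfolding UN_iff mem_ball by blast
    then have "e \<le> \<phi> p x" by (simp add: \<phi>_def dist_commute)
    also have "\<dots> \<le> \<Phi> x" unfolding \<Phi>_def using p P(1) \<phi>0 by (intro member_le_sum) auto
    finally show ?thesis unfolding sum\<psi> using e by (simp add: max_def)
  qed
  have cont\<psi>: "continuous_on UNIV (\<psi> p)" for p
    unfolding \<psi>_def \<Phi>_def \<phi>_def using e by (intro continuous_intros) (auto simp: max_def)
  have [measurable]: "\<psi> p \<in> borel_measurable borel" for p using cont\<psi> by (rule borel_measurable_continuous_onI)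
  have "(\<lambda>n. \<Sum>p\<in>P. taxi p * \<bar>(\<integral>x. \<psi> p x \<partial>M n) - (\<integral>x. \<psi> p x \<partial>N)\<bar>) \<longlonglongrightarrow> (\<Sum>p\<in>P. taxi p * 0)"
  proof (intro tendsto_intros tendsto_rabs_zero LIM_zero)
    fix p assume "p \<in> P"
    then have "norm (\<psi> p x) \<le> 1" for x using \<psi>0[of p x] \<psi>1[of p x] by simp
    then have "bounded (range (\<psi> p))" unfolding bounded_iff by blast
    then show "(\<lambda>n. \<integral>x. \<psi> p x \<partial>M n) \<longlonglongrightarrow> (\<integral>x. \<psi> p x \<partial>N)"
      using cont\<psi>[of p] by (intro w[unfolded weak_conv2_def, rule_format] conjI)
  qed
  then have "\<forall>\<^sub>F n in sequentially. (\<Sum>p\<in>P. taxi p * \<bar>(\<integral>x. \<psi> p x \<partial>M n) - (\<integral>x. \<psi> p x \<partial>N)\<bar>) < e"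
    using e by (intro order_tendstoD(2)[where y=0]) auto
  then show "\<forall>\<^sub>F n in sequentially. dist (wasserstein (M n) N) 0 < e'"
  proof eventually_elim
    case (elim n)
    have "wasserstein (M n) N \<le> 11 * e"
    proof (rule wasserstein_least)
      fix f assume f: "lip_taxi 1 f"
      define F where "F x = (\<Sum>p\<in>P. (f p - f 0) * \<psi> p x)" for x
      have approx: "\<bar>f x - f 0 - F x\<bar> \<le> 4 * e + (taxi x)\<^sup>2 / R" for x
      proof -
        have eq: "f x - f 0 - F x = (\<Sum>p\<in>P. \<psi> p x * (f x - f p)) + (1 - (\<Sum>p\<in>P. \<psi> p x)) * (f x - f 0)"
          unfolding F_def by (simp add: algebra_simps sum_subtractf sum.distrib sum_distrib_left sum_distrib_right)
        have "\<bar>\<Sum>p\<in>P. \<psi> p x * (f x - f p)\<bar> \<le> (\<Sum>p\<in>P. \<psi> p x * (4 * e))"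
        proof (rule order_trans[OF sum_abs sum_mono])
          fix p assume "p \<in> P"
          show "\<bar>\<psi> p x * (f x - f p)\<bar> \<le> \<psi> p x * (4 * e)"
          proof (cases "dist x p < 2 * e")
            case True
            have "\<bar>f x - f p\<bar> \<le> 2 * norm (x - p)"
              using lip_taxiD[OF f, of x p] taxi_le_norm[of "x - p"] by simp
            then have "\<bar>f x - f p\<bar> \<le> 4 * e" using True by (simp add: dist_norm)
            then show ?thesis using \<psi>0[of p x] by (simp add: abs_mult mult_left_mono)
          next
            case False
            then show ?thesis by (simp add: \<psi>_def \<phi>_def)
          qed
        qed
        also have "\<dots> \<le> 4 * e"
          using sum1[of x] e by (simp add: sum_distrib_right[symmetric] mult_left_le_one_le)
        finally have 1: "\<bar>\<Sum>p\<in>P. \<psi> p x * (f x - f p)\<bar> \<le> 4 * e" .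
        have 2: "\<bar>(1 - (\<Sum>p\<in>P. \<psi> p x)) * (f x - f 0)\<bar> \<le> (taxi x)\<^sup>2 / R"
        proof (cases "x \<in> S")
          case True
          then show ?thesis using R by (simp add: sum_S)
        next
          case False
          then have "R \<le> taxi x" by (simp add: S_def)
          have "0 \<le> (\<Sum>p\<in>P. \<psi> p x)" by (intro sum_nonneg \<psi>0)
          then have "\<bar>(1 - (\<Sum>p\<in>P. \<psi> p x)) * (f x - f 0)\<bar> \<le> 1 * taxi x"
            unfolding abs_mult using sum1[of x] lip_taxiD[OF f, of x 0] by (intro mult_mono) auto
          also have "\<dots> \<le> (taxi x)\<^sup>2 / R"
            using \<open>R \<le> taxi x\<close> R by (simp add: field_simps power2_eq_square mult_right_mono)
          finally show ?thesis .
        qed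
        show ?thesis unfolding eq using 1 2 by linarith
      qed
      have diff: "\<bar>(\<integral>x. f x \<partial>Q) - f 0 - (\<integral>x. F x \<partial>Q)\<bar> \<le> 5 * e \<and> (\<integral>x. F x \<partial>Q) = (\<Sum>p\<in>P. (f p - f 0) * (\<integral>x. \<psi> p x \<partial>Q))"
        if Q: "prob_space Q" "sets Q = sets borel" "integrable Q (\<lambda>x. (taxi x)\<^sup>2)" "finite_mean Q" "(\<integral>x. (taxi x)\<^sup>2 \<partial>Q) \<le> K" for Q
      proof -
        interpret prob_space Q by (rule Q)
        have int\<psi>: "integrable Q (\<psi> p)" if "p \<in> P" for p
          using that \<psi>0 \<psi>1 by (intro bounded_integrable[OF Q(1,2), where B=1]) auto
        have F: "(\<integral>x. F x \<partial>Q) = (\<Sum>p\<in>P. (f p - f 0) * (\<integral>x. \<psi> p x \<partial>Q))"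
          unfolding F_def using int\<psi> by (subst Bochner_Integration.integral_sum) auto
        have intF: "integrable Q F" unfolding F_def using int\<psi> by (intro Bochner_Integration.integrable_sum) auto
        have intf: "integrable Q f" using Q f by (intro lip_taxi_integrable[of _ 1]) auto
        have "(\<integral>x. f x \<partial>Q) - f 0 - (\<integral>x. F x \<partial>Q) = (\<integral>x. f x - f 0 - F x \<partial>Q)"
          using intf intF by (simp add: prob_space)
        also have "\<bar>\<dots>\<bar> \<le> (\<integral>x. \<bar>f x - f 0 - F x\<bar> \<partial>Q)" by (rule integral_abs_bound)
        also have "\<dots> \<le> (\<integral>x. 4 * e + (taxi x)\<^sup>2 / R \<partial>Q)"
          using intf intF Q(3) by (intro integral_mono approx) auto
        also have "\<dots> = 4 * e + (\<integral>x. (taxi x)\<^sup>2 \<partial>Q) / R" using Q(3) by (simp add: prob_space)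
        also have "\<dots> \<le> 4 * e + K / R" using R Q(5) by (intro add_mono divide_right_mono) auto
        also have "\<dots> \<le> 5 * e" using KR by simp
        finally show ?thesis using F by simp
      qed
      have dM: "\<bar>(\<integral>x. f x \<partial>M n) - f 0 - (\<integral>x. F x \<partial>M n)\<bar> \<le> 5 * e"
           "(\<integral>x. F x \<partial>M n) = (\<Sum>p\<in>P. (f p - f 0) * (\<integral>x. \<psi> p x \<partial>M n))"
        using diff[of "M n"] M[of n] fM[of n] K(1)[of n] by auto
      have dN: "\<bar>(\<integral>x. f x \<partial>N) - f 0 - (\<integral>x. F x \<partial>N)\<bar> \<le> 5 * e"
           "(\<integral>x. F x \<partial>N) = (\<Sum>p\<in>P. (f p - f 0) * (\<integral>x. \<psi> p x \<partial>N))"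
        using diff[of N] N fN K(2) by auto
      have "(\<integral>x. F x \<partial>M n) - (\<integral>x. F x \<partial>N) = (\<Sum>p\<in>P. (f p - f 0) * ((\<integral>x. \<psi> p x \<partial>M n) - (\<integral>x. \<psi> p x \<partial>N)))"
        unfolding dM(2) dN(2) by (simp add: sum_subtractf right_diff_distrib)
      also have "\<bar>\<dots>\<bar> \<le> (\<Sum>p\<in>P. taxi p * \<bar>(\<integral>x. \<psi> p x \<partial>M n) - (\<integral>x. \<psi> p x \<partial>N)\<bar>)"
        using lip_taxiD[OF f, of _ 0] by (intro order_trans[OF sum_abs sum_mono]) (auto simp: abs_mult intro!: mult_right_mono)
      also have "\<dots> < e" by (rule elim)
      finally show "\<bar>(\<integral>x. f x \<partial>M n) - (\<integral>x. f x \<partial>N)\<bar> \<le> 11 * e" using dM(1) dN(1) by linarith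
    qed
    then show ?case using wasserstein_nonneg[OF fM fN, of n] e by (simp add: e_def)
  qed
qed

section \<open>The recursion for the scaled quantities\<close>

definition mean_T :: "real \<Rightarrow> nat \<Rightarrow> real" where
  "mean_T \<theta> n = shape_exp \<theta> n (\<lambda>t. real (tlen t))"

definition mean_W :: "real \<Rightarrow> nat \<Rightarrow> real" where
  "mean_W \<theta> n = shape_exp \<theta> n (\<lambda>t. real (twiener t))"

definition scaled_shape :: "real \<Rightarrow> nat \<Rightarrow> unit tree \<Rightarrow> real \<times> real" where
  "scaled_shape \<theta> n t =
     ((real (twiener t) - mean_W \<theta> n) / (real n)\<^sup>2, (real (tlen t) - mean_T \<theta> n) / real n)"

lemma scaled_WT_eq_scaled_shape:
  assumes "\<theta> > 0" "n > 0" "J \<in> set_pmf (hoppe_tree \<theta> n)"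
  shows "scaled_WT \<theta> n J = scaled_shape \<theta> n (shape (encode J n))"
proof -
  have wt: "wiener n J' = twiener (encode J' n)" "total_length n J' = tlen (encode J' n)"
    if "J' \<in> set_pmf (hoppe_tree \<theta> n)" for J'
    using hoppe_tree_support[OF assms(1) that] assms(2)
    by (auto intro!: wiener_eq_twiener total_length_eq_tlen)
  have "measure_pmf.expectation (hoppe_tree \<theta> n) (\<lambda>J'. real (wiener n J')) = mean_W \<theta> n"
    unfolding mean_W_def shape_pmf_def integral_map_pmf
    by (intro integral_cong_AE) (auto intro!: AE_pmfI simp: wt)
  moreover have "measure_pmf.expectation (hoppe_tree \<theta> n) (\<lambda>J'. real (total_length n J')) = mean_T \<theta> n"
    unfolding mean_T_def shape_pmf_def integral_map_pmf
    by (intro integral_cong_AE) (auto intro!: AE_pmfI simp: wt)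
  ultimately show ?thesis
    by (simp add: scaled_WT_def scaled_shape_def wt[OF assms(3)])
qed

lemma sets_hoppe_law [simp, measurable_cong]: "sets (hoppe_law \<theta> n) = sets borel"
  by (simp add: hoppe_law_def)

lemma prob_space_hoppe_law: "prob_space (hoppe_law \<theta> n)"
  unfolding hoppe_law_def by (intro measure_pmf.prob_space_distr) simp

lemma integrable_hoppe_law:
  fixes g :: "real \<times> real \<Rightarrow> real"
  assumes "\<theta> > 0" "g \<in> borel_measurable borel"
  shows "integrable (hoppe_law \<theta> n) g"
  unfolding hoppe_law_def using assms
  by (subst integrable_distr_eq) (auto intro!: integrable_measure_pmf_finite finite_set_pmf_hoppe_tree)

lemma integral_hoppe_law:
  fixes g :: "real \<times> real \<Rightarrow> real"
  assumes "\<theta> > 0" "n > 0" "g \<in> borel_measurable borel"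
  shows "(\<integral>x. g x \<partial>hoppe_law \<theta> n) = shape_exp \<theta> n (\<lambda>t. g (scaled_shape \<theta> n t))"
  unfolding hoppe_law_def shape_pmf_def integral_map_pmf using assms
  by (subst integral_distr) (auto intro!: integral_cong_AE AE_pmfI simp: scaled_WT_eq_scaled_shape)

lemma hoppe_law_centered:
  assumes "\<theta> > 0" "n > 0"
  shows "centered_L2 (hoppe_law \<theta> n)"
proof -
  have "shape_exp \<theta> n (\<lambda>t. (real (twiener t) - mean_W \<theta> n) / (real n)\<^sup>2) = 0"
    using assms measure_pmf.prob_space[of "shape_pmf \<theta> n"] by (simp add: mean_W_def)
  moreover have "shape_exp \<theta> n (\<lambda>t. (real (tlen t) - mean_T \<theta> n) / real n) = 0"
    using assms measure_pmf.prob_space[of "shape_pmf \<theta> n"] by (simp add: mean_T_def)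
  ultimately show ?thesis
    unfolding centered_L2_def using assms
    by (auto intro!: integrable_hoppe_law prob_space_hoppe_law
        simp: integral_hoppe_law[of \<theta> n fst] integral_hoppe_law[of \<theta> n snd] scaled_shape_def)
qed

definition affine_map :: "real \<times> real \<Rightarrow> real \<times> real \<Rightarrow> real \<Rightarrow> real \<times> real \<Rightarrow> real \<times> real" where
  "affine_map x' x v b =
     ((1 - v)\<^sup>2 * fst x' + v * (1 - v) * snd x' + v\<^sup>2 * fst x + v * (1 - v) * snd x + fst b,
      (1 - v) * snd x' + v * snd x + snd b)"

lemma measurable_affine_map [measurable]:
  assumes [measurable]: "f \<in> borel_measurable M" "g \<in> borel_measurable M" "h \<in> borel_measurable M" "k \<in> borel_measurable M"
  shows "(\<lambda>w. affine_map (f w) (g w) (h w) (k w)) \<in> borel_measurable M"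
  unfolding affine_map_def by measurable

text \<open>The finite-size toll for \<open>n = N + 2\<close> vertices when the subtree of vertex 1 has size \<open>i + 1\<close>.\<close>

definition finite_toll :: "real \<Rightarrow> nat \<Rightarrow> nat \<Rightarrow> real \<times> real" where
  "finite_toll \<theta> N i = (let n = real (N + 2); k = real (Suc i); m = real (Suc (N - i)) in
     ((mean_W \<theta> (Suc (N - i)) + mean_W 1 (Suc i) + k * mean_T \<theta> (Suc (N - i)) + m * mean_T 1 (Suc i)
        + k * m - mean_W \<theta> (N + 2)) / n\<^sup>2,
      (mean_T \<theta> (Suc (N - i)) + mean_T 1 (Suc i) + k - mean_T \<theta> (N + 2)) / n))"

text \<open>The recursions of \<open>tlen\<close> and \<open>twiener\<close> after centering and
  scaling: each part carries its own normalisation, the quotients of sizes become powers of the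
  share, and all deterministic remainders collect in the toll.\<close>

lemma scaled_shape_Join:
  assumes "i \<le> N" "tsize s = Suc i" "tsize r = Suc (N - i)"
  shows "scaled_shape \<theta> (N + 2) (Join s r) = affine_map (scaled_shape \<theta> (Suc (N - i)) r) (scaled_shape 1 (Suc i) s)
      (share N i) (finite_toll \<theta> N i)"
proof -
  define n k m where "n = real (N + 2)" and "k = real (Suc i)" and "m = real (Suc (N - i))"
  have nkm: "n = k + m" "k > 0" "m > 0" "n > 0"
    using assms(1) by (auto simp: n_def k_def m_def of_nat_diff)
  have 1: "1 - k / n = m / n" using nkm by (simp add: field_simps)
  define Ws Ts Wr Tr where "Ws = real (twiener s)" and "Ts = real (tlen s)" and "Wr = real (twiener r)" and "Tr = real (tlen r)"
  define a b c d where "a = mean_W \<theta> (Suc (N - i))" and "b = mean_T \<theta> (Suc (N - i))"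
    and "c = mean_W 1 (Suc i)" and "d = mean_T 1 (Suc i)"
  define e f where "e = mean_W \<theta> (N + 2)" and "f = mean_T \<theta> (N + 2)"
  have "(Ws + Wr + k * Tr + m * Ts + k * m - e) / n\<^sup>2
     = (m / n)\<^sup>2 * ((Wr - a) / m\<^sup>2) + k / n * (m / n) * ((Tr - b) / m) + (k / n)\<^sup>2 * ((Ws - c) / k\<^sup>2)
        + k / n * (m / n) * ((Ts - d) / k) + (a + c + k * b + m * d + k * m - e) / n\<^sup>2"
    using nkm(2-4) by (simp add: divide_simps power2_eq_square) (simp add: algebra_simps)
  moreover have "(Ts + Tr + k - f) / n = m / n * ((Tr - b) / m) + k / n * ((Ts - d) / k) + (b + d + k - f) / n"
    using nkm(2-4) by (simp add: divide_simps)
  ultimately show ?thesis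
    unfolding scaled_shape_def affine_map_def finite_toll_def Let_def
    by (simp only: twiener.simps tlen.simps of_nat_add of_nat_mult assms(2,3) fst_conv snd_conv
        n_def[symmetric] k_def[symmetric] m_def[symmetric] 1
        Ws_def[symmetric] Ts_def[symmetric] Wr_def[symmetric] Tr_def[symmetric]
        a_def[symmetric] b_def[symmetric] c_def[symmetric] d_def[symmetric] e_def[symmetric] f_def[symmetric]
        n_def[unfolded of_nat_add, symmetric])
qed

text \<open>Finite counterpart of \<open>hoppe_fixpoint\<close>, with the share in place of
  \<open>V\<close> and the finite toll in place of its limit.\<close>

lemma hoppe_law_split:
  fixes g :: "real \<times> real \<Rightarrow> real"
  assumes "\<theta> > 0" and [measurable]: "g \<in> borel_measurable borel"
  shows "(\<integral>x. g x \<partial>hoppe_law \<theta> (N + 2)) = (\<Sum>i\<le>N. split_weight \<theta> N i *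
     (\<integral>x. (\<integral>x'. g (affine_map x' x (share N i) (finite_toll \<theta> N i)) \<partial>hoppe_law \<theta> (Suc (N - i))) \<partial>hoppe_law 1 (Suc i)))"
proof -
  have "(\<integral>x. g x \<partial>hoppe_law \<theta> (N + 2)) = (\<Sum>i\<le>N. split_weight \<theta> N i *
     shape_exp 1 (Suc i) (\<lambda>s. shape_exp \<theta> (Suc (N - i)) (\<lambda>r. g (scaled_shape \<theta> (N + 2) (Join s r)))))"
    using assms by (subst integral_hoppe_law) (auto intro!: shape_exp_split simp del: add_2_eq_Suc')
  also have "\<dots> = (\<Sum>i\<le>N. split_weight \<theta> N i *
     (\<integral>x. (\<integral>x'. g (affine_map x' x (share N i) (finite_toll \<theta> N i)) \<partial>hoppe_law \<theta> (Suc (N - i))) \<partial>hoppe_law 1 (Suc i)))"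
  proof (intro sum.cong refl arg_cong2[where f="(*)"])
    fix i assume "i \<in> {..N}"
    then have i: "i \<le> N" by simp
    interpret P: prob_space "hoppe_law \<theta> (Suc (N - i))" by (rule prob_space_hoppe_law)
    have [measurable]: "(\<lambda>x. \<integral>x'. g (affine_map x' x (share N i) (finite_toll \<theta> N i)) \<partial>hoppe_law \<theta> (Suc (N - i))) \<in> borel_measurable borel"
      by (rule P.borel_measurable_lebesgue_integral) measurable
    have "(\<integral>x. (\<integral>x'. g (affine_map x' x (share N i) (finite_toll \<theta> N i)) \<partial>hoppe_law \<theta> (Suc (N - i))) \<partial>hoppe_law 1 (Suc i))
      = shape_exp 1 (Suc i) (\<lambda>s. \<integral>x'. g (affine_map x' (scaled_shape 1 (Suc i) s) (share N i) (finite_toll \<theta> N i)) \<partial>hoppe_law \<theta> (Suc (N - i)))"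
      by (subst integral_hoppe_law) auto
    also have "\<dots> = shape_exp 1 (Suc i) (\<lambda>s. shape_exp \<theta> (Suc (N - i))
        (\<lambda>r. g (affine_map (scaled_shape \<theta> (Suc (N - i)) r) (scaled_shape 1 (Suc i) s) (share N i) (finite_toll \<theta> N i))))"
      using assms by (subst integral_hoppe_law) auto
    also have "\<dots> = shape_exp 1 (Suc i) (\<lambda>s. shape_exp \<theta> (Suc (N - i)) (\<lambda>r. g (scaled_shape \<theta> (N + 2) (Join s r))))"
      by (intro shape_exp_cong arg_cong[where f=g] scaled_shape_Join[symmetric] i assms) auto
    finally show "shape_exp 1 (Suc i) (\<lambda>s. shape_exp \<theta> (Suc (N - i)) (\<lambda>r. g (scaled_shape \<theta> (N + 2) (Join s r))))
      = (\<integral>x. (\<integral>x'. g (affine_map x' x (share N i) (finite_toll \<theta> N i)) \<partial>hoppe_law \<theta> (Suc (N - i))) \<partial>hoppe_law 1 (Suc i))"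
      by simp
  qed
  finally show ?thesis .
qed

subsection \<open>Means\<close>

text \<open>Analogue of the harmonic number, equal to
  \<open>Digamma (\<theta> + 1 + m) - Digamma (\<theta> + 1)\<close>.\<close>

definition shifted_harm :: "real \<Rightarrow> nat \<Rightarrow> real" where
  "shifted_harm \<theta> m = (\<Sum>j<m. inverse (\<theta> + 1 + real j))"

text \<open>By \<open>grow_tlen\<close>, the quotient of the mean by \<open>\<theta> + m\<close>
  increases by \<open>1 / (\<theta> + 1 + m)\<close> in each step.\<close>

lemma mean_T_eq:
  assumes "\<theta> > 0"
  shows "mean_T \<theta> (Suc m) = (\<theta> + real m) * shifted_harm \<theta> m"
proof (induction m)
  case 0
  show ?case by (simp add: mean_T_def shape_exp_1[unfolded One_nat_def] shifted_harm_def)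
next
  case (Suc m)
  have p: "\<theta> + real m > 0" "\<theta> + 1 + real m > 0" using assms by auto
  have "mean_T \<theta> (Suc (Suc m)) = shape_exp \<theta> (Suc m) (\<lambda>t. (\<theta> + real (Suc m)) * real (tlen t) + (\<theta> + real m)) / (\<theta> + real m)"
  proof -
    have "shape_exp \<theta> (Suc m) (\<lambda>t. grow t \<theta> (\<lambda>t. real (tlen t)))
       = shape_exp \<theta> (Suc m) (\<lambda>t. (\<theta> + real (Suc m)) * real (tlen t) + (\<theta> + real m))"
      using assms by (intro shape_exp_cong) (simp_all add: grow_tlen)
    then show ?thesis unfolding mean_T_def using assms by (subst shape_exp_Suc) simp_all
  qed
  also have "\<dots> = ((\<theta> + real (Suc m)) * mean_T \<theta> (Suc m) + (\<theta> + real m)) / (\<theta> + real m)"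
    using assms measure_pmf.prob_space[of "shape_pmf \<theta> (Suc m)"] by (simp add: mean_T_def)
  also have "\<dots> = (\<theta> + real (Suc m)) * (shifted_harm \<theta> m + inverse (\<theta> + 1 + real m))"
    unfolding Suc using p by (simp add: field_simps)
  finally show ?case by (simp add: shifted_harm_def)
qed

text \<open>The closed form solves the linear recursion given by \<open>grow_twiener\<close>, whose
  term with \<open>\<theta> - 1\<close> brings in the mean path length. The subtracted fraction
  becomes the constant \<open>2 / (\<theta> + 1)\<close> by which the asymptotics of the two scaled
  means differ.\<close>

lemma mean_W_eq:
  assumes "\<theta> > 0"
  shows "mean_W \<theta> (Suc m) = (\<theta> + real m) * ((real m + 2) * shifted_harm \<theta> m - 2 * real m / (\<theta> + 1))"
proof (induction m)
  case 0
  show ?case by (simp add: mean_W_def shape_exp_1[unfolded One_nat_def] shifted_harm_def)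
next
  case (Suc m)
  define p where "p = \<theta> + real m"
  have p: "p > 0" "p + 1 > 0" using assms by (auto simp: p_def)
  have "mean_W \<theta> (Suc (Suc m)) = shape_exp \<theta> (Suc m) (\<lambda>t. (p + 2) * real (twiener t)
      + ((\<theta> - 1) * real (tlen t) + (real m + 1) * p)) / p"
  proof -
    have "shape_exp \<theta> (Suc m) (\<lambda>t. grow t \<theta> (\<lambda>t. real (twiener t)))
       = shape_exp \<theta> (Suc m) (\<lambda>t. (p + 2) * real (twiener t) + ((\<theta> - 1) * real (tlen t) + (real m + 1) * p))"
      using assms by (intro shape_exp_cong) (simp_all add: grow_twiener p_def algebra_simps)
    then show ?thesis unfolding mean_W_def using assms by (subst shape_exp_Suc) (simp_all add: p_def)
  qed
  also have "\<dots> = ((p + 2) * mean_W \<theta> (Suc m) + ((\<theta> - 1) * mean_T \<theta> (Suc m) + (real m + 1) * p)) / p"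
    using assms measure_pmf.prob_space[of "shape_pmf \<theta> (Suc m)"] by (simp add: mean_T_def mean_W_def)
  also have "\<dots> = (p + 2) * ((real m + 2) * shifted_harm \<theta> m - 2 * real m / (\<theta> + 1)) + (\<theta> - 1) * shifted_harm \<theta> m + (real m + 1)"
    unfolding Suc mean_T_eq[OF assms] p_def[symmetric] using p by (simp add: field_simps)
  also have "\<dots> = (p + 1) * ((real m + 3) * (shifted_harm \<theta> m + inverse (p + 1)) - 2 * (real m + 1) / (\<theta> + 1))"
    using p assms by (simp add: divide_simps) (simp add: p_def algebra_simps)
  also have "inverse (p + 1) = inverse (\<theta> + 1 + real m)" by (simp add: p_def add_ac)
  finally show ?case by (simp add: shifted_harm_def p_def add_ac)
qed

lemma shifted_harm_asymptotic:
  assumes "\<theta> > 0"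
  shows "(\<lambda>m. shifted_harm \<theta> m - ln (real m)) \<longlonglongrightarrow> - Digamma (\<theta> + 1)"
  using tendsto_minus[OF Digamma_LIMSEQ[of "\<theta> + 1"]] assms by (simp add: shifted_harm_def)

lemma mean_T_asymptotic:
  assumes "\<theta> > 0"
  shows "(\<lambda>n. mean_T \<theta> n / real n - ln (real n)) \<longlonglongrightarrow> - Digamma (\<theta> + 1)"
proof (subst filterlim_sequentially_Suc[symmetric])
  have "(\<lambda>m. (\<theta> + real m) / (real m + 1)) \<longlonglongrightarrow> 1" by real_asymp
  moreover have "(\<lambda>m. (\<theta> + real m) / (real m + 1) * ln (real m) - ln (real m + 1)) \<longlonglongrightarrow> 0" by real_asymp
  ultimately have "(\<lambda>m. (\<theta> + real m) / (real m + 1) * (shifted_harm \<theta> m - ln (real m))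
      + ((\<theta> + real m) / (real m + 1) * ln (real m) - ln (real m + 1))) \<longlonglongrightarrow> 1 * - Digamma (\<theta> + 1) + 0"
    by (intro tendsto_intros shifted_harm_asymptotic assms)
  then show "(\<lambda>m. mean_T \<theta> (Suc m) / real (Suc m) - ln (real (Suc m))) \<longlonglongrightarrow> - Digamma (\<theta> + 1)"
    by (simp add: mean_T_eq[OF assms] right_diff_distrib diff_divide_distrib add.commute)
qed

lemma mean_W_asymptotic:
  assumes "\<theta> > 0"
  shows "(\<lambda>n. mean_W \<theta> n / (real n)\<^sup>2 - ln (real n)) \<longlonglongrightarrow> - Digamma (\<theta> + 1) - 2 / (\<theta> + 1)"
proof (subst filterlim_sequentially_Suc[symmetric])
  let ?c = "\<lambda>m. (\<theta> + real m) * (real m + 2) / (real m + 1)\<^sup>2"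
  have 1: "?c \<longlonglongrightarrow> 1" by real_asymp
  have 2: "(\<lambda>m. ?c m * ln (real m) - ln (real m + 1)) \<longlonglongrightarrow> 0" by real_asymp
  have "(\<lambda>m. (\<theta> + real m) * real m / (real m + 1)\<^sup>2) \<longlonglongrightarrow> 1" by real_asymp
  then have 3: "(\<lambda>m. (\<theta> + real m) * real m / (real m + 1)\<^sup>2 * (2 / (\<theta> + 1))) \<longlonglongrightarrow> 1 * (2 / (\<theta> + 1))"
    by (intro tendsto_intros)
  have "(\<lambda>m. ?c m * (shifted_harm \<theta> m - ln (real m)) + (?c m * ln (real m) - ln (real m + 1))
      - (\<theta> + real m) * real m / (real m + 1)\<^sup>2 * (2 / (\<theta> + 1))) \<longlonglongrightarrow> 1 * - Digamma (\<theta> + 1) + 0 - 1 * (2 / (\<theta> + 1))"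
    by (intro tendsto_diff[OF tendsto_add[OF tendsto_mult[OF 1 shifted_harm_asymptotic[OF assms]] 2] 3])
  also have "(\<lambda>m. ?c m * (shifted_harm \<theta> m - ln (real m)) + (?c m * ln (real m) - ln (real m + 1))
      - (\<theta> + real m) * real m / (real m + 1)\<^sup>2 * (2 / (\<theta> + 1)))
      = (\<lambda>m. mean_W \<theta> (Suc m) / (real (Suc m))\<^sup>2 - ln (real (Suc m)))"
  proof
    fix m
    define q where "q = (real m + 1)\<^sup>2"
    have r: "real (Suc m) = real m + 1" by simp
    show "?c m * (shifted_harm \<theta> m - ln (real m)) + (?c m * ln (real m) - ln (real m + 1))
      - (\<theta> + real m) * real m / (real m + 1)\<^sup>2 * (2 / (\<theta> + 1)) = mean_W \<theta> (Suc m) / (real (Suc m))\<^sup>2 - ln (real (Suc m))"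
      unfolding mean_W_eq[OF assms] r q_def[symmetric]
      by (simp add: right_diff_distrib diff_divide_distrib mult_ac)
  qed
  finally show "(\<lambda>m. mean_W \<theta> (Suc m) / (real (Suc m))\<^sup>2 - ln (real (Suc m))) \<longlonglongrightarrow> - Digamma (\<theta> + 1) - 2 / (\<theta> + 1)"
    by simp
qed

section \<open>The toll and its limit\<close>

definition limit_toll :: "real \<Rightarrow> real \<Rightarrow> real \<times> real" where
  "limit_toll \<theta> v = (let c = entropy_fn v + (Digamma (\<theta> + 1) - Digamma 2) * v in
     (((\<theta> + 5) / (\<theta> + 1) - (2 * \<theta> + 4) / (\<theta> + 1) * v) * v + c, v + c))"

lemma hoppe_map_eq_affine_map: "hoppe_map \<theta> x' x v = affine_map x' x v (limit_toll \<theta> v)"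
  by (simp add: hoppe_map_def affine_map_def limit_toll_def Let_def)

text \<open>For small \<open>m\<close> the error \<open>e m\<close> need not be small, but the
  fraction \<open>m / n\<close> is. This gives uniformity over all splits, including very unbalanced
  ones.\<close>

lemma fraction_weighted_null:
  fixes e :: "nat \<Rightarrow> real"
  assumes "e \<longlonglongrightarrow> 0" "x > 0"
  shows "\<forall>\<^sub>F n in sequentially. \<forall>m\<le>n. real m / real n * \<bar>e m\<bar> \<le> x"
proof -
  obtain M where M: "\<And>n. \<bar>e n\<bar> \<le> M"
    using convergent_imp_bounded[OF assms(1)] unfolding bounded_iff by auto
  obtain n0 where n0: "\<And>n. n \<ge> n0 \<Longrightarrow> \<bar>e n\<bar> \<le> x"
    using LIMSEQ_D[OF assms] by (auto intro: less_imp_le)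
  have "(\<lambda>n. real n0 * M / real n) \<longlonglongrightarrow> 0" by real_asymp
  then have "\<forall>\<^sub>F n in sequentially. real n0 * M / real n < x" using assms(2) by (rule order_tendstoD(2))
  then show ?thesis
  proof eventually_elim
    case (elim n)
    show ?case
    proof (intro allI impI)
      fix m assume m: "m \<le> n"
      show "real m / real n * \<bar>e m\<bar> \<le> x"
      proof (cases "m \<ge> n0")
        case True
        have "real m / real n * \<bar>e m\<bar> \<le> 1 * x" using m n0[OF True] by (intro mult_mono) (auto simp: divide_le_eq_1)
        then show ?thesis by simp
      next
        case False
        have "real m / real n * \<bar>e m\<bar> \<le> real n0 / real n * M"
          using False M[of m] by (intro mult_mono divide_right_mono) auto
        then show ?thesis using elim by simp
      qed
    qed
  qed
qed

text \<open>The means are written as size (or its square) times logarithm plus constant plus error.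
  The terms \<open>ln n\<close> cancel because \<open>(1 - u)^2 + u^2 + 2 u (1 - u) = 1\<close>; the
  logarithms of the shares combine to \<open>u ln u + (1 - u) ln (1 - u)\<close>, and the different
  constants for the parameters \<theta> and 1 give the Digamma term. These identities are exact,
  only the errors are estimated.\<close>

lemma finite_toll_tendsto:
  assumes "\<theta> > 0" "x > 0"
  shows "\<forall>\<^sub>F N in sequentially. \<forall>i\<le>N.
    \<bar>fst (finite_toll \<theta> N i) - fst (limit_toll \<theta> (share N i))\<bar> \<le> x \<and>
    \<bar>snd (finite_toll \<theta> N i) - snd (limit_toll \<theta> (share N i))\<bar> \<le> x"
proof -
  define eT where "eT c n = mean_T c n / real n - ln (real n) - (- Digamma (c + 1))" for c n
  define eW where "eW c n = mean_W c n / (real n)\<^sup>2 - ln (real n) - (- Digamma (c + 1) - 2 / (c + 1))" for c n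
  have eT: "eT c \<longlonglongrightarrow> 0" and eW: "eW c \<longlonglongrightarrow> 0" if "c > 0" for c
    using LIM_zero[OF mean_T_asymptotic[OF that]] LIM_zero[OF mean_W_asymptotic[OF that]]
    by (simp_all add: eT_def[abs_def] eW_def[abs_def])
  have shift: "eventually P sequentially \<Longrightarrow> \<forall>\<^sub>F N in sequentially. P (N + 2)" for P
    by (rule sequentially_offset)
  \<comment> \<open>The first coordinate carries five error terms, the second three.\<close>
  have y: "x / 5 > 0" using assms by simp
  have "\<forall>\<^sub>F N in sequentially. \<bar>eT \<theta> (N + 2)\<bar> \<le> x / 5" "\<forall>\<^sub>F N in sequentially. \<bar>eW \<theta> (N + 2)\<bar> \<le> x / 5"
    using shift[OF order_tendstoD(2)[OF tendsto_rabs_zero[OF eT[OF assms(1)]] y]]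
      shift[OF order_tendstoD(2)[OF tendsto_rabs_zero[OF eW[OF assms(1)]] y]]
    by (auto elim: eventually_mono)
  moreover note shift[OF fraction_weighted_null[OF eT[OF assms(1)] y]]
    shift[OF fraction_weighted_null[OF eW[OF assms(1)] y]]
    shift[OF fraction_weighted_null[OF eT[OF zero_less_one] y]]
    shift[OF fraction_weighted_null[OF eW[OF zero_less_one] y]]
  ultimately show ?thesis
  proof eventually_elim
    case (elim N)
    show ?case
    proof (intro allI impI)
      fix i assume i: "i \<le> N"
      define n k m where "n = real (N + 2)" and "k = real (Suc i)" and "m = real (Suc (N - i))"
      have nkm: "n = k + m" "k > 0" "m > 0" "n > 0"
        using i by (auto simp: n_def k_def m_def of_nat_diff)
      define u where "u = k / n"
      have u1: "1 - u = m / n" using nkm by (simp add: u_def field_simps)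
      have u: "0 < u" "u < 1" using nkm by (auto simp: u_def field_simps)
      define a b c d where "a = eW \<theta> (Suc (N - i))" and "b = eT \<theta> (Suc (N - i))"
        and "c = eW 1 (Suc i)" and "d = eT 1 (Suc i)"
      define e f where "e = eW \<theta> (N + 2)" and "f = eT \<theta> (N + 2)"
      define D where "D = Digamma (\<theta> + 1)"
      have lnk: "ln k = ln u + ln n" using nkm by (simp add: u_def ln_div)
      have lnm: "ln m = ln (1 - u) + ln n" using nkm by (simp add: u1 ln_div)
      have T: "mean_T \<theta> (Suc (N - i)) = m * (ln m - D + b)" "mean_T 1 (Suc i) = k * (ln k - Digamma 2 + d)"
         "mean_T \<theta> (N + 2) = n * (ln n - D + f)"
        using nkm unfolding b_def d_def f_def eT_def m_def[symmetric] k_def[symmetric] n_def[symmetric] D_def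
        by (simp_all add: field_simps)
      have W: "mean_W \<theta> (Suc (N - i)) = m\<^sup>2 * (ln m - D - 2 / (\<theta> + 1) + a)" "mean_W 1 (Suc i) = k\<^sup>2 * (ln k - Digamma 2 - 1 + c)"
         "mean_W \<theta> (N + 2) = n\<^sup>2 * (ln n - D - 2 / (\<theta> + 1) + e)"
        using nkm unfolding a_def c_def e_def eW_def m_def[symmetric] k_def[symmetric] n_def[symmetric] D_def
        by simp_all
      have mk: "m = (1 - u) * n" "k = u * n" using u1 nkm by (auto simp: u_def)
      \<comment> \<open>All logarithms and constants are absorbed by \<open>limit_toll\<close>; just
        the errors in the means remain, each with a coefficient bounded by the matching
        fraction.\<close>
      have fst_eq: "fst (finite_toll \<theta> N i) - fst (limit_toll \<theta> u)
         = (1 - u)\<^sup>2 * a + u\<^sup>2 * c + u * (1 - u) * b + u * (1 - u) * d - e"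
      proof -
        have "fst (finite_toll \<theta> N i) = (m\<^sup>2 * (ln m - D - 2 / (\<theta> + 1) + a) + k\<^sup>2 * (ln k - Digamma 2 - 1 + c)
            + k * (m * (ln m - D + b)) + m * (k * (ln k - Digamma 2 + d)) + k * m - n\<^sup>2 * (ln n - D - 2 / (\<theta> + 1) + e)) / n\<^sup>2"
          unfolding finite_toll_def Let_def T W by (simp only: fst_conv n_def k_def m_def)
        also have "\<dots> = (1 - u)\<^sup>2 * (ln (1 - u) + ln n - D - 2 / (\<theta> + 1) + a) + u\<^sup>2 * (ln u + ln n - Digamma 2 - 1 + c)
            + u * (1 - u) * (ln (1 - u) + ln n - D + b) + u * (1 - u) * (ln u + ln n - Digamma 2 + d) + u * (1 - u)
            - (ln n - D - 2 / (\<theta> + 1) + e)"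
        proof -
          have cancel: "x / n\<^sup>2 = y" if "x = n\<^sup>2 * y" for x y using that nkm(4) by simp
          define q where "q = 2 / (\<theta> + 1)"
          show ?thesis
            unfolding lnk lnm q_def[symmetric] unfolding mk
            by (rule cancel) (simp add: algebra_simps power2_eq_square)
        qed
        \<comment> \<open>Both rational coefficients are affine in
          \<open>1 / (\<theta> + 1)\<close>, which leaves a polynomial identity.\<close>
        moreover define z where "z = 1 / (\<theta> + 1)"
        have "fst (limit_toll \<theta> u) = ((1 + 4 * z) - (2 + 2 * z) * u) * u + entropy_fn u + (D - Digamma 2) * u"
        proof -
          have "(\<theta> + 5) / (\<theta> + 1) = 1 + 4 * z" "(2 * \<theta> + 4) / (\<theta> + 1) = 2 + 2 * z"
            using assms(1) by (auto simp: z_def field_simps)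
          then show ?thesis by (simp add: limit_toll_def Let_def D_def)
        qed
        moreover have "2 / (\<theta> + 1) = 2 * z" by (simp add: z_def)
        ultimately show ?thesis
          by (simp only: entropy_fn_def) (simp add: algebra_simps power2_eq_square)
      qed
      have snd_eq: "snd (finite_toll \<theta> N i) - snd (limit_toll \<theta> u) = (1 - u) * b + u * d - f"
      proof -
        have "snd (finite_toll \<theta> N i) = (m * (ln m - D + b) + k * (ln k - Digamma 2 + d) + k - n * (ln n - D + f)) / n"
          unfolding finite_toll_def Let_def T by (simp only: snd_conv n_def k_def m_def)
        also have "\<dots> = (1 - u) * (ln (1 - u) + ln n - D + b) + u * (ln u + ln n - Digamma 2 + d) + u - (ln n - D + f)"
          unfolding lnk lnm unfolding mk using nkm(4) by (simp add: field_simps)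
        finally show ?thesis
          by (simp add: limit_toll_def entropy_fn_def Let_def D_def algebra_simps)
      qed
      have le: "Suc (N - i) \<le> N + 2" "Suc i \<le> N + 2" using i by auto
      have small: "(1 - u) * \<bar>a\<bar> \<le> x / 5" "(1 - u) * \<bar>b\<bar> \<le> x / 5" "u * \<bar>c\<bar> \<le> x / 5" "u * \<bar>d\<bar> \<le> x / 5"
          "\<bar>e\<bar> \<le> x / 5" "\<bar>f\<bar> \<le> x / 5"
        using elim le unfolding u1 unfolding u_def a_def b_def c_def d_def e_def f_def n_def k_def m_def by blast+
      have shrink: "p * (q * \<bar>z\<bar>) \<le> x / 5" if "q * \<bar>z\<bar> \<le> x / 5" "0 \<le> p" "p \<le> 1" for p q z :: real
        using mult_left_mono[OF that(1,2)] mult_right_mono[of p 1 "x / 5"] that(3) assms(2) by linarith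
      have b: "\<bar>(1 - u)\<^sup>2 * a\<bar> \<le> x / 5" "\<bar>u\<^sup>2 * c\<bar> \<le> x / 5" "\<bar>u * (1 - u) * b\<bar> \<le> x / 5" "\<bar>u * (1 - u) * d\<bar> \<le> x / 5"
          "\<bar>(1 - u) * b\<bar> \<le> x / 5" "\<bar>u * d\<bar> \<le> x / 5"
        using shrink[OF small(1), of "1 - u"] shrink[OF small(3), of u] shrink[OF small(2), of u]
          shrink[OF small(4), of "1 - u"] small u
        by (simp_all add: abs_mult power2_eq_square mult_ac)
      have "\<bar>fst (finite_toll \<theta> N i) - fst (limit_toll \<theta> u)\<bar> \<le> x"
        unfolding fst_eq using b small(5) by linarith
      moreover have "\<bar>snd (finite_toll \<theta> N i) - snd (limit_toll \<theta> u)\<bar> \<le> x"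
        unfolding snd_eq using b small(6) assms(2) by linarith
      ultimately show "\<bar>fst (finite_toll \<theta> N i) - fst (limit_toll \<theta> (share N i))\<bar> \<le> x \<and>
          \<bar>snd (finite_toll \<theta> N i) - snd (limit_toll \<theta> (share N i))\<bar> \<le> x"
        by (simp only: u_def k_def n_def)
    qed
  qed
qed

text \<open>Only \<open>v ln v\<close> at 0 is at stake, where the value 0 agrees with the limit;
  the other half of the entropy follows by replacing \<open>v\<close> with
  \<open>1 - v\<close>.\<close>

lemma limit_toll_continuous: "continuous_on {0..1} (limit_toll \<theta>)"
proof -
  have xlnx: "continuous_on {0..1} (\<lambda>v::real. v * ln v)"
    unfolding continuous_on_def
  proof
    fix v :: real assume v: "v \<in> {0..1}"
    show "((\<lambda>v. v * ln v) \<longlongrightarrow> v * ln v) (at v within {0..1})"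
    proof (cases "v = 0")
      case True
      have "((\<lambda>v::real. v * ln v) \<longlongrightarrow> 0) (at_right 0)" by real_asymp
      moreover have "at (0::real) within {0..1} = at_right 0"
        by (rule at_within_Icc_at_right) simp
      ultimately show ?thesis using True by simp
    next
      case False
      then show ?thesis using v by (intro tendsto_intros) auto
    qed
  qed
  have "continuous_on {0..1} ((\<lambda>v::real. v * ln v) \<circ> (\<lambda>v. 1 - v))"
    by (rule continuous_on_compose) (auto intro!: continuous_intros continuous_on_subset[OF xlnx])
  then have "continuous_on {0..1} entropy_fn"
    unfolding entropy_fn_def[abs_def] o_def by (intro continuous_on_add xlnx)
  then show ?thesis
    unfolding limit_toll_def[abs_def] Let_def by (intro continuous_intros)
qed

lemma limit_toll_measurable [measurable]: "limit_toll \<theta> \<in> borel_measurable borel"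
  unfolding limit_toll_def[abs_def] Let_def entropy_fn_def by measurable

section \<open>The limit equation\<close>

lemma centered_L2_finite_mean: "centered_L2 M \<Longrightarrow> finite_mean M"
  by (simp add: centered_L2_def finite_mean_def)

lemma centered_L2_integrable_prod:
  assumes "centered_L2 M"
  shows "integrable M (\<lambda>x. fst x * snd x)"
proof -
  have [measurable_cong]: "sets M = sets borel" using assms by (simp add: centered_L2_def)
  have "integrable M (\<lambda>x. (fst x)\<^sup>2 + (snd x)\<^sup>2)" using assms by (simp add: centered_L2_def)
  then show ?thesis
  proof (rule Bochner_Integration.integrable_bound)
    have "\<bar>a * b\<bar> \<le> a\<^sup>2 + b\<^sup>2" for a b :: real
      using sum_squares_bound[of "\<bar>a\<bar>" "\<bar>b\<bar>"] abs_ge_zero[of "a * b"] unfolding abs_mult power2_abs by linarith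
    then show "AE x in M. norm (fst x * snd x) \<le> norm ((fst x)\<^sup>2 + (snd x)\<^sup>2)" by simp
  qed measurable
qed

lemma centered_L2_taxi_square:
  assumes "centered_L2 M"
  shows "integrable M (\<lambda>x. (taxi x)\<^sup>2)"
proof -
  have [measurable_cong]: "sets M = sets borel" using assms by (simp add: centered_L2_def)
  have "integrable M (\<lambda>x. 2 * (fst x)\<^sup>2 + 2 * (snd x)\<^sup>2)" using assms by (simp add: centered_L2_def)
  then show ?thesis
    by (rule Bochner_Integration.integrable_bound) (use taxi_square_le in auto)
qed

text \<open>Linear terms drop out by centering, so pure second moments and the constants
  survive.\<close>

lemma centered_moment:
  assumes M: "centered_L2 M"
  shows "(\<integral>x. (a1 * fst x + a2 * snd x + k) * (b1 * fst x + b2 * snd x + l) \<partial>M)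
    = a1 * b1 * (\<integral>x. (fst x)\<^sup>2 \<partial>M) + (a1 * b2 + a2 * b1) * (\<integral>x. fst x * snd x \<partial>M)
      + a2 * b2 * (\<integral>x. (snd x)\<^sup>2 \<partial>M) + k * l"
proof -
  interpret prob_space M using M by (simp add: centered_L2_def)
  note i = M[unfolded centered_L2_def] centered_L2_integrable_prod[OF M]
  have "(\<integral>x. (a1 * fst x + a2 * snd x + k) * (b1 * fst x + b2 * snd x + l) \<partial>M)
     = (\<integral>x. a1 * b1 * (fst x)\<^sup>2 + (a1 * b2 + a2 * b1) * (fst x * snd x) + a2 * b2 * (snd x)\<^sup>2
          + (a1 * l + k * b1) * fst x + (a2 * l + k * b2) * snd x + k * l \<partial>M)"
    by (intro Bochner_Integration.integral_cong) (auto simp: algebra_simps power2_eq_square)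
  also have "\<dots> = a1 * b1 * (\<integral>x. (fst x)\<^sup>2 \<partial>M) + (a1 * b2 + a2 * b1) * (\<integral>x. fst x * snd x \<partial>M)
      + a2 * b2 * (\<integral>x. (snd x)\<^sup>2 \<partial>M) + k * l"
    using i by (simp add: prob_space)
  finally show ?thesis .
qed

text \<open>For fixed \<open>x\<close> the part depending on \<open>x\<close> is a constant of the
  inner integral, so mixed terms between the independent vectors vanish by centering of
  \<open>M'\<close>; a second use of \<open>centered_moment\<close> treats \<open>x\<close>.\<close>

lemma centered_moment2:
  assumes M': "centered_L2 M'" and M: "centered_L2 M"
  shows "(\<integral>x. (\<integral>x'. (a1 * fst x' + a2 * snd x' + c1 * fst x + c2 * snd x + k) *
        (b1 * fst x' + b2 * snd x' + d1 * fst x + d2 * snd x + l) \<partial>M') \<partial>M)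
    = a1 * b1 * (\<integral>x. (fst x)\<^sup>2 \<partial>M') + (a1 * b2 + a2 * b1) * (\<integral>x. fst x * snd x \<partial>M') + a2 * b2 * (\<integral>x. (snd x)\<^sup>2 \<partial>M')
     + (c1 * d1 * (\<integral>x. (fst x)\<^sup>2 \<partial>M) + (c1 * d2 + c2 * d1) * (\<integral>x. fst x * snd x \<partial>M) + c2 * d2 * (\<integral>x. (snd x)\<^sup>2 \<partial>M) + k * l)"
proof -
  interpret prob_space M using M by (simp add: centered_L2_def)
  have int: "integrable M (\<lambda>x. (c1 * fst x + c2 * snd x + k) * (d1 * fst x + d2 * snd x + l))"
  proof -
    have "integrable M (\<lambda>x. c1 * d1 * (fst x)\<^sup>2 + (c1 * d2 + c2 * d1) * (fst x * snd x) + c2 * d2 * (snd x)\<^sup>2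
          + (c1 * l + k * d1) * fst x + (c2 * l + k * d2) * snd x + k * l)"
      using M[unfolded centered_L2_def] centered_L2_integrable_prod[OF M] by simp
    then show ?thesis by (simp add: algebra_simps power2_eq_square)
  qed
  have "(\<integral>x'. (a1 * fst x' + a2 * snd x' + c1 * fst x + c2 * snd x + k) *
        (b1 * fst x' + b2 * snd x' + d1 * fst x + d2 * snd x + l) \<partial>M')
    = (a1 * b1 * (\<integral>x. (fst x)\<^sup>2 \<partial>M') + (a1 * b2 + a2 * b1) * (\<integral>x. fst x * snd x \<partial>M') + a2 * b2 * (\<integral>x. (snd x)\<^sup>2 \<partial>M'))
      + (c1 * fst x + c2 * snd x + k) * (d1 * fst x + d2 * snd x + l)" for x
    using centered_moment[OF M', of a1 a2 "c1 * fst x + c2 * snd x + k" b1 b2 "d1 * fst x + d2 * snd x + l"]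
    by (simp add: add.assoc)
  then show ?thesis
    using int by (simp add: prob_space centered_moment[OF M])
qed

text \<open>The matrix has absolute column sums \<open>(1 - v)^2\<close> and
  \<open>v (1 - v) + (1 - v) = 1 - v^2\<close>, of which the second is the larger.\<close>

lemma taxi_affine_map_left:
  assumes "0 \<le> v" "v \<le> 1"
  shows "taxi (affine_map x' x v b - affine_map y' x v b) \<le> (1 - v\<^sup>2) * taxi (x' - y')"
proof -
  define a c where "a = fst x' - fst y'" and "c = snd x' - snd y'"
  have "taxi (affine_map x' x v b - affine_map y' x v b) = \<bar>(1 - v)\<^sup>2 * a + v * (1 - v) * c\<bar> + \<bar>(1 - v) * c\<bar>"
    by (simp add: taxi_def affine_map_def a_def c_def algebra_simps)
  also have "\<dots> \<le> (1 - v)\<^sup>2 * \<bar>a\<bar> + v * (1 - v) * \<bar>c\<bar> + (1 - v) * \<bar>c\<bar>"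
    using assms abs_triangle_ineq[of "(1 - v)\<^sup>2 * a" "v * (1 - v) * c"] by (simp add: abs_mult)
  also have "\<dots> = (1 - v)\<^sup>2 * \<bar>a\<bar> + (1 - v\<^sup>2) * \<bar>c\<bar>" by (simp add: algebra_simps power2_eq_square)
  also have "(1 - v)\<^sup>2 * \<bar>a\<bar> \<le> (1 - v\<^sup>2) * \<bar>a\<bar>"
  proof (intro mult_right_mono)
    have "v * v \<le> v" using assms by (simp add: mult_left_le)
    then show "(1 - v)\<^sup>2 \<le> 1 - v\<^sup>2" by (simp add: algebra_simps power2_eq_square)
  qed simp
  finally show ?thesis by (simp add: taxi_def a_def c_def algebra_simps)
qed

text \<open>A crude constant suffices: distances in this argument are met by the convergence of the
  random recursive tree and need no contraction.\<close>

lemma taxi_affine_map_right: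
  assumes "0 \<le> v" "v \<le> 1"
  shows "taxi (affine_map x' x v b - affine_map x' y v b) \<le> 2 * taxi (x - y)"
proof -
  define a c where "a = fst x - fst y" and "c = snd x - snd y"
  have "taxi (affine_map x' x v b - affine_map x' y v b) = \<bar>v\<^sup>2 * a + v * (1 - v) * c\<bar> + \<bar>v * c\<bar>"
    by (simp add: taxi_def affine_map_def a_def c_def algebra_simps)
  also have "\<dots> \<le> v\<^sup>2 * \<bar>a\<bar> + v * (1 - v) * \<bar>c\<bar> + v * \<bar>c\<bar>"
    using assms abs_triangle_ineq[of "v\<^sup>2 * a" "v * (1 - v) * c"] by (simp add: abs_mult)
  also have "\<dots> \<le> 1 * \<bar>a\<bar> + 1 * \<bar>c\<bar> + 1 * \<bar>c\<bar>"
    using assms by (intro add_mono mult_right_mono) (auto simp: power_le_one mult_le_one)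
  also have "\<dots> \<le> 2 * taxi (x - y)" by (simp add: taxi_def a_def c_def)
  finally show ?thesis .
qed

text \<open>Each coefficient difference factors through \<open>u - v\<close>, for instance
  \<open>(1 - u)^2 - (1 - v)^2 = (u - v) (u + v - 2)\<close>. The bound measures the loss when the
  share replaces \<open>V\<close>.\<close>

lemma taxi_affine_map_fraction:
  assumes "0 \<le> u" "u \<le> 1" "0 \<le> v" "v \<le> 1"
  shows "taxi (affine_map x' x u b - affine_map x' x v b') \<le> 2 * \<bar>u - v\<bar> * (taxi x' + taxi x) + taxi (b - b')"
proof -
  define d where "d = u - v"
  have 1: "\<bar>d * (u + v - 2) * fst x'\<bar> \<le> 2 * \<bar>d\<bar> * \<bar>fst x'\<bar>" "\<bar>d * (1 - u - v) * snd x'\<bar> \<le> \<bar>d\<bar> * \<bar>snd x'\<bar>"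
    "\<bar>d * (u + v) * fst x\<bar> \<le> 2 * \<bar>d\<bar> * \<bar>fst x\<bar>" "\<bar>d * (1 - u - v) * snd x\<bar> \<le> \<bar>d\<bar> * \<bar>snd x\<bar>"
  proof -
    have "\<bar>u + v - 2\<bar> \<le> 2" "\<bar>1 - u - v\<bar> \<le> 1" "\<bar>u + v\<bar> \<le> 2" using assms by auto
    then have *: "\<bar>d\<bar> * \<bar>u + v - 2\<bar> \<le> \<bar>d\<bar> * 2" "\<bar>d\<bar> * \<bar>1 - u - v\<bar> \<le> \<bar>d\<bar> * 1" "\<bar>d\<bar> * \<bar>u + v\<bar> \<le> \<bar>d\<bar> * 2"
      using mult_left_mono[OF _ abs_ge_zero[of d]] by blast+
    show "\<bar>d * (u + v - 2) * fst x'\<bar> \<le> 2 * \<bar>d\<bar> * \<bar>fst x'\<bar>" "\<bar>d * (1 - u - v) * snd x'\<bar> \<le> \<bar>d\<bar> * \<bar>snd x'\<bar>"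
      "\<bar>d * (u + v) * fst x\<bar> \<le> 2 * \<bar>d\<bar> * \<bar>fst x\<bar>" "\<bar>d * (1 - u - v) * snd x\<bar> \<le> \<bar>d\<bar> * \<bar>snd x\<bar>"
      using mult_right_mono[OF *(1), of "\<bar>fst x'\<bar>"] mult_right_mono[OF *(2), of "\<bar>snd x'\<bar>"]
        mult_right_mono[OF *(3), of "\<bar>fst x\<bar>"] mult_right_mono[OF *(2), of "\<bar>snd x\<bar>"]
      by (simp_all only: abs_mult mult.commute[of 2 "\<bar>d\<bar>"] mult_1_right)
  qed
  have "taxi (affine_map x' x u b - affine_map x' x v b') =
      \<bar>d * (u + v - 2) * fst x' + d * (1 - u - v) * snd x' + d * (u + v) * fst x + d * (1 - u - v) * snd x + (fst b - fst b')\<bar>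
      + \<bar>- d * snd x' + d * snd x + (snd b - snd b')\<bar>"
    by (simp add: taxi_def affine_map_def d_def algebra_simps power2_eq_square)
  also have "\<dots> \<le> 2 * \<bar>d\<bar> * \<bar>fst x'\<bar> + \<bar>d\<bar> * \<bar>snd x'\<bar> + 2 * \<bar>d\<bar> * \<bar>fst x\<bar> + \<bar>d\<bar> * \<bar>snd x\<bar> + \<bar>fst b - fst b'\<bar>
      + (\<bar>d\<bar> * \<bar>snd x'\<bar> + \<bar>d\<bar> * \<bar>snd x\<bar> + \<bar>snd b - snd b'\<bar>)"
  proof -
    have 2: "\<bar>- d * snd x'\<bar> \<le> \<bar>d\<bar> * \<bar>snd x'\<bar>" "\<bar>d * snd x\<bar> \<le> \<bar>d\<bar> * \<bar>snd x\<bar>" by (simp_all add: abs_mult)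
    have tri: "\<bar>p + q\<bar> \<le> p' + q'" if "\<bar>p\<bar> \<le> p'" "\<bar>q\<bar> \<le> q'" for p q p' q' :: real using that by linarith
    show ?thesis by (intro add_mono tri 1 2 order_refl)
  qed
  also have "\<dots> = 2 * \<bar>d\<bar> * (taxi x' + taxi x) + taxi (b - b')"
    by (simp add: taxi_def algebra_simps)
  finally show ?thesis by (simp add: d_def)
qed

lemma taxi_affine_map_le:
  assumes "0 \<le> v" "v \<le> 1"
  shows "taxi (affine_map x' x v b) \<le> taxi x' + 2 * taxi x + taxi b"
proof -
  have "taxi (affine_map x' x v b - affine_map 0 x v b) \<le> 1 * taxi (x' - 0)"
    using assms by (intro order_trans[OF taxi_affine_map_left] mult_right_mono) auto
  moreover have "taxi (affine_map 0 x v b - affine_map 0 0 v b) \<le> 2 * taxi (x - 0)"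
    using assms by (rule taxi_affine_map_right)
  moreover have "taxi (affine_map 0 0 v b) = taxi b" by (simp add: affine_map_def taxi_def)
  ultimately show ?thesis
    using taxi_triangle[of "affine_map x' x v b" 0 "affine_map 0 x v b"]
      taxi_triangle[of "affine_map 0 x v b" 0 "affine_map 0 0 v b"] by simp
qed

lemma limit_toll_bounded: "\<exists>C. \<forall>v. 0 \<le> v \<and> v \<le> 1 \<longrightarrow> taxi (limit_toll \<theta> v) \<le> C"
proof -
  have "bounded ((\<lambda>v. taxi (limit_toll \<theta> v)) ` {0..1})"
    by (intro compact_imp_bounded compact_continuous_image continuous_intros limit_toll_continuous) simp
  then show ?thesis unfolding bounded_iff real_norm_def by (metis atLeastAtMost_iff image_eqI abs_le_D1)
qed

section \<open>Integrating the limit equation; uniqueness\<close>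

lemma measurable_hoppe_map [measurable]:
  "(\<lambda>(x', x, v). hoppe_map \<theta> x' x v) \<in> borel_measurable (borel \<Otimes>\<^sub>M borel \<Otimes>\<^sub>M borel)"
  unfolding hoppe_map_eq_affine_map by measurable

text \<open>Fubini for the equation in law. The relevant test functions are unbounded, so
  integrability is imported from a dominating function that separates the variables; the bound is
  asked for \<open>v\<close> in the open unit interval, which carries the beta law.\<close>

lemma hoppe_fixpoint_integral:
  fixes g :: "real \<times> real \<Rightarrow> real"
  assumes \<theta>: "\<theta> > 0" and \<rho>: "prob_space \<rho>" "sets \<rho> = sets borel" and \<nu>: "prob_space \<nu>" "sets \<nu> = sets borel"
    and fp: "hoppe_fixpoint \<theta> \<nu> \<rho>" and g [measurable]: "g \<in> borel_measurable borel"
    and D: "integrable \<rho> D" "integrable \<nu> D'"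
    and bnd: "\<And>x' x v. \<lbrakk>0 < v; v < 1\<rbrakk> \<Longrightarrow> \<bar>g (hoppe_map \<theta> x' x v)\<bar> \<le> D x' + D' x + C"
  shows "(\<integral>x. g x \<partial>\<rho>) = (\<integral>v. (\<integral>x. (\<integral>x'. g (hoppe_map \<theta> x' x v) \<partial>\<rho>) \<partial>\<nu>) \<partial>beta1 \<theta>)"
    and "integrable (beta1 \<theta>) (\<lambda>v. \<integral>x. (\<integral>x'. g (hoppe_map \<theta> x' x v) \<partial>\<rho>) \<partial>\<nu>)"
proof -
  note [measurable_cong] = \<rho>(2) \<nu>(2)
  interpret R: prob_space \<rho> by fact
  interpret N: prob_space \<nu> by fact
  interpret B: prob_space "beta1 \<theta>" by (rule prob_space_beta1[OF \<theta>])
  interpret Q: pair_prob_space \<nu> "beta1 \<theta>" ..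
  interpret P: pair_prob_space \<rho> "\<nu> \<Otimes>\<^sub>M beta1 \<theta>" ..
  let ?h = "\<lambda>x' (x, v). g (hoppe_map \<theta> x' x v)"
  have [measurable]: "(\<lambda>(x', x, v). hoppe_map \<theta> x' x v) \<in> borel_measurable (\<rho> \<Otimes>\<^sub>M \<nu> \<Otimes>\<^sub>M beta1 \<theta>)"
    by measurable
  have [measurable]: "(\<lambda>w. hoppe_map \<theta> (fst w) (fst (snd w)) (snd (snd w))) \<in> borel_measurable (\<rho> \<Otimes>\<^sub>M \<nu> \<Otimes>\<^sub>M beta1 \<theta>)"
    unfolding hoppe_map_eq_affine_map by measurable
  have D1: "integrable (\<rho> \<Otimes>\<^sub>M (\<nu> \<Otimes>\<^sub>M beta1 \<theta>)) (\<lambda>w. D (fst w))"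
    using D(1) integrable_distr_eq[of fst "\<rho> \<Otimes>\<^sub>M (\<nu> \<Otimes>\<^sub>M beta1 \<theta>)" \<rho> D] Q.distr_pair_fst[of \<rho>] by simp
  have D2: "integrable (\<nu> \<Otimes>\<^sub>M beta1 \<theta>) (\<lambda>w. D' (fst w))"
    using D(2) integrable_distr_eq[of fst "\<nu> \<Otimes>\<^sub>M beta1 \<theta>" \<nu> D'] B.distr_pair_fst[of \<nu>] by simp
  have D3: "integrable (\<rho> \<Otimes>\<^sub>M (\<nu> \<Otimes>\<^sub>M beta1 \<theta>)) (\<lambda>w. D' (fst (snd w)))"
  proof -
    interpret P': pair_sigma_finite "\<nu> \<Otimes>\<^sub>M beta1 \<theta>" \<rho> ..
    have "integrable ((\<nu> \<Otimes>\<^sub>M beta1 \<theta>) \<Otimes>\<^sub>M \<rho>) (\<lambda>w. D' (fst (fst w)))"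
      using D2 integrable_distr_eq[of fst "(\<nu> \<Otimes>\<^sub>M beta1 \<theta>) \<Otimes>\<^sub>M \<rho>" "\<nu> \<Otimes>\<^sub>M beta1 \<theta>" "\<lambda>w. D' (fst w)"]
        R.distr_pair_fst[of "\<nu> \<Otimes>\<^sub>M beta1 \<theta>"] by simp
    then show ?thesis
      using P'.integrable_product_swap[of "\<lambda>w. D' (fst (fst w))"] by (simp add: case_prod_beta')
  qed
  have ae: "AE w in \<rho> \<Otimes>\<^sub>M (\<nu> \<Otimes>\<^sub>M beta1 \<theta>). 0 < snd (snd w) \<and> snd (snd w) < 1"
    by (rule P.AE_pair_measure, measurable, rule AE_I2, rule Q.AE_pair_measure, measurable)
       (use AE_beta1[of \<theta>] in simp)
  have int: "integrable (\<rho> \<Otimes>\<^sub>M (\<nu> \<Otimes>\<^sub>M beta1 \<theta>)) (case_prod ?h)"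
  proof (rule Bochner_Integration.integrable_bound)
    show "integrable (\<rho> \<Otimes>\<^sub>M (\<nu> \<Otimes>\<^sub>M beta1 \<theta>)) (\<lambda>w. D (fst w) + D' (fst (snd w)) + C)"
      using D1 D3 by simp
    show "AE w in \<rho> \<Otimes>\<^sub>M (\<nu> \<Otimes>\<^sub>M beta1 \<theta>). norm (case_prod ?h w) \<le> norm (D (fst w) + D' (fst (snd w)) + C)"
      using ae
    proof eventually_elim
      case (elim w)
      then show ?case using bnd[of "snd (snd w)" "fst w" "fst (snd w)"] by (simp add: case_prod_beta')
    qed
  qed (simp add: case_prod_beta')
  have int2: "integrable (\<nu> \<Otimes>\<^sub>M beta1 \<theta>) (case_prod (\<lambda>x v. \<integral>x'. g (hoppe_map \<theta> x' x v) \<partial>\<rho>))"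
    using P.integrable_snd[OF int] by (simp add: case_prod_beta')
  have "(\<integral>x. g x \<partial>\<rho>) = (\<integral>x. g x \<partial>distr (\<rho> \<Otimes>\<^sub>M \<nu> \<Otimes>\<^sub>M beta1 \<theta>) borel (\<lambda>(x', x, v). hoppe_map \<theta> x' x v))"
    using fp by (simp add: hoppe_fixpoint_def)
  also have "\<dots> = integral\<^sup>L (\<rho> \<Otimes>\<^sub>M (\<nu> \<Otimes>\<^sub>M beta1 \<theta>)) (case_prod ?h)"
    by (subst integral_distr) (auto simp: case_prod_beta')
  also have "\<dots> = (\<integral>y. (\<integral>x'. ?h x' y \<partial>\<rho>) \<partial>(\<nu> \<Otimes>\<^sub>M beta1 \<theta>))"
    by (rule P.integral_snd[OF int, symmetric])
  also have "\<dots> = integral\<^sup>L (\<nu> \<Otimes>\<^sub>M beta1 \<theta>) (case_prod (\<lambda>x v. \<integral>x'. g (hoppe_map \<theta> x' x v) \<partial>\<rho>))"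
    by (simp add: case_prod_beta')
  also have "\<dots> = (\<integral>v. (\<integral>x. (\<integral>x'. g (hoppe_map \<theta> x' x v) \<partial>\<rho>) \<partial>\<nu>) \<partial>beta1 \<theta>)"
    by (rule Q.integral_snd[OF int2, symmetric])
  finally show "(\<integral>x. g x \<partial>\<rho>) = (\<integral>v. (\<integral>x. (\<integral>x'. g (hoppe_map \<theta> x' x v) \<partial>\<rho>) \<partial>\<nu>) \<partial>beta1 \<theta>)" .
  show "integrable (beta1 \<theta>) (\<lambda>v. \<integral>x. (\<integral>x'. g (hoppe_map \<theta> x' x v) \<partial>\<rho>) \<partial>\<nu>)"
    using Q.integrable_snd[OF int2] .
qed

lemma hoppe_fixpoint_integral_lip:
  assumes \<theta>: "\<theta> > 0" and \<rho>: "finite_mean \<rho>" and \<nu>: "finite_mean \<nu>"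
    and fp: "hoppe_fixpoint \<theta> \<nu> \<rho>" and f: "lip_taxi 1 f"
  shows "(\<integral>x. f x \<partial>\<rho>) = (\<integral>v. (\<integral>x. (\<integral>x'. f (hoppe_map \<theta> x' x v) \<partial>\<rho>) \<partial>\<nu>) \<partial>beta1 \<theta>)"
    and "integrable (beta1 \<theta>) (\<lambda>v. \<integral>x. (\<integral>x'. f (hoppe_map \<theta> x' x v) \<partial>\<rho>) \<partial>\<nu>)"
proof -
  obtain C where C: "\<And>v. 0 \<le> v \<Longrightarrow> v \<le> 1 \<Longrightarrow> taxi (limit_toll \<theta> v) \<le> C"
    using limit_toll_bounded[of \<theta>] by blast
  have bnd: "\<bar>f (hoppe_map \<theta> x' x v)\<bar> \<le> taxi x' + 2 * taxi x + (\<bar>f 0\<bar> + C)" if "0 < v" "v < 1" for x' x v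
    using lip_taxiD[OF f, of "hoppe_map \<theta> x' x v" 0] taxi_affine_map_le[of v x' x "limit_toll \<theta> v"] C[of v] that
    by (simp add: hoppe_map_eq_affine_map)
  have p: "prob_space \<rho>" "sets \<rho> = sets borel" "prob_space \<nu>" "sets \<nu> = sets borel"
    "integrable \<rho> taxi" "integrable \<nu> (\<lambda>x. 2 * taxi x)"
    using \<rho> \<nu> finite_mean_taxi by (auto simp: finite_mean_def)
  have m: "f \<in> borel_measurable borel" using f by (rule lip_taxi_measurable) simp
  show "(\<integral>x. f x \<partial>\<rho>) = (\<integral>v. (\<integral>x. (\<integral>x'. f (hoppe_map \<theta> x' x v) \<partial>\<rho>) \<partial>\<nu>) \<partial>beta1 \<theta>)"
    "integrable (beta1 \<theta>) (\<lambda>v. \<integral>x. (\<integral>x'. f (hoppe_map \<theta> x' x v) \<partial>\<rho>) \<partial>\<nu>)"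
    using hoppe_fixpoint_integral[OF \<theta> p(1-4) fp m p(5,6) bnd] by auto
qed

lemma lip_affine_left:
  assumes "lip_taxi 1 f" "0 \<le> v" "v \<le> 1"
  shows "lip_taxi (1 - v\<^sup>2) (\<lambda>x'. f (affine_map x' x v b))"
  unfolding lip_taxi_def
proof (intro allI)
  fix x' y'
  show "\<bar>f (affine_map x' x v b) - f (affine_map y' x v b)\<bar> \<le> (1 - v\<^sup>2) * taxi (x' - y')"
    using lip_taxiD[OF assms(1), of "affine_map x' x v b" "affine_map y' x v b"]
      taxi_affine_map_left[OF assms(2,3), of x' x b y'] by simp
qed

text \<open>Integrating out the Hoppe argument keeps a Lipschitz bound in the other one, so that
  closeness of random recursive trees to \<nu> can be used inside the double integral.\<close>

lemma lip_affine_right: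
  assumes f: "lip_taxi 1 f" and v: "0 \<le> v" "v \<le> 1" and \<rho>: "finite_mean \<rho>"
  shows "lip_taxi 2 (\<lambda>x. \<integral>x'. f (affine_map x' x v b) \<partial>\<rho>)"
  unfolding lip_taxi_def
proof (intro allI)
  interpret prob_space \<rho> using \<rho> by (simp add: finite_mean_def)
  fix x y
  have "1 - v\<^sup>2 \<ge> 0" using v by (simp add: power_le_one)
  then have int: "integrable \<rho> (\<lambda>x'. f (affine_map x' x v b))" for x
    using \<rho> lip_affine_left[OF f v] by (intro lip_taxi_integrable)
  have "\<bar>(\<integral>x'. f (affine_map x' x v b) \<partial>\<rho>) - (\<integral>x'. f (affine_map x' y v b) \<partial>\<rho>)\<bar>
      = \<bar>\<integral>x'. f (affine_map x' x v b) - f (affine_map x' y v b) \<partial>\<rho>\<bar>"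
    using int by simp
  also have "\<dots> \<le> (\<integral>x'. \<bar>f (affine_map x' x v b) - f (affine_map x' y v b)\<bar> \<partial>\<rho>)"
    by (rule integral_abs_bound)
  also have "\<dots> \<le> (\<integral>x'. 2 * taxi (x - y) \<partial>\<rho>)"
  proof (intro integral_mono)
    fix x'
    show "\<bar>f (affine_map x' x v b) - f (affine_map x' y v b)\<bar> \<le> 2 * taxi (x - y)"
      using lip_taxiD[OF f, of "affine_map x' x v b" "affine_map x' y v b"] taxi_affine_map_right[OF v, of x' x b y] by simp
  qed (use int in auto)
  finally show "\<bar>(\<integral>x'. f (affine_map x' x v b) \<partial>\<rho>) - (\<integral>x'. f (affine_map x' y v b) \<partial>\<rho>)\<bar> \<le> 2 * taxi (x - y)"
    by (simp add: prob_space)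
qed

text \<open>The averaged contraction factor, strictly below 1 because \<open>V > 0\<close> almost
  surely.\<close>

lemma integral_one_minus_square:
  assumes "\<theta> > 0"
  shows "integrable (beta1 \<theta>) (\<lambda>v. 1 - v\<^sup>2)" "(\<integral>v. 1 - v\<^sup>2 \<partial>beta1 \<theta>) < 1" "0 \<le> (\<integral>v. 1 - v\<^sup>2 \<partial>beta1 \<theta>)"
proof -
  show int: "integrable (beta1 \<theta>) (\<lambda>v. 1 - v\<^sup>2)"
    using assms by (intro integrable_beta1[where C=1]) (auto simp: abs_le_iff power_le_one)
  show "(\<integral>v. 1 - v\<^sup>2 \<partial>beta1 \<theta>) < 1"
    using assms int by (intro integral_beta1_less_1) auto
  show "0 \<le> (\<integral>v. 1 - v\<^sup>2 \<partial>beta1 \<theta>)"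
    using AE_beta1[of \<theta>] by (intro integral_nonneg_AE) (auto simp: power_le_one)
qed

lemma lip_affine_integrable:
  assumes "lip_taxi 1 f" "0 \<le> v" "v \<le> 1" "finite_mean \<rho>" "finite_mean \<sigma>"
  shows "integrable \<rho> (\<lambda>x'. f (affine_map x' x v b))" "integrable \<sigma> (\<lambda>x. \<integral>x'. f (affine_map x' x v b) \<partial>\<rho>)"
proof -
  have "1 - v\<^sup>2 \<ge> 0" using assms by (simp add: power_le_one)
  then show "integrable \<rho> (\<lambda>x'. f (affine_map x' x v b))"
    using lip_affine_left[OF assms(1-3)] assms(4) by (intro lip_taxi_integrable)
  show "integrable \<sigma> (\<lambda>x. \<integral>x'. f (affine_map x' x v b) \<partial>\<rho>)"
    by (rule lip_taxi_integrable[OF assms(5) lip_affine_right[OF assms(1-4)]]) simp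
qed

lemma double_integral_left:
  assumes f: "lip_taxi 1 f" and v: "0 \<le> v" "v \<le> 1" and \<rho>: "finite_mean \<rho>" "finite_mean \<rho>'" and \<sigma>: "finite_mean \<sigma>"
  shows "\<bar>(\<integral>x. (\<integral>x'. f (affine_map x' x v b) \<partial>\<rho>) \<partial>\<sigma>) - (\<integral>x. (\<integral>x'. f (affine_map x' x v b) \<partial>\<rho>') \<partial>\<sigma>)\<bar>
    \<le> (1 - v\<^sup>2) * wasserstein \<rho> \<rho>'"
proof -
  interpret S: prob_space \<sigma> using \<sigma> by (simp add: finite_mean_def)
  have v2: "1 - v\<^sup>2 \<ge> 0" using v by (simp add: power_le_one)
  note i = lip_affine_integrable[OF f v \<rho>(1) \<sigma>] lip_affine_integrable[OF f v \<rho>(2) \<sigma>]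
  have "\<bar>(\<integral>x. (\<integral>x'. f (affine_map x' x v b) \<partial>\<rho>) \<partial>\<sigma>) - (\<integral>x. (\<integral>x'. f (affine_map x' x v b) \<partial>\<rho>') \<partial>\<sigma>)\<bar>
     = \<bar>\<integral>x. (\<integral>x'. f (affine_map x' x v b) \<partial>\<rho>) - (\<integral>x'. f (affine_map x' x v b) \<partial>\<rho>') \<partial>\<sigma>\<bar>" using i by simp
  also have "\<dots> \<le> (\<integral>x. \<bar>(\<integral>x'. f (affine_map x' x v b) \<partial>\<rho>) - (\<integral>x'. f (affine_map x' x v b) \<partial>\<rho>')\<bar> \<partial>\<sigma>)"
    by (rule integral_abs_bound)
  also have "\<dots> \<le> (\<integral>x. (1 - v\<^sup>2) * wasserstein \<rho> \<rho>' \<partial>\<sigma>)"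
    using i by (intro integral_mono wasserstein_scaled \<rho> lip_affine_left f v v2) auto
  finally show ?thesis by (simp add: S.prob_space)
qed

text \<open>Testing both equations with the same \<open>f\<close> gives \<open>W \<le> c * W\<close>
  for the distance \<open>W\<close> of the solutions, where \<open>c < 1\<close> is the mean of
  \<open>1 - V^2\<close>.\<close>

theorem hoppe_fixpoint_unique:
  assumes \<theta>: "\<theta> > 0" and \<rho>: "finite_mean \<rho>" and \<mu>: "finite_mean \<mu>" and \<nu>: "finite_mean \<nu>"
    and fp: "hoppe_fixpoint \<theta> \<nu> \<rho>" "hoppe_fixpoint \<theta> \<nu> \<mu>"
  shows "\<rho> = \<mu>"
proof (rule wasserstein_eq_0[OF \<rho> \<mu>])
  let ?c = "\<integral>v. 1 - v\<^sup>2 \<partial>beta1 \<theta>"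
  let ?W = "wasserstein \<rho> \<mu>"
  have W0: "?W \<ge> 0" by (rule wasserstein_nonneg[OF \<rho> \<mu>])
  have "?W \<le> ?c * ?W"
  proof (rule wasserstein_least)
    fix f assume f: "lip_taxi 1 f"
    let ?I = "\<lambda>\<rho> v. \<integral>x. (\<integral>x'. f (hoppe_map \<theta> x' x v) \<partial>\<rho>) \<partial>\<nu>"
    note r = hoppe_fixpoint_integral_lip[OF \<theta> \<rho> \<nu> fp(1) f] and m = hoppe_fixpoint_integral_lip[OF \<theta> \<mu> \<nu> fp(2) f]
    have "\<bar>(\<integral>x. f x \<partial>\<rho>) - (\<integral>x. f x \<partial>\<mu>)\<bar> = \<bar>\<integral>v. ?I \<rho> v - ?I \<mu> v \<partial>beta1 \<theta>\<bar>"
      using r m by simp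
    also have "\<dots> \<le> (\<integral>v. \<bar>?I \<rho> v - ?I \<mu> v\<bar> \<partial>beta1 \<theta>)" by (rule integral_abs_bound)
    also have "\<dots> \<le> (\<integral>v. (1 - v\<^sup>2) * ?W \<partial>beta1 \<theta>)"
    proof (rule integral_beta1_mono)
      show "integrable (beta1 \<theta>) (\<lambda>v. \<bar>?I \<rho> v - ?I \<mu> v\<bar>)" using r m by auto
      show "integrable (beta1 \<theta>) (\<lambda>v. (1 - v\<^sup>2) * ?W)" using integral_one_minus_square[OF \<theta>] by auto
      fix v :: real assume v: "0 < v" "v < 1"
      show "\<bar>?I \<rho> v - ?I \<mu> v\<bar> \<le> (1 - v\<^sup>2) * ?W"
        unfolding hoppe_map_eq_affine_map using v by (intro double_integral_left[OF f _ _ \<rho> \<mu> \<nu>]) simp_all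
    qed
    finally show "\<bar>(\<integral>x. f x \<partial>\<rho>) - (\<integral>x. f x \<partial>\<mu>)\<bar> \<le> ?c * ?W" by simp
  qed
  then have "(1 - ?c) * ?W \<le> 0" by (simp add: algebra_simps)
  then show "?W \<le> 0" using integral_one_minus_square(2)[OF \<theta>] by (simp add: mult_le_0_iff)
qed

section \<open>Existence of the fixed point\<close>

lemma continuous_affine_map_left: "continuous_on UNIV (\<lambda>x'. affine_map x' x v b)"
  unfolding affine_map_def by (intro continuous_intros)

text \<open>The fixed point is the law of the almost sure limit of the backward iterates
  \<open>\<Phi>\<^sub>0 (\<Phi>\<^sub>1 (\<dots> (\<Phi>\<^sub>k 0)))\<close> of independent copies of the random affine map.\<close>

theorem hoppe_fixpoint_exists:
  assumes \<theta>: "\<theta> > 0" and \<nu>: "finite_mean \<nu>"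
  shows "\<exists>\<mu>. finite_mean \<mu> \<and> hoppe_fixpoint \<theta> \<nu> \<mu>"
proof -
  interpret N: prob_space \<nu> using \<nu> by (simp add: finite_mean_def)
  interpret B: prob_space "beta1 \<theta>" by (rule prob_space_beta1[OF \<theta>])
  have sN [measurable_cong]: "sets \<nu> = sets borel" using \<nu> by (simp add: finite_mean_def)
  define Q where "Q = \<nu> \<Otimes>\<^sub>M beta1 \<theta>"
  interpret QP: pair_prob_space \<nu> "beta1 \<theta>" ..
  interpret Q: prob_space Q unfolding Q_def by (rule QP.prob_space_axioms)
  have sQ [measurable_cong]: "sets Q = sets (borel \<Otimes>\<^sub>M borel)"
    unfolding Q_def by (intro sets_pair_measure_cong sN sets_beta1)
  interpret S: sequence_space Q ..
  let ?S = "PiM (UNIV :: nat set) (\<lambda>_. Q)"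
  define \<Phi> where "\<Phi> x' s = affine_map x' (fst s) (snd s) (limit_toll \<theta> (snd s))" for x' and s :: "(real \<times> real) \<times> real"
  have \<Phi>_meas: "(\<lambda>w. \<Phi> (f w) (h w)) \<in> borel_measurable M" if [measurable]: "f \<in> borel_measurable M" "h \<in> measurable M Q" for f h M
  proof -
    have [measurable]: "h \<in> measurable M (borel \<Otimes>\<^sub>M borel)"
      using that(2) unfolding measurable_cong_sets[OF refl sQ] .
    show ?thesis unfolding \<Phi>_def by measurable
  qed
  \<comment> \<open>\<open>\<omega> 0\<close> is applied last and the inner iterate sees the shifted
    sequence. Prolonging the iteration changes only the innermost map, which makes the iterates
    converge pathwise and not merely in law.\<close>
  define X where "X = rec_nat (\<lambda>_. 0) (\<lambda>_ Y \<omega>. \<Phi> (Y (\<lambda>i. \<omega> (Suc i))) (\<omega> (0::nat)))"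
  have X0: "X 0 \<omega> = 0" and XSuc: "X (Suc k) \<omega> = \<Phi> (X k (\<lambda>i. \<omega> (Suc i))) (\<omega> 0)" for k \<omega>
    by (simp_all add: X_def)
  have [measurable]: "(\<lambda>\<omega> i. \<omega> (Suc i)) \<in> measurable ?S ?S"
    by (rule measurable_PiM_single') (auto simp: space_PiM)
  have [measurable]: "(\<lambda>\<omega>. \<omega> 0) \<in> measurable ?S Q" by (rule measurable_component_singleton) simp
  have Xm [measurable]: "X k \<in> borel_measurable ?S" for k
  proof (induction k)
    case (Suc k)
    note [measurable] = Suc
    have "(\<lambda>\<omega>. \<Phi> (X k (\<lambda>i. \<omega> (Suc i))) (\<omega> 0)) \<in> borel_measurable ?S"
      by (rule \<Phi>_meas) measurable
    then show ?case by (simp add: XSuc[abs_def])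
  qed (simp add: X0[abs_def])
  have Xcase: "X (Suc k) (case_nat s \<omega>) = \<Phi> (X k \<omega>) s" for k s \<omega> by (simp add: XSuc)
  have aeQ: "AE s in Q. 0 < snd s \<and> snd s < 1"
    unfolding Q_def by (rule QP.AE_pair_measure, measurable) (use AE_beta1[of \<theta>] in simp)
  define D where "D k \<omega> = taxi (X (Suc k) \<omega> - X k \<omega>)" for k \<omega>
  have Dm [measurable]: "D k \<in> borel_measurable ?S" for k unfolding D_def by measurable
  interpret QS: pair_prob_space Q ?S ..
  have cm [measurable]: "(\<lambda>(s, \<omega>). case_nat s \<omega>) \<in> measurable (Q \<Otimes>\<^sub>M ?S) ?S"
    by measurable
  \<comment> \<open>An independent sequence keeps its law when an independent entry is put in front;
    this turns the recursion for \<open>X\<close> into one for integrals.\<close>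
  have shift: "(\<integral>\<^sup>+\<omega>. f \<omega> \<partial>?S) = (\<integral>\<^sup>+s. (\<integral>\<^sup>+\<omega>. f (case_nat s \<omega>) \<partial>?S) \<partial>Q)"
    if [measurable]: "f \<in> borel_measurable ?S" for f :: "_ \<Rightarrow> ennreal"
  proof -
    have "(\<integral>\<^sup>+\<omega>. f \<omega> \<partial>?S) = (\<integral>\<^sup>+w. f w \<partial>distr (Q \<Otimes>\<^sub>M ?S) ?S (\<lambda>(s, \<omega>). case_nat s \<omega>))"
      by (simp add: S.PiM_iter)
    also have "\<dots> = (\<integral>\<^sup>+w. f (case w of (s, \<omega>) \<Rightarrow> case_nat s \<omega>) \<partial>(Q \<Otimes>\<^sub>M ?S))"
      by (rule nn_integral_distr) auto
    also have "\<dots> = (\<integral>\<^sup>+s. (\<integral>\<^sup>+\<omega>. f (case_nat s \<omega>) \<partial>?S) \<partial>Q)"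
      by (subst S.P.nn_integral_fst[symmetric]) auto
    finally show ?thesis .
  qed
  let ?c = "\<integral>v. 1 - v\<^sup>2 \<partial>beta1 \<theta>"
  note c = integral_one_minus_square[OF \<theta>]
  have cQ: "(\<integral>\<^sup>+s. ennreal (1 - (snd s)\<^sup>2) \<partial>Q) = ennreal ?c"
  proof -
    have "(\<integral>\<^sup>+s. ennreal (1 - (snd s)\<^sup>2) \<partial>Q) = (\<integral>\<^sup>+x. (\<integral>\<^sup>+v. ennreal (1 - v\<^sup>2) \<partial>beta1 \<theta>) \<partial>\<nu>)"
      unfolding Q_def by (subst B.nn_integral_fst[symmetric]) auto
    also have "(\<integral>\<^sup>+v. ennreal (1 - v\<^sup>2) \<partial>beta1 \<theta>) = ennreal ?c"
      using c(1) AE_beta1[of \<theta>] by (intro nn_integral_eq_integral) (auto simp: power_le_one)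
    finally show ?thesis by (simp add: N.emeasure_space_1)
  qed
  define A where "A = (\<integral>\<^sup>+\<omega>. ennreal (D 0 \<omega>) \<partial>?S)"
  \<comment> \<open>One more outer map shrinks an increment by \<open>1 - v^2\<close>, with
    \<open>v\<close> independent of it, so the expectations decay geometrically.\<close>
  have D_le: "(\<integral>\<^sup>+\<omega>. ennreal (D k \<omega>) \<partial>?S) \<le> ennreal (?c ^ k) * A" for k
  proof (induction k)
    case (Suc k)
    have "(\<integral>\<^sup>+\<omega>. ennreal (D (Suc k) \<omega>) \<partial>?S) = (\<integral>\<^sup>+s. (\<integral>\<^sup>+\<omega>. ennreal (D (Suc k) (case_nat s \<omega>)) \<partial>?S) \<partial>Q)"
      by (rule shift) measurable
    also have "\<dots> \<le> (\<integral>\<^sup>+s. (\<integral>\<^sup>+\<omega>. ennreal (1 - (snd s)\<^sup>2) * ennreal (D k \<omega>) \<partial>?S) \<partial>Q)"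
    proof (rule nn_integral_mono_AE)
      show "AE s in Q. (\<integral>\<^sup>+\<omega>. ennreal (D (Suc k) (case_nat s \<omega>)) \<partial>?S) \<le> (\<integral>\<^sup>+\<omega>. ennreal (1 - (snd s)\<^sup>2) * ennreal (D k \<omega>) \<partial>?S)"
        using aeQ
      proof eventually_elim
        case (elim s)
        then have v: "0 \<le> snd s" "snd s \<le> 1" by auto
        show ?case
        proof (rule nn_integral_mono)
          fix \<omega>
          have "D (Suc k) (case_nat s \<omega>) \<le> (1 - (snd s)\<^sup>2) * D k \<omega>"
            unfolding D_def Xcase \<Phi>_def by (rule taxi_affine_map_left[OF v])
          then show "ennreal (D (Suc k) (case_nat s \<omega>)) \<le> ennreal (1 - (snd s)\<^sup>2) * ennreal (D k \<omega>)"
            using v by (subst ennreal_mult[symmetric]) (auto simp: power_le_one D_def intro!: ennreal_leI)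
        qed
      qed
    qed
    also have "\<dots> = ennreal ?c * (\<integral>\<^sup>+\<omega>. ennreal (D k \<omega>) \<partial>?S)"
      by (subst nn_integral_cmult, measurable, subst nn_integral_multc) (simp_all add: cQ)
    also have "\<dots> \<le> ennreal ?c * (ennreal (?c ^ k) * A)" by (intro mult_left_mono Suc) simp
    also have "\<dots> = ennreal (?c ^ Suc k) * A" using c(3) by (simp add: ennreal_mult mult.assoc)
    finally show ?case .
  qed (simp add: A_def)
  obtain C where C: "\<And>v. 0 \<le> v \<Longrightarrow> v \<le> 1 \<Longrightarrow> taxi (limit_toll \<theta> v) \<le> C"
    using limit_toll_bounded[of \<theta>] by blast
  have A_fin: "A < \<infinity>"
  proof -
    have "A = (\<integral>\<^sup>+s. (\<integral>\<^sup>+\<omega>. ennreal (D 0 (case_nat s \<omega>)) \<partial>?S) \<partial>Q)"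
      unfolding A_def by (rule shift) measurable
    also have "\<dots> = (\<integral>\<^sup>+s. ennreal (taxi (\<Phi> 0 s)) \<partial>Q)"
      using S.P.emeasure_space_1 by (simp add: D_def Xcase X0)
    also have "\<dots> \<le> (\<integral>\<^sup>+s. ennreal (2 * taxi (fst s) + C) \<partial>Q)"
    proof (rule nn_integral_mono_AE)
      show "AE s in Q. ennreal (taxi (\<Phi> 0 s)) \<le> ennreal (2 * taxi (fst s) + C)"
        using aeQ
      proof eventually_elim
        case (elim s)
        then show ?case using taxi_affine_map_le[of "snd s" 0 "fst s" "limit_toll \<theta> (snd s)"] C[of "snd s"]
          by (intro ennreal_leI) (simp add: \<Phi>_def)
      qed
    qed
    also have "\<dots> < \<infinity>"
    proof -
      have "integrable Q (\<lambda>s. taxi (fst s))"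
        using finite_mean_taxi[OF \<nu>] integrable_distr_eq[of fst Q \<nu> taxi] B.distr_pair_fst[of \<nu>]
        unfolding Q_def by simp
      then have "integrable Q (\<lambda>s. 2 * taxi (fst s) + C)" by simp
      from integrableD(2)[OF this] show ?thesis by (simp add: less_top)
    qed
    finally show ?thesis .
  qed
  have sumD: "(\<integral>\<^sup>+\<omega>. (\<Sum>k. ennreal (D k \<omega>)) \<partial>?S) < \<infinity>"
  proof -
    have "(\<integral>\<^sup>+\<omega>. (\<Sum>k. ennreal (D k \<omega>)) \<partial>?S) = (\<Sum>k. \<integral>\<^sup>+\<omega>. ennreal (D k \<omega>) \<partial>?S)"
      by (rule nn_integral_suminf) measurable
    also have "\<dots> \<le> (\<Sum>k. ennreal (?c ^ k) * A)" by (intro suminf_le D_le) auto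
    also have "\<dots> = (\<Sum>k. ennreal (?c ^ k)) * A" by simp
    also have "(\<Sum>k. ennreal (?c ^ k)) = ennreal (\<Sum>k. ?c ^ k)"
      using c by (intro suminf_ennreal2 summable_geometric) auto
    finally show ?thesis using A_fin by (auto simp: ennreal_mult_less_top intro: le_less_trans)
  qed
  \<comment> \<open>\<open>lim\<close> has some value even where the iterates diverge, so
    \<open>Z\<close> is total and measurable; its meaning is needed almost surely only.\<close>
  define Z where "Z \<omega> = lim (\<lambda>k. X k \<omega>)" for \<omega>
  have Zm [measurable]: "Z \<in> borel_measurable ?S" unfolding Z_def by measurable
  have aeD: "AE \<omega> in ?S. (\<Sum>k. ennreal (D k \<omega>)) \<noteq> \<infinity>"
    using sumD by (intro nn_integral_PInf_AE) auto
  \<comment> \<open>Summable increments force convergence, and the same sum dominates the limit,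
    which yields its finite mean.\<close>
  have conv_pt: "(\<lambda>k. X k \<omega>) \<longlonglongrightarrow> Z \<omega> \<and> ennreal (taxi (Z \<omega>)) \<le> (\<Sum>k. ennreal (D k \<omega>))"
    if elim: "(\<Sum>k. ennreal (D k \<omega>)) \<noteq> \<infinity>" for \<omega>
  proof -
    have D0: "D k \<omega> \<ge> 0" for k by (simp add: D_def)
    then have sm: "summable (\<lambda>k. D k \<omega>)" using elim by (intro summable_suminf_not_top) auto
    have "summable (\<lambda>k. X (Suc k) \<omega> - X k \<omega>)"
      by (rule summable_comparison_test'[OF sm]) (simp add: D_def norm_le_taxi)
    then have "convergent (\<lambda>n. \<Sum>k<n. X (Suc k) \<omega> - X k \<omega>)" by (simp add: summable_iff_convergent)
    then have "convergent (\<lambda>n. X n \<omega>)" by (simp add: sum_lessThan_telescope[of "\<lambda>k. X k \<omega>"] X0)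
    then have lim: "(\<lambda>k. X k \<omega>) \<longlonglongrightarrow> Z \<omega>" unfolding Z_def by (simp add: convergent_LIMSEQ_iff)
    have "taxi (X n \<omega>) \<le> (\<Sum>k. D k \<omega>)" for n
    proof -
      have "taxi (X n \<omega>) \<le> (\<Sum>k<n. D k \<omega>)"
      proof (induction n)
        case (Suc n)
        then show ?case using taxi_triangle[of "X (Suc n) \<omega>" 0 "X n \<omega>"] by (simp add: D_def)
      qed (simp add: X0)
      also have "\<dots> \<le> (\<Sum>k. D k \<omega>)" using sm D0 by (intro sum_le_suminf) auto
      finally show ?thesis .
    qed
    moreover have "(\<lambda>n. taxi (X n \<omega>)) \<longlonglongrightarrow> taxi (Z \<omega>)"
      unfolding taxi_def by (intro tendsto_intros lim)
    ultimately have "taxi (Z \<omega>) \<le> (\<Sum>k. D k \<omega>)" by (intro LIMSEQ_le_const2) auto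
    then have "ennreal (taxi (Z \<omega>)) \<le> (\<Sum>k. ennreal (D k \<omega>))"
      using suminf_ennreal2[OF D0 sm] by (simp add: ennreal_leI)
    with lim show ?thesis by simp
  qed
  have conv: "AE \<omega> in ?S. (\<lambda>k. X k \<omega>) \<longlonglongrightarrow> Z \<omega> \<and> ennreal (taxi (Z \<omega>)) \<le> (\<Sum>k. ennreal (D k \<omega>))"
    using aeD conv_pt by (rule eventually_mono)
  define \<mu> where "\<mu> = distr ?S borel Z"
  have \<mu>P: "prob_space \<mu>" unfolding \<mu>_def by (rule S.P.prob_space_distr) measurable
  have "integrable \<mu> taxi"
    unfolding \<mu>_def
  proof (subst integrable_distr_eq)
    show "integrable ?S (\<lambda>\<omega>. taxi (Z \<omega>))"
    proof (rule integrableI_bounded)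
      have "(\<integral>\<^sup>+\<omega>. ennreal (taxi (Z \<omega>)) \<partial>?S) \<le> (\<integral>\<^sup>+\<omega>. (\<Sum>k. ennreal (D k \<omega>)) \<partial>?S)"
        using conv by (intro nn_integral_mono_AE) auto
      then show "(\<integral>\<^sup>+\<omega>. ennreal (norm (taxi (Z \<omega>))) \<partial>?S) < \<infinity>" using sumD by (simp add: le_less_trans)
    qed measurable
  qed measurable
  then have \<mu>fm: "finite_mean \<mu>" using \<mu>P by (intro finite_meanI) (simp_all add: \<mu>_def)
  interpret SQ: pair_prob_space ?S Q ..
  \<comment> \<open>The equation in law is reduced to the almost sure identity
    \<open>\<Phi> (Z \<omega>) s = Z (case_nat s \<omega>)\<close>: the limit along the prolonged
    sequence is the new map applied to the old limit, by continuity. Prolonging preserves the law,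
    so the right-hand side is distributed as \<open>Z\<close>.\<close>
  have "distr (\<mu> \<Otimes>\<^sub>M \<nu> \<Otimes>\<^sub>M beta1 \<theta>) borel (\<lambda>(x', x, v). hoppe_map \<theta> x' x v) = distr (\<mu> \<Otimes>\<^sub>M Q) borel (\<lambda>(x', s). \<Phi> x' s)"
    unfolding Q_def by (intro distr_cong) (auto simp: hoppe_map_eq_affine_map \<Phi>_def)
  also have "\<mu> \<Otimes>\<^sub>M Q = distr (?S \<Otimes>\<^sub>M Q) (borel \<Otimes>\<^sub>M Q) (\<lambda>(\<omega>, s). (Z \<omega>, s))"
    using pair_measure_distr[of Z ?S borel "\<lambda>s. s" Q Q] Q.sigma_finite_measure_axioms
    by (simp add: \<mu>_def distr_id2)
  also have "distr (distr (?S \<Otimes>\<^sub>M Q) (borel \<Otimes>\<^sub>M Q) (\<lambda>(\<omega>, s). (Z \<omega>, s))) borel (\<lambda>(x', s). \<Phi> x' s)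
     = distr (?S \<Otimes>\<^sub>M Q) borel (\<lambda>(\<omega>, s). \<Phi> (Z \<omega>) s)"
  proof (subst distr_distr)
    show "(\<lambda>(x', s). \<Phi> x' s) \<in> borel_measurable (borel \<Otimes>\<^sub>M Q)"
      unfolding case_prod_beta' by (rule \<Phi>_meas) measurable
  qed (auto simp: comp_def case_prod_beta')
  also have "\<dots> = distr (distr (Q \<Otimes>\<^sub>M ?S) (?S \<Otimes>\<^sub>M Q) (\<lambda>(x, y). (y, x))) borel (\<lambda>(\<omega>, s). \<Phi> (Z \<omega>) s)"
    using SQ.distr_pair_swap by simp
  also have "\<dots> = distr (Q \<Otimes>\<^sub>M ?S) borel (\<lambda>(s, \<omega>). \<Phi> (Z \<omega>) s)"
  proof (subst distr_distr)
    show "(\<lambda>(\<omega>, s). \<Phi> (Z \<omega>) s) \<in> borel_measurable (?S \<Otimes>\<^sub>M Q)"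
      unfolding case_prod_beta' by (rule \<Phi>_meas) measurable
  qed (auto simp: comp_def case_prod_beta')
  also have "\<dots> = distr (Q \<Otimes>\<^sub>M ?S) borel (\<lambda>w. Z (case w of (s, \<omega>) \<Rightarrow> case_nat s \<omega>))"
  proof (rule distr_cong_AE[OF refl refl])
    have "AE w in Q \<Otimes>\<^sub>M ?S. (\<Sum>k. ennreal (D k (snd w))) \<noteq> \<infinity>"
    proof (rule QS.AE_pair_measure)
      show "{w \<in> space (Q \<Otimes>\<^sub>M ?S). (\<Sum>k. ennreal (D k (snd w))) \<noteq> \<infinity>} \<in> sets (Q \<Otimes>\<^sub>M ?S)"
        by measurable
      show "AE s in Q. AE \<omega> in ?S. (\<Sum>k. ennreal (D k (snd (s, \<omega>)))) \<noteq> \<infinity>"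
        using aeD by simp
    qed
    then have conv1: "AE w in Q \<Otimes>\<^sub>M ?S. (\<lambda>k. X k (snd w)) \<longlonglongrightarrow> Z (snd w)"
      by (rule eventually_mono) (use conv_pt in blast)
    have "AE \<omega> in distr (Q \<Otimes>\<^sub>M ?S) ?S (\<lambda>(s, \<omega>). case_nat s \<omega>). (\<lambda>k. X k \<omega>) \<longlonglongrightarrow> Z \<omega>"
      unfolding S.PiM_iter using conv by auto
    then have conv2: "AE w in Q \<Otimes>\<^sub>M ?S. (\<lambda>k. X k (case w of (s, \<omega>) \<Rightarrow> case_nat s \<omega>)) \<longlonglongrightarrow> Z (case w of (s, \<omega>) \<Rightarrow> case_nat s \<omega>)"
      by (rule AE_distrD[OF cm])
    show "AE w in Q \<Otimes>\<^sub>M ?S. (case w of (s, \<omega>) \<Rightarrow> \<Phi> (Z \<omega>) s) = Z (case w of (s, \<omega>) \<Rightarrow> case_nat s \<omega>)"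
      using conv1 conv2
    proof eventually_elim
      case (elim w)
      obtain s \<omega> where w: "w = (s, \<omega>)" by (cases w)
      have "isCont (\<lambda>x'. \<Phi> x' s) (Z \<omega>)"
        unfolding \<Phi>_def using continuous_affine_map_left[unfolded continuous_on_eq_continuous_at[OF open_UNIV]] by blast
      then have "(\<lambda>k. \<Phi> (X k \<omega>) s) \<longlonglongrightarrow> \<Phi> (Z \<omega>) s"
        using elim(1) w by (intro isCont_tendsto_compose[of _ "\<lambda>x'. \<Phi> x' s"]) auto
      moreover have "(\<lambda>k. \<Phi> (X k \<omega>) s) \<longlonglongrightarrow> Z (case_nat s \<omega>)"
        using LIMSEQ_Suc[of "\<lambda>k. X k (case_nat s \<omega>)"] elim(2) w by (simp add: Xcase)
      ultimately show ?case using w LIMSEQ_unique by auto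
    qed
    show "(\<lambda>(s, \<omega>). \<Phi> (Z \<omega>) s) \<in> borel_measurable (Q \<Otimes>\<^sub>M ?S)"
      unfolding case_prod_beta' by (rule \<Phi>_meas) measurable
  qed measurable
  also have "\<dots> = distr (distr (Q \<Otimes>\<^sub>M ?S) ?S (\<lambda>(s, \<omega>). case_nat s \<omega>)) borel Z"
    by (subst distr_distr) (auto simp: comp_def)
  also have "\<dots> = \<mu>" unfolding S.PiM_iter \<mu>_def ..
  finally have "hoppe_fixpoint \<theta> \<nu> \<mu>" unfolding hoppe_fixpoint_def .
  with \<mu>fm show ?thesis by blast
qed

section \<open>Convergence\<close>

lemma hoppe_law_finite_mean: "\<theta> > 0 \<Longrightarrow> finite_mean (hoppe_law \<theta> n)"
  by (simp add: finite_mean_def prob_space_hoppe_law integrable_hoppe_law)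

text \<open>Serves twice: it bounds the oscillation in \<open>v\<close> of the integrated limit map,
  and with \<open>u = v\<close> it exchanges the finite toll for the limit toll.\<close>

lemma double_integral_fraction:
  assumes f: "lip_taxi 1 f" and uv: "0 \<le> u" "u \<le> 1" "0 \<le> v" "v \<le> 1" and \<rho>: "finite_mean \<rho>" and \<sigma>: "finite_mean \<sigma>"
  shows "\<bar>(\<integral>x. (\<integral>x'. f (affine_map x' x u b) \<partial>\<rho>) \<partial>\<sigma>) - (\<integral>x. (\<integral>x'. f (affine_map x' x v b') \<partial>\<rho>) \<partial>\<sigma>)\<bar>
    \<le> 2 * \<bar>u - v\<bar> * ((\<integral>x. taxi x \<partial>\<rho>) + (\<integral>x. taxi x \<partial>\<sigma>)) + taxi (b - b')"
proof -
  interpret R: prob_space \<rho> using \<rho> by (simp add: finite_mean_def)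
  interpret S: prob_space \<sigma> using \<sigma> by (simp add: finite_mean_def)
  note iu = lip_affine_integrable[OF f uv(1,2) \<rho> \<sigma>] and iv = lip_affine_integrable[OF f uv(3,4) \<rho> \<sigma>]
  have t: "integrable \<rho> taxi" "integrable \<sigma> taxi" using \<rho> \<sigma> by (auto intro: finite_mean_taxi)
  let ?T = "\<integral>x. taxi x \<partial>\<rho>"
  have inner: "\<bar>(\<integral>x'. f (affine_map x' x u b) \<partial>\<rho>) - (\<integral>x'. f (affine_map x' x v b') \<partial>\<rho>)\<bar>
      \<le> 2 * \<bar>u - v\<bar> * (?T + taxi x) + taxi (b - b')" for x
  proof -
    have "\<bar>(\<integral>x'. f (affine_map x' x u b) \<partial>\<rho>) - (\<integral>x'. f (affine_map x' x v b') \<partial>\<rho>)\<bar>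
       = \<bar>\<integral>x'. f (affine_map x' x u b) - f (affine_map x' x v b') \<partial>\<rho>\<bar>" using iu iv by simp
    also have "\<dots> \<le> (\<integral>x'. \<bar>f (affine_map x' x u b) - f (affine_map x' x v b')\<bar> \<partial>\<rho>)" by (rule integral_abs_bound)
    also have "\<dots> \<le> (\<integral>x'. 2 * \<bar>u - v\<bar> * (taxi x' + taxi x) + taxi (b - b') \<partial>\<rho>)"
    proof (intro integral_mono)
      fix x'
      show "\<bar>f (affine_map x' x u b) - f (affine_map x' x v b')\<bar> \<le> 2 * \<bar>u - v\<bar> * (taxi x' + taxi x) + taxi (b - b')"
        using lip_taxiD[OF f, of "affine_map x' x u b" "affine_map x' x v b'"]
          taxi_affine_map_fraction[OF uv, of x' x b b'] by simp
    qed (use iu iv t in auto)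
    also have "\<dots> = 2 * \<bar>u - v\<bar> * (?T + taxi x) + taxi (b - b')"
      using t by (simp add: R.prob_space)
    finally show ?thesis .
  qed
  have "\<bar>(\<integral>x. (\<integral>x'. f (affine_map x' x u b) \<partial>\<rho>) \<partial>\<sigma>) - (\<integral>x. (\<integral>x'. f (affine_map x' x v b') \<partial>\<rho>) \<partial>\<sigma>)\<bar>
     = \<bar>\<integral>x. (\<integral>x'. f (affine_map x' x u b) \<partial>\<rho>) - (\<integral>x'. f (affine_map x' x v b') \<partial>\<rho>) \<partial>\<sigma>\<bar>" using iu iv by simp
  also have "\<dots> \<le> (\<integral>x. \<bar>(\<integral>x'. f (affine_map x' x u b) \<partial>\<rho>) - (\<integral>x'. f (affine_map x' x v b') \<partial>\<rho>)\<bar> \<partial>\<sigma>)"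
    by (rule integral_abs_bound)
  also have "\<dots> \<le> (\<integral>x. 2 * \<bar>u - v\<bar> * (?T + taxi x) + taxi (b - b') \<partial>\<sigma>)"
    using iu iv t by (intro integral_mono inner) auto
  also have "\<dots> = 2 * \<bar>u - v\<bar> * (?T + (\<integral>x. taxi x \<partial>\<sigma>)) + taxi (b - b')"
    using t by (simp add: S.prob_space)
  finally show ?thesis .
qed

text \<open>For each 1-Lipschitz \<open>f\<close> the finite recursion is moved to the limit
  equation by four exchanges: finite toll for limit toll, finite Hoppe law for \<mu> (the contracted
  term), random recursive tree for \<nu>, share for \<open>V\<close>. The error bounds must not
  depend on \<open>f\<close>, since the supremum over \<open>f\<close> is taken for each
  \<open>N\<close>.\<close>

theorem wasserstein_hoppe_law_null:
  assumes \<theta>: "\<theta> > 0" and \<nu>: "finite_mean \<nu>" and \<mu>: "finite_mean \<mu>" and fp: "hoppe_fixpoint \<theta> \<nu> \<mu>"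
    and lim: "(\<lambda>n. wasserstein (hoppe_law 1 n) \<nu>) \<longlonglongrightarrow> 0"
  shows "(\<lambda>n. wasserstein (hoppe_law \<theta> n) \<mu>) \<longlonglongrightarrow> 0"
proof -
  define K where "K = (\<integral>x. taxi x \<partial>\<mu>) + (\<integral>x. taxi x \<partial>\<nu>)"
  have K0: "K \<ge> 0" unfolding K_def by (intro add_nonneg_nonneg integral_nonneg) auto
  \<comment> \<open>A modulus of continuity for the integrated limit map that is common to all
    1-Lipschitz test functions.\<close>
  define g where "g u v = 2 * \<bar>u - v\<bar> * K + taxi (limit_toll \<theta> u - limit_toll \<theta> v)" for u v
  have [measurable]: "g u \<in> borel_measurable borel" for u
    unfolding g_def[abs_def] by measurable
  obtain C where C: "\<And>v. 0 \<le> v \<Longrightarrow> v \<le> 1 \<Longrightarrow> taxi (limit_toll \<theta> v) \<le> C"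
    using limit_toll_bounded[of \<theta>] by blast
  define M where "M = 2 * K + 2 * C"
  have g_bnd: "0 \<le> g u v \<and> g u v \<le> M" if "u \<in> {0..1}" "v \<in> {0..1}" for u v
  proof -
    have "\<bar>u - v\<bar> * K \<le> 1 * K" using that K0 by (intro mult_right_mono) auto
    moreover have "taxi (limit_toll \<theta> u - limit_toll \<theta> v) \<le> C + C"
      using taxi_triangle[of "limit_toll \<theta> u" "limit_toll \<theta> v" 0] taxi_minus_commute[of 0 "limit_toll \<theta> v"] C[of u] C[of v] that by simp
    moreover have "0 \<le> \<bar>u - v\<bar> * K" using K0 by simp
    ultimately show ?thesis unfolding g_def M_def by simp
  qed
  have g_small: "\<exists>d>0. \<forall>u\<in>{0..1}. \<forall>v\<in>{0..1}. \<bar>u - v\<bar> < d \<longrightarrow> g u v \<le> e" if e: "e > 0" for e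
  proof -
    have "uniformly_continuous_on {0..1} (limit_toll \<theta>)"
      by (intro compact_uniformly_continuous limit_toll_continuous) simp
    then obtain d where d: "d > 0" "\<And>u v. \<lbrakk>u \<in> {0..1}; v \<in> {0..1}; dist v u < d\<rbrakk> \<Longrightarrow> dist (limit_toll \<theta> v) (limit_toll \<theta> u) < e / 4"
      using e unfolding uniformly_continuous_on_def by (metis divide_pos_pos zero_less_numeral)
    show ?thesis
    proof (intro exI[of _ "min d (e / (4 * (K + 1)))"] conjI ballI impI)
      show "0 < min d (e / (4 * (K + 1)))" using d e K0 by simp
      fix u v :: real assume uv: "u \<in> {0..1}" "v \<in> {0..1}" "\<bar>u - v\<bar> < min d (e / (4 * (K + 1)))"
      have "\<bar>u - v\<bar> * (K + 1) \<le> e / 4" using uv(3) K0 by (simp add: field_simps)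
      then have "\<bar>u - v\<bar> * K \<le> e / 4"
        using abs_ge_zero[of "u - v"] unfolding distrib_left mult_1_right by linarith
      moreover have "dist (limit_toll \<theta> u) (limit_toll \<theta> v) < e / 4"
        using uv by (intro d(2)) (auto simp: dist_real_def)
      then have "taxi (limit_toll \<theta> u - limit_toll \<theta> v) \<le> e / 2"
        using taxi_le_norm[of "limit_toll \<theta> u - limit_toll \<theta> v"] by (simp add: dist_norm)
      ultimately show "g u v \<le> e" unfolding g_def by simp
    qed
  qed
  define \<eta> where "\<eta> N = (MAX i\<in>{..N}. taxi (finite_toll \<theta> N i - limit_toll \<theta> (share N i)))" for N
  have \<eta>: "taxi (finite_toll \<theta> N i - limit_toll \<theta> (share N i)) \<le> \<eta> N" if "i \<le> N" for i N
    unfolding \<eta>_def using that by (intro Max_ge) auto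
  have \<eta>_lim: "\<eta> \<longlonglongrightarrow> 0"
  proof (rule tendstoI)
    fix x :: real assume x: "x > 0"
    then have "x / 3 > 0" by simp
    from finite_toll_tendsto[OF \<theta> this] show "\<forall>\<^sub>F N in sequentially. dist (\<eta> N) 0 < x"
    proof eventually_elim
      case (elim N)
      have "\<eta> N \<le> 2 * (x / 3)"
        unfolding \<eta>_def
      proof (intro Max.boundedI)
        fix a assume "a \<in> (\<lambda>i. taxi (finite_toll \<theta> N i - limit_toll \<theta> (share N i))) ` {..N}"
        then obtain i where i: "i \<le> N" "a = taxi (finite_toll \<theta> N i - limit_toll \<theta> (share N i))" by blast
        show "a \<le> 2 * (x / 3)" using elim[rule_format, OF i(1)] unfolding i(2) taxi_def by simp
      qed auto
      moreover have "\<eta> N \<ge> 0" using \<eta>[of 0 N] taxi_nonneg order_trans by blast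
      ultimately show ?case using x by simp
    qed
  qed
  \<comment> \<open>Toll error, averaged distance of the first subtree from \<nu>, and
    discretisation of \<open>V\<close>.\<close>
  define e where "e N = \<eta> N + 2 * (\<Sum>i\<le>N. split_weight \<theta> N i * wasserstein (hoppe_law 1 (Suc i)) \<nu>)
      + (\<Sum>i\<le>N. \<integral>v. Bernstein N i v * g (share N i) v \<partial>beta1 \<theta>)" for N
  have "e \<longlonglongrightarrow> 0 + 2 * 0 + 0"
    unfolding e_def
    by (intro tendsto_add tendsto_mult tendsto_const \<eta>_lim split_sum_null[OF \<theta> LIMSEQ_Suc[OF lim]]
        split_average_null[OF \<theta> _ g_bnd g_small]) auto
  then have e: "e \<longlonglongrightarrow> 0" by simp
  show ?thesis
  proof (rule split_recursion_null[where \<alpha>="\<lambda>v. 1 - v\<^sup>2" and e=e, OF \<theta> _ _ _ integral_one_minus_square(2)[OF \<theta>] _ e])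
    show "(\<lambda>v::real. 1 - v\<^sup>2) \<in> borel_measurable borel" by measurable
    show "continuous_on {0..1} (\<lambda>v::real. 1 - v\<^sup>2)" by (intro continuous_intros)
    show "0 \<le> 1 - v\<^sup>2 \<and> 1 - v\<^sup>2 \<le> 1" if "0 \<le> v" "v \<le> 1" for v :: real using that by (simp add: power_le_one)
    show "wasserstein (hoppe_law \<theta> n) \<mu> \<ge> 0" for n by (intro wasserstein_nonneg hoppe_law_finite_mean \<theta> \<mu>)
    fix N
    let ?d = "\<lambda>n. wasserstein (hoppe_law \<theta> n) \<mu>" and ?w = "\<lambda>n. wasserstein (hoppe_law 1 n) \<nu>"
    show "?d (N + 2) \<le> (\<Sum>i\<le>N. split_weight \<theta> N i * ((1 - (share N i)\<^sup>2) * ?d (Suc (N - i)))) + e N"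
    proof (rule wasserstein_least)
      fix f assume f: "lip_taxi 1 f"
      have fm: "f \<in> borel_measurable borel" using f by (rule lip_taxi_measurable) simp
      \<comment> \<open>\<open>H\<close> is the right-hand side of the limit equation before
        integration over \<open>v\<close>, and \<open>J\<close> its finite counterpart for a given
        split.\<close>
      define H where "H v = (\<integral>x. (\<integral>x'. f (affine_map x' x v (limit_toll \<theta> v)) \<partial>\<mu>) \<partial>\<nu>)" for v
      define J where "J i = (\<integral>x. (\<integral>x'. f (affine_map x' x (share N i) (finite_toll \<theta> N i)) \<partial>hoppe_law \<theta> (Suc (N - i))) \<partial>hoppe_law 1 (Suc i))" for i
      note H_int = hoppe_fixpoint_integral_lip[OF \<theta> \<mu> \<nu> fp f, unfolded hoppe_map_eq_affine_map, folded H_def]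
      have Hm [measurable]: "H \<in> borel_measurable borel"
        using borel_measurable_integrable[OF H_int(2)] by simp
      have Hg: "\<bar>H u - H v\<bar> \<le> g u v" if "u \<in> {0..1}" "v \<in> {0..1}" for u v
        unfolding H_def g_def K_def using that f \<mu> \<nu> by (intro double_integral_fraction) auto
      have Hb: "\<bar>H v\<bar> \<le> \<bar>H 0\<bar> + M" if "v \<in> {0..1}" for v
      proof -
        have 0: "(0::real) \<in> {0..1}" by simp
        show ?thesis using Hg[OF that 0] g_bnd[OF that 0, THEN conjunct2] by linarith
      qed
      have JH: "\<bar>J i - H (share N i)\<bar> \<le> \<eta> N + (1 - (share N i)\<^sup>2) * ?d (Suc (N - i)) + 2 * ?w (Suc i)" if i: "i \<le> N" for i
      proof -
        define u where "u = share N i"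
        have u: "0 \<le> u" "u \<le> 1" using share_bounds[OF i] by (auto simp: u_def)
        note h1 = hoppe_law_finite_mean[OF \<theta>, of "Suc (N - i)"] and h2 = hoppe_law_finite_mean[OF zero_less_one, of "Suc i"]
        let ?I = "\<lambda>\<rho> \<sigma> b. \<integral>x. (\<integral>x'. f (affine_map x' x u b) \<partial>\<rho>) \<partial>\<sigma>"
        have 1: "\<bar>?I (hoppe_law \<theta> (Suc (N - i))) (hoppe_law 1 (Suc i)) (finite_toll \<theta> N i)
            - ?I (hoppe_law \<theta> (Suc (N - i))) (hoppe_law 1 (Suc i)) (limit_toll \<theta> u)\<bar> \<le> \<eta> N"
          using double_integral_fraction[OF f u u h1 h2, of "finite_toll \<theta> N i" "limit_toll \<theta> u"] \<eta>[OF i]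
          by (simp add: u_def)
        have 2: "\<bar>?I (hoppe_law \<theta> (Suc (N - i))) (hoppe_law 1 (Suc i)) (limit_toll \<theta> u)
            - ?I \<mu> (hoppe_law 1 (Suc i)) (limit_toll \<theta> u)\<bar> \<le> (1 - u\<^sup>2) * ?d (Suc (N - i))"
          by (rule double_integral_left[OF f u h1 \<mu> h2])
        have 3: "\<bar>?I \<mu> (hoppe_law 1 (Suc i)) (limit_toll \<theta> u) - ?I \<mu> \<nu> (limit_toll \<theta> u)\<bar> \<le> 2 * ?w (Suc i)"
          by (rule wasserstein_scaled[OF h2 \<nu> lip_affine_right[OF f u \<mu>]]) simp
        have "J i = ?I (hoppe_law \<theta> (Suc (N - i))) (hoppe_law 1 (Suc i)) (finite_toll \<theta> N i)"
          unfolding J_def u_def ..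
        moreover have "H u = ?I \<mu> \<nu> (limit_toll \<theta> u)" unfolding H_def ..
        ultimately show ?thesis using 1 2 3 unfolding u_def[symmetric] by linarith
      qed
      have "(\<integral>x. f x \<partial>hoppe_law \<theta> (N + 2)) = (\<Sum>i\<le>N. split_weight \<theta> N i * J i)"
        unfolding J_def by (rule hoppe_law_split[OF \<theta> fm])
      moreover have "(\<integral>x. f x \<partial>\<mu>) = (\<integral>v. H v \<partial>beta1 \<theta>)" by (rule H_int(1))
      moreover have "\<bar>(\<Sum>i\<le>N. split_weight \<theta> N i * J i) - (\<Sum>i\<le>N. split_weight \<theta> N i * H (share N i))\<bar>
         \<le> \<eta> N + (\<Sum>i\<le>N. split_weight \<theta> N i * ((1 - (share N i)\<^sup>2) * ?d (Suc (N - i)))) + 2 * (\<Sum>i\<le>N. split_weight \<theta> N i * ?w (Suc i))"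
      proof -
        have "\<bar>(\<Sum>i\<le>N. split_weight \<theta> N i * J i) - (\<Sum>i\<le>N. split_weight \<theta> N i * H (share N i))\<bar>
           = \<bar>\<Sum>i\<le>N. split_weight \<theta> N i * (J i - H (share N i))\<bar>"
          by (simp only: sum_subtractf right_diff_distrib)
        also have "\<dots> \<le> (\<Sum>i\<le>N. \<bar>split_weight \<theta> N i * (J i - H (share N i))\<bar>)" by (rule sum_abs)
        also have "\<dots> \<le> (\<Sum>i\<le>N. split_weight \<theta> N i * (\<eta> N + (1 - (share N i)\<^sup>2) * ?d (Suc (N - i)) + 2 * ?w (Suc i)))"
          unfolding abs_mult abs_of_nonneg[OF split_weight_nonneg]
          by (intro sum_mono mult_left_mono split_weight_nonneg JH) simp
        also have "\<dots> = (\<Sum>i\<le>N. split_weight \<theta> N i) * \<eta> N + (\<Sum>i\<le>N. split_weight \<theta> N i * ((1 - (share N i)\<^sup>2) * ?d (Suc (N - i))))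
            + 2 * (\<Sum>i\<le>N. split_weight \<theta> N i * ?w (Suc i))"
          unfolding sum_distrib_left sum_distrib_right sum.distrib[symmetric]
          by (intro sum.cong refl) (simp only: distrib_left mult.assoc mult.left_commute)
        finally show ?thesis by (simp only: sum_split_weight[OF \<theta>] mult_1)
      qed
      moreover have "\<bar>(\<Sum>i\<le>N. split_weight \<theta> N i * H (share N i)) - (\<integral>v. H v \<partial>beta1 \<theta>)\<bar>
          \<le> (\<Sum>i\<le>N. \<integral>v. Bernstein N i v * g (share N i) v \<partial>beta1 \<theta>)"
      proof (rule order_trans[OF split_sum_error[OF \<theta> Hm Hb] sum_mono])
        fix i assume "i \<in> {..N}"
        then have u: "share N i \<in> {0..1}" using share_bounds[of i N] by (simp del: of_nat_Suc of_nat_add)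
        show "(\<integral>v. Bernstein N i v * \<bar>H (share N i) - H v\<bar> \<partial>beta1 \<theta>) \<le> (\<integral>v. Bernstein N i v * g (share N i) v \<partial>beta1 \<theta>)"
        proof (rule integral_beta1_mono)
          show "integrable (beta1 \<theta>) (\<lambda>v. Bernstein N i v * \<bar>H (share N i) - H v\<bar>)"
            using Hg[OF u] g_bnd[OF u] by (intro integrable_Bernstein_mult[OF \<theta>, where C=M]) (auto intro: order_trans)
          show "integrable (beta1 \<theta>) (\<lambda>v. Bernstein N i v * g (share N i) v)"
            using g_bnd[OF u] by (intro integrable_Bernstein_mult[OF \<theta>, where C=M]) auto
          show "Bernstein N i v * \<bar>H (share N i) - H v\<bar> \<le> Bernstein N i v * g (share N i) v" if "0 < v" "v < 1" for v
            using that by (intro mult_left_mono Hg u Bernstein_nonneg) auto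
        qed
      qed
      ultimately show "\<bar>(\<integral>x. f x \<partial>hoppe_law \<theta> (N + 2)) - (\<integral>x. f x \<partial>\<mu>)\<bar>
          \<le> (\<Sum>i\<le>N. split_weight \<theta> N i * ((1 - (share N i)\<^sup>2) * ?d (Suc (N - i)))) + e N"
        unfolding e_def by linarith
    qed
  qed
qed

section \<open>Second moments\<close>

lemma fst_affine_map: "fst (affine_map x' x v b) = (1 - v)\<^sup>2 * fst x' + v * (1 - v) * snd x' + v\<^sup>2 * fst x + v * (1 - v) * snd x + fst b"
  by (simp add: affine_map_def)

text \<open>The zero coefficients bring the second row into the five-term pattern of
  \<open>centered_moment2\<close>.\<close>

lemma snd_affine_map: "snd (affine_map x' x v b) = 0 * fst x' + (1 - v) * snd x' + 0 * fst x + v * snd x + snd b"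
  by (simp add: affine_map_def)

definition moment_TT :: "(real \<times> real) measure \<Rightarrow> real" where
  "moment_TT M = (\<integral>x. (snd x)\<^sup>2 \<partial>M)"

definition moment_WT :: "(real \<times> real) measure \<Rightarrow> real" where
  "moment_WT M = (\<integral>x. fst x * snd x \<partial>M)"

definition moment_WW :: "(real \<times> real) measure \<Rightarrow> real" where
  "moment_WW M = (\<integral>x. (fst x)\<^sup>2 \<partial>M)"

text \<open>A triangular system: the own coefficients are \<open>(1 - v)^2\<close>,
  \<open>(1 - v)^3\<close>, \<open>(1 - v)^4\<close>, and beyond these each moment of
  \<open>M'\<close> calls only on moments listed before it. The sums are nested to the right so that
  limits can be taken term by term.\<close>

lemma affine_map_moments:
  assumes "centered_L2 M'" "centered_L2 M"
  shows "(\<integral>x. (\<integral>x'. (snd (affine_map x' x v b))\<^sup>2 \<partial>M') \<partial>M) = (1 - v)\<^sup>2 * moment_TT M' + (v\<^sup>2 * moment_TT M + (snd b)\<^sup>2)"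
    and "(\<integral>x. (\<integral>x'. fst (affine_map x' x v b) * snd (affine_map x' x v b) \<partial>M') \<partial>M)
      = (1 - v) ^ 3 * moment_WT M' + (v * (1 - v)\<^sup>2 * moment_TT M' + (v ^ 3 * moment_WT M + (v\<^sup>2 * (1 - v) * moment_TT M + fst b * snd b)))"
    and "(\<integral>x. (\<integral>x'. (fst (affine_map x' x v b))\<^sup>2 \<partial>M') \<partial>M)
      = (1 - v) ^ 4 * moment_WW M' + (2 * v * (1 - v) ^ 3 * moment_WT M' + (v\<^sup>2 * (1 - v)\<^sup>2 * moment_TT M'
        + (v ^ 4 * moment_WW M + (2 * v ^ 3 * (1 - v) * moment_WT M + (v\<^sup>2 * (1 - v)\<^sup>2 * moment_TT M + (fst b)\<^sup>2)))))"
  unfolding power2_eq_square[of "snd (affine_map x' x v b)" for x' x v b]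
    power2_eq_square[of "fst (affine_map x' x v b)" for x' x v b]
  unfolding fst_affine_map snd_affine_map centered_moment2[OF assms] moment_TT_def moment_WT_def moment_WW_def
  by (simp_all add: algebra_simps power2_eq_square power3_eq_cube power4_eq_xxxx)

lemma uniform_product:
  fixes h k :: "real \<Rightarrow> real"
  assumes p: "\<And>x. x > 0 \<Longrightarrow> \<forall>\<^sub>F N in sequentially. \<forall>i\<le>N. \<bar>p N i - h (share N i)\<bar> \<le> x"
    and q: "\<And>x. x > 0 \<Longrightarrow> \<forall>\<^sub>F N in sequentially. \<forall>i\<le>N. \<bar>q N i - k (share N i)\<bar> \<le> x"
    and hk: "continuous_on {0..1} h" "continuous_on {0..1} k" and x: "x > 0"
  shows "\<forall>\<^sub>F N in sequentially. \<forall>i\<le>N. \<bar>p N i * q N i - h (share N i) * k (share N i)\<bar> \<le> x"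
proof -
  obtain A where A: "\<And>v. \<lbrakk>0 \<le> v; v \<le> 1\<rbrakk> \<Longrightarrow> \<bar>h v\<bar> \<le> A" using continuous_unit_bounded[OF hk(1)] by blast
  obtain B where B: "\<And>v. \<lbrakk>0 \<le> v; v \<le> 1\<rbrakk> \<Longrightarrow> \<bar>k v\<bar> \<le> B" using continuous_unit_bounded[OF hk(2)] by blast
  have AB: "A \<ge> 0" "B \<ge> 0" using A[of 0] B[of 0] by auto
  \<comment> \<open>With \<open>y \<le> 1\<close> the product of the two errors is at most
    \<open>y\<close>; the divisor \<open>A + B + 1\<close> then absorbs all three terms.\<close>
  define y where "y = min 1 (x / (A + B + 1))"
  have y: "y > 0" "y \<le> 1" using x AB by (auto simp: y_def)
  have "y \<le> x / (A + B + 1)" by (simp add: y_def)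
  then have yx: "y * (A + B + 1) \<le> x" using AB by (subst (asm) pos_le_divide_eq) simp_all
  show ?thesis
    using p[OF y(1)] q[OF y(1)]
  proof eventually_elim
    case (elim N)
    show ?case
    proof (intro allI impI)
      fix i assume i: "i \<le> N"
      let ?u = "share N i"
      have u: "0 \<le> ?u" "?u \<le> 1" using share_bounds[OF i] by auto
      have 1: "\<bar>p N i - h ?u\<bar> \<le> y" "\<bar>q N i - k ?u\<bar> \<le> y" using elim i by auto
      have "p N i * q N i - h ?u * k ?u = (p N i - h ?u) * (q N i - k ?u) + (p N i - h ?u) * k ?u + h ?u * (q N i - k ?u)"
        by (simp add: algebra_simps)
      moreover have "\<bar>(p N i - h ?u) * (q N i - k ?u)\<bar> \<le> y * 1" "\<bar>(p N i - h ?u) * k ?u\<bar> \<le> y * B"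
          "\<bar>h ?u * (q N i - k ?u)\<bar> \<le> A * y"
        unfolding abs_mult using 1 A[OF u] B[OF u] y AB by (auto intro!: mult_mono simp del: of_nat_Suc of_nat_add mult_1_right)
      moreover have "y * (A + B + 1) = y * 1 + y * B + A * y" by (simp add: algebra_simps)
      ultimately show "\<bar>p N i * q N i - h ?u * k ?u\<bar> \<le> x" using yx by linarith
    qed
  qed
qed

lemma integrable_beta1_continuous:
  assumes "\<theta> > 0" "h \<in> borel_measurable borel" "continuous_on {0..1} h"
  shows "integrable (beta1 \<theta>) (h :: real \<Rightarrow> real)"
proof -
  obtain A where "\<And>v. \<lbrakk>0 \<le> v; v \<le> 1\<rbrakk> \<Longrightarrow> \<bar>h v\<bar> \<le> A" using continuous_unit_bounded[OF assms(3)] by blast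
  then show ?thesis using assms by (intro integrable_beta1[where C=A])
qed

text \<open>Quadratic growth is dominated through
  \<open>(a + b + c)^2 \<le> 3 (a^2 + b^2 + c^2)\<close> with \<open>b = 2 * taxi x\<close>, whence
  the factors 3 and 12.\<close>

lemma hoppe_fixpoint_integral_quadratic:
  assumes \<theta>: "\<theta> > 0" and \<rho>: "centered_L2 \<rho>" and \<nu>: "centered_L2 \<nu>" and fp: "hoppe_fixpoint \<theta> \<nu> \<rho>"
    and g: "g \<in> borel_measurable borel" "\<And>x. \<bar>g x\<bar> \<le> (taxi x)\<^sup>2"
  shows "(\<integral>x. g x \<partial>\<rho>) = (\<integral>v. (\<integral>x. (\<integral>x'. g (affine_map x' x v (limit_toll \<theta> v)) \<partial>\<rho>) \<partial>\<nu>) \<partial>beta1 \<theta>)"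
proof -
  obtain C where C: "\<And>v. 0 \<le> v \<Longrightarrow> v \<le> 1 \<Longrightarrow> taxi (limit_toll \<theta> v) \<le> C"
    using limit_toll_bounded[of \<theta>] by blast
  have bnd: "\<bar>g (hoppe_map \<theta> x' x v)\<bar> \<le> 3 * (taxi x')\<^sup>2 + 12 * (taxi x)\<^sup>2 + 3 * C\<^sup>2" if "0 < v" "v < 1" for x' x v
  proof -
    have "taxi (hoppe_map \<theta> x' x v) \<le> taxi x' + 2 * taxi x + C"
      using taxi_affine_map_le[of v x' x "limit_toll \<theta> v"] C[of v] that by (simp add: hoppe_map_eq_affine_map)
    then have "(taxi (hoppe_map \<theta> x' x v))\<^sup>2 \<le> (taxi x' + 2 * taxi x + C)\<^sup>2" by (intro power_mono) auto
    also have "\<dots> \<le> 3 * (taxi x')\<^sup>2 + 12 * (taxi x)\<^sup>2 + 3 * C\<^sup>2"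
    proof -
      have "0 \<le> (taxi x' - 2 * taxi x)\<^sup>2 + (taxi x' - C)\<^sup>2 + (2 * taxi x - C)\<^sup>2" by simp
      then show ?thesis by (simp add: power2_eq_square algebra_simps)
    qed
    finally show ?thesis using g(2)[of "hoppe_map \<theta> x' x v"] by simp
  qed
  have p: "prob_space \<rho>" "sets \<rho> = sets borel" "prob_space \<nu>" "sets \<nu> = sets borel"
    "integrable \<rho> (\<lambda>x. 3 * (taxi x)\<^sup>2)" "integrable \<nu> (\<lambda>x. 12 * (taxi x)\<^sup>2)"
    using \<rho> \<nu> centered_L2_taxi_square by (auto simp: centered_L2_def)
  show ?thesis
    using hoppe_fixpoint_integral(1)[OF \<theta> p(1-4) fp g(1) p(5,6) bnd] by (simp add: hoppe_map_eq_affine_map)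
qed

lemma quadratic_le_taxi:
  "\<bar>(fst x)\<^sup>2\<bar> \<le> (taxi x)\<^sup>2" "\<bar>fst x * snd x\<bar> \<le> (taxi x)\<^sup>2" "\<bar>(snd x)\<^sup>2\<bar> \<le> (taxi x)\<^sup>2"
proof -
  have "(taxi x)\<^sup>2 = (fst x)\<^sup>2 + (snd x)\<^sup>2 + 2 * \<bar>fst x * snd x\<bar>"
    by (simp add: taxi_def power2_sum abs_mult)
  moreover have "0 \<le> (fst x)\<^sup>2" "0 \<le> (snd x)\<^sup>2" "0 \<le> \<bar>fst x * snd x\<bar>" by simp_all
  ultimately show "\<bar>(fst x)\<^sup>2\<bar> \<le> (taxi x)\<^sup>2" "\<bar>fst x * snd x\<bar> \<le> (taxi x)\<^sup>2" "\<bar>(snd x)\<^sup>2\<bar> \<le> (taxi x)\<^sup>2"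
    by linarith+
qed

lemma integral_power_one_minus:
  assumes "\<theta> > 0" "k > 0"
  shows "(\<integral>v. (1 - v) ^ k \<partial>beta1 \<theta>) < 1"
  using assms by (intro integral_beta1_less_1 integrable_beta1_continuous) (auto intro!: continuous_intros simp: power_less_one_iff)

context
  fixes \<theta> :: real and \<nu> :: "(real \<times> real) measure"
  assumes \<theta>: "\<theta> > 0"
begin

text \<open>Solution of the scalar equation that the integrated moment identity yields with the
  limit toll. These constants make no reference to a solution of the limit law equation, so the
  finite laws and the fixed point can be matched through them.\<close>

definition limit_TT :: real where
  "limit_TT = ((\<integral>v. v\<^sup>2 \<partial>beta1 \<theta>) * moment_TT \<nu> + (\<integral>v. (snd (limit_toll \<theta> v))\<^sup>2 \<partial>beta1 \<theta>))
     / (1 - (\<integral>v. (1 - v)\<^sup>2 \<partial>beta1 \<theta>))"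

definition limit_WT :: real where
  "limit_WT = ((\<integral>v. v * (1 - v)\<^sup>2 \<partial>beta1 \<theta>) * limit_TT + ((\<integral>v. v ^ 3 \<partial>beta1 \<theta>) * moment_WT \<nu>
     + ((\<integral>v. v\<^sup>2 * (1 - v) \<partial>beta1 \<theta>) * moment_TT \<nu> + (\<integral>v. fst (limit_toll \<theta> v) * snd (limit_toll \<theta> v) \<partial>beta1 \<theta>))))
     / (1 - (\<integral>v. (1 - v) ^ 3 \<partial>beta1 \<theta>))"

definition limit_WW :: real where
  "limit_WW = ((\<integral>v. 2 * v * (1 - v) ^ 3 \<partial>beta1 \<theta>) * limit_WT + ((\<integral>v. v\<^sup>2 * (1 - v)\<^sup>2 \<partial>beta1 \<theta>) * limit_TT
     + ((\<integral>v. v ^ 4 \<partial>beta1 \<theta>) * moment_WW \<nu> + ((\<integral>v. 2 * v ^ 3 * (1 - v) \<partial>beta1 \<theta>) * moment_WT \<nu>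
     + ((\<integral>v. v\<^sup>2 * (1 - v)\<^sup>2 \<partial>beta1 \<theta>) * moment_TT \<nu> + (\<integral>v. (fst (limit_toll \<theta> v))\<^sup>2 \<partial>beta1 \<theta>))))))
     / (1 - (\<integral>v. (1 - v) ^ 4 \<partial>beta1 \<theta>))"

lemma toll_measurable_continuous:
  "(\<lambda>v. fst (limit_toll \<theta> v)) \<in> borel_measurable borel" "(\<lambda>v. snd (limit_toll \<theta> v)) \<in> borel_measurable borel"
  "continuous_on {0..1} (\<lambda>v. fst (limit_toll \<theta> v))" "continuous_on {0..1} (\<lambda>v. snd (limit_toll \<theta> v))"
  by (measurable, measurable) (intro continuous_intros limit_toll_continuous)+

lemma toll_uniform:
  assumes "x > 0"
  shows "\<forall>\<^sub>F N in sequentially. \<forall>i\<le>N. \<bar>fst (finite_toll \<theta> N i) - fst (limit_toll \<theta> (share N i))\<bar> \<le> x"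
    "\<forall>\<^sub>F N in sequentially. \<forall>i\<le>N. \<bar>snd (finite_toll \<theta> N i) - snd (limit_toll \<theta> (share N i))\<bar> \<le> x"
  using finite_toll_tendsto[OF \<theta> assms] by (auto elim!: eventually_mono)

text \<open>The order is forced: the recursion for the mixed moment needs the limit of the second
  moment of the path length of the same Hoppe trees, and that for the Wiener index needs
  both.\<close>

lemma hoppe_law_moments_tendsto:
  assumes TT: "(\<lambda>n. moment_TT (hoppe_law 1 n)) \<longlonglongrightarrow> moment_TT \<nu>"
    and WT: "(\<lambda>n. moment_WT (hoppe_law 1 n)) \<longlonglongrightarrow> moment_WT \<nu>"
    and WW: "(\<lambda>n. moment_WW (hoppe_law 1 n)) \<longlonglongrightarrow> moment_WW \<nu>"
  shows "(\<lambda>n. moment_TT (hoppe_law \<theta> n)) \<longlonglongrightarrow> limit_TT" "(\<lambda>n. moment_WT (hoppe_law \<theta> n)) \<longlonglongrightarrow> limit_WT"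
    "(\<lambda>n. moment_WW (hoppe_law \<theta> n)) \<longlonglongrightarrow> limit_WW"
proof -
  note c = hoppe_law_centered[OF \<theta> zero_less_Suc] hoppe_law_centered[OF zero_less_one zero_less_Suc]
  note tm = toll_measurable_continuous
  have split_add: "(\<Sum>i\<le>N. split_weight \<theta> N i * (f i + f' i)) = (\<Sum>i\<le>N. split_weight \<theta> N i * f i) + (\<Sum>i\<le>N. split_weight \<theta> N i * f' i)" for N f f'
    by (simp only: distrib_left sum.distrib)
  show TT': "(\<lambda>n. moment_TT (hoppe_law \<theta> n)) \<longlonglongrightarrow> limit_TT"
    unfolding limit_TT_def
  proof (rule split_recursion_tendsto[OF \<theta>])
    show "(\<lambda>N. (\<Sum>i\<le>N. split_weight \<theta> N i * ((share N i)\<^sup>2 * moment_TT (hoppe_law 1 (Suc i))))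
        + (\<Sum>i\<le>N. split_weight \<theta> N i * (snd (finite_toll \<theta> N i))\<^sup>2))
      \<longlonglongrightarrow> (\<integral>v. v\<^sup>2 \<partial>beta1 \<theta>) * moment_TT \<nu> + (\<integral>v. (snd (limit_toll \<theta> v))\<^sup>2 \<partial>beta1 \<theta>)"
      unfolding power2_eq_square[of "snd _"]
      by (intro tendsto_add split_sum_product_tendsto(1)[where h="\<lambda>v. v\<^sup>2"] split_sum_uniform_tendsto
          uniform_product toll_uniform \<theta> TT tm continuous_intros borel_measurable_times) auto
    show "moment_TT (hoppe_law \<theta> (N + 2)) = (\<Sum>i\<le>N. split_weight \<theta> N i * ((1 - share N i)\<^sup>2 * moment_TT (hoppe_law \<theta> (Suc (N - i)))))
        + ((\<Sum>i\<le>N. split_weight \<theta> N i * ((share N i)\<^sup>2 * moment_TT (hoppe_law 1 (Suc i))))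
        + (\<Sum>i\<le>N. split_weight \<theta> N i * (snd (finite_toll \<theta> N i))\<^sup>2))" for N
      unfolding split_add[symmetric] affine_map_moments(1)[OF c, symmetric]
      unfolding moment_TT_def by (rule hoppe_law_split[OF \<theta>]) measurable
  qed (use integral_power_one_minus[OF \<theta>, of 2] in \<open>auto intro!: continuous_intros simp: power_le_one\<close>)
  show WT': "(\<lambda>n. moment_WT (hoppe_law \<theta> n)) \<longlonglongrightarrow> limit_WT"
    unfolding limit_WT_def
  proof (rule split_recursion_tendsto[OF \<theta>])
    show "(\<lambda>N. (\<Sum>i\<le>N. split_weight \<theta> N i * (share N i * (1 - share N i)\<^sup>2 * moment_TT (hoppe_law \<theta> (Suc (N - i)))))
        + ((\<Sum>i\<le>N. split_weight \<theta> N i * ((share N i) ^ 3 * moment_WT (hoppe_law 1 (Suc i))))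
        + ((\<Sum>i\<le>N. split_weight \<theta> N i * ((share N i)\<^sup>2 * (1 - share N i) * moment_TT (hoppe_law 1 (Suc i))))
        + (\<Sum>i\<le>N. split_weight \<theta> N i * (fst (finite_toll \<theta> N i) * snd (finite_toll \<theta> N i))))))
      \<longlonglongrightarrow> (\<integral>v. v * (1 - v)\<^sup>2 \<partial>beta1 \<theta>) * limit_TT + ((\<integral>v. v ^ 3 \<partial>beta1 \<theta>) * moment_WT \<nu>
     + ((\<integral>v. v\<^sup>2 * (1 - v) \<partial>beta1 \<theta>) * moment_TT \<nu> + (\<integral>v. fst (limit_toll \<theta> v) * snd (limit_toll \<theta> v) \<partial>beta1 \<theta>)))"
      by (intro tendsto_add split_sum_product_tendsto(2)[where h="\<lambda>v. v * (1 - v)\<^sup>2"] split_sum_product_tendsto(1)[where h="\<lambda>v. v ^ 3"]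
          split_sum_product_tendsto(1)[where h="\<lambda>v. v\<^sup>2 * (1 - v)"] split_sum_uniform_tendsto
          uniform_product toll_uniform \<theta> TT WT TT' tm continuous_intros borel_measurable_times) auto
    show "moment_WT (hoppe_law \<theta> (N + 2)) = (\<Sum>i\<le>N. split_weight \<theta> N i * ((1 - share N i) ^ 3 * moment_WT (hoppe_law \<theta> (Suc (N - i)))))
        + ((\<Sum>i\<le>N. split_weight \<theta> N i * (share N i * (1 - share N i)\<^sup>2 * moment_TT (hoppe_law \<theta> (Suc (N - i)))))
        + ((\<Sum>i\<le>N. split_weight \<theta> N i * ((share N i) ^ 3 * moment_WT (hoppe_law 1 (Suc i))))
        + ((\<Sum>i\<le>N. split_weight \<theta> N i * ((share N i)\<^sup>2 * (1 - share N i) * moment_TT (hoppe_law 1 (Suc i))))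
        + (\<Sum>i\<le>N. split_weight \<theta> N i * (fst (finite_toll \<theta> N i) * snd (finite_toll \<theta> N i))))))" for N
      unfolding split_add[symmetric] affine_map_moments(2)[OF c, symmetric]
      unfolding moment_WT_def by (rule hoppe_law_split[OF \<theta>]) measurable
  qed (use integral_power_one_minus[OF \<theta>, of 3] in \<open>auto intro!: continuous_intros simp: power_le_one\<close>)
  show "(\<lambda>n. moment_WW (hoppe_law \<theta> n)) \<longlonglongrightarrow> limit_WW"
    unfolding limit_WW_def
  proof (rule split_recursion_tendsto[OF \<theta>])
    show "(\<lambda>N. (\<Sum>i\<le>N. split_weight \<theta> N i * (2 * share N i * (1 - share N i) ^ 3 * moment_WT (hoppe_law \<theta> (Suc (N - i)))))
        + ((\<Sum>i\<le>N. split_weight \<theta> N i * ((share N i)\<^sup>2 * (1 - share N i)\<^sup>2 * moment_TT (hoppe_law \<theta> (Suc (N - i)))))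
        + ((\<Sum>i\<le>N. split_weight \<theta> N i * ((share N i) ^ 4 * moment_WW (hoppe_law 1 (Suc i))))
        + ((\<Sum>i\<le>N. split_weight \<theta> N i * (2 * (share N i) ^ 3 * (1 - share N i) * moment_WT (hoppe_law 1 (Suc i))))
        + ((\<Sum>i\<le>N. split_weight \<theta> N i * ((share N i)\<^sup>2 * (1 - share N i)\<^sup>2 * moment_TT (hoppe_law 1 (Suc i))))
        + (\<Sum>i\<le>N. split_weight \<theta> N i * (fst (finite_toll \<theta> N i))\<^sup>2))))))
      \<longlonglongrightarrow> (\<integral>v. 2 * v * (1 - v) ^ 3 \<partial>beta1 \<theta>) * limit_WT + ((\<integral>v. v\<^sup>2 * (1 - v)\<^sup>2 \<partial>beta1 \<theta>) * limit_TT
     + ((\<integral>v. v ^ 4 \<partial>beta1 \<theta>) * moment_WW \<nu> + ((\<integral>v. 2 * v ^ 3 * (1 - v) \<partial>beta1 \<theta>) * moment_WT \<nu>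
     + ((\<integral>v. v\<^sup>2 * (1 - v)\<^sup>2 \<partial>beta1 \<theta>) * moment_TT \<nu> + (\<integral>v. (fst (limit_toll \<theta> v))\<^sup>2 \<partial>beta1 \<theta>)))))"
      unfolding power2_eq_square[of "fst _"]
      by (intro tendsto_add split_sum_product_tendsto(2)[where h="\<lambda>v. 2 * v * (1 - v) ^ 3"]
          split_sum_product_tendsto(2)[where h="\<lambda>v. v\<^sup>2 * (1 - v)\<^sup>2"] split_sum_product_tendsto(1)[where h="\<lambda>v. v ^ 4"]
          split_sum_product_tendsto(1)[where h="\<lambda>v. 2 * v ^ 3 * (1 - v)"] split_sum_product_tendsto(1)[where h="\<lambda>v. v\<^sup>2 * (1 - v)\<^sup>2"]
          split_sum_uniform_tendsto uniform_product toll_uniform \<theta> TT WT WW TT' WT' tm continuous_intros borel_measurable_times) auto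
    show "moment_WW (hoppe_law \<theta> (N + 2)) = (\<Sum>i\<le>N. split_weight \<theta> N i * ((1 - share N i) ^ 4 * moment_WW (hoppe_law \<theta> (Suc (N - i)))))
        + ((\<Sum>i\<le>N. split_weight \<theta> N i * (2 * share N i * (1 - share N i) ^ 3 * moment_WT (hoppe_law \<theta> (Suc (N - i)))))
        + ((\<Sum>i\<le>N. split_weight \<theta> N i * ((share N i)\<^sup>2 * (1 - share N i)\<^sup>2 * moment_TT (hoppe_law \<theta> (Suc (N - i)))))
        + ((\<Sum>i\<le>N. split_weight \<theta> N i * ((share N i) ^ 4 * moment_WW (hoppe_law 1 (Suc i))))
        + ((\<Sum>i\<le>N. split_weight \<theta> N i * (2 * (share N i) ^ 3 * (1 - share N i) * moment_WT (hoppe_law 1 (Suc i))))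
        + ((\<Sum>i\<le>N. split_weight \<theta> N i * ((share N i)\<^sup>2 * (1 - share N i)\<^sup>2 * moment_TT (hoppe_law 1 (Suc i))))
        + (\<Sum>i\<le>N. split_weight \<theta> N i * (fst (finite_toll \<theta> N i))\<^sup>2))))))" for N
      unfolding split_add[symmetric] affine_map_moments(3)[OF c, symmetric]
      unfolding moment_WW_def by (rule hoppe_law_split[OF \<theta>]) measurable
  qed (use integral_power_one_minus[OF \<theta>, of 4] in \<open>auto intro!: continuous_intros simp: power_le_one\<close>)
qed

text \<open>Integrating the limit equation gives \<open>x = q * x + r\<close> with
  \<open>q < 1\<close> for each moment in turn; solving for \<open>x\<close> is legitimate because
  the second moments are known to be finite.\<close>

lemma fixpoint_moments:
  assumes \<mu>: "centered_L2 \<mu>" and \<nu>: "centered_L2 \<nu>" and fp: "hoppe_fixpoint \<theta> \<nu> \<mu>"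
  shows "moment_TT \<mu> = limit_TT" "moment_WT \<mu> = limit_WT" "moment_WW \<mu> = limit_WW"
proof -
  note tm = toll_measurable_continuous
  note [measurable] = tm(1,2)
  have I: "integrable (beta1 \<theta>) h" if "continuous_on {0..1} h" "h \<in> borel_measurable borel" for h :: "real \<Rightarrow> real"
    using that by (intro integrable_beta1_continuous \<theta>)
  have solve: "x = r / (1 - q)" if "x = q * x + r" "q < 1" for x q r :: real
    using that by (simp add: field_simps)
  note q = integral_power_one_minus[OF \<theta>]
  have int: "integrable (beta1 \<theta>) (\<lambda>v. v\<^sup>2)" "integrable (beta1 \<theta>) (\<lambda>v. (1 - v)\<^sup>2)" "integrable (beta1 \<theta>) (\<lambda>v. (snd (limit_toll \<theta> v))\<^sup>2)"
    "integrable (beta1 \<theta>) (\<lambda>v. v * (1 - v)\<^sup>2)" "integrable (beta1 \<theta>) (\<lambda>v. v ^ 3)" "integrable (beta1 \<theta>) (\<lambda>v. (1 - v) ^ 3)"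
    "integrable (beta1 \<theta>) (\<lambda>v. v\<^sup>2 * (1 - v))" "integrable (beta1 \<theta>) (\<lambda>v. fst (limit_toll \<theta> v) * snd (limit_toll \<theta> v))"
    "integrable (beta1 \<theta>) (\<lambda>v. 2 * v * (1 - v) ^ 3)" "integrable (beta1 \<theta>) (\<lambda>v. v\<^sup>2 * (1 - v)\<^sup>2)"
    "integrable (beta1 \<theta>) (\<lambda>v. v ^ 4)" "integrable (beta1 \<theta>) (\<lambda>v. (1 - v) ^ 4)" "integrable (beta1 \<theta>) (\<lambda>v. 2 * v ^ 3 * (1 - v))"
    "integrable (beta1 \<theta>) (\<lambda>v. (fst (limit_toll \<theta> v))\<^sup>2)"
    by (rule I, intro continuous_intros tm, measurable)+
  have "moment_TT \<mu> = (\<integral>v. (1 - v)\<^sup>2 * moment_TT \<mu> + (v\<^sup>2 * moment_TT \<nu> + (snd (limit_toll \<theta> v))\<^sup>2) \<partial>beta1 \<theta>)"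
    unfolding affine_map_moments(1)[OF \<mu> \<nu>, symmetric] unfolding moment_TT_def
    by (rule hoppe_fixpoint_integral_quadratic[OF \<theta> \<mu> \<nu> fp _ quadratic_le_taxi(3)]) measurable
  also have "\<dots> = (\<integral>v. (1 - v)\<^sup>2 \<partial>beta1 \<theta>) * moment_TT \<mu> + ((\<integral>v. v\<^sup>2 \<partial>beta1 \<theta>) * moment_TT \<nu> + (\<integral>v. (snd (limit_toll \<theta> v))\<^sup>2 \<partial>beta1 \<theta>))"
    using int by simp
  finally show TT: "moment_TT \<mu> = limit_TT"
    unfolding limit_TT_def by (rule solve) (rule q, simp)
  have "moment_WT \<mu> = (\<integral>v. (1 - v) ^ 3 * moment_WT \<mu> + (v * (1 - v)\<^sup>2 * moment_TT \<mu> + (v ^ 3 * moment_WT \<nu>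
      + (v\<^sup>2 * (1 - v) * moment_TT \<nu> + fst (limit_toll \<theta> v) * snd (limit_toll \<theta> v)))) \<partial>beta1 \<theta>)"
    unfolding affine_map_moments(2)[OF \<mu> \<nu>, symmetric] unfolding moment_WT_def
    by (rule hoppe_fixpoint_integral_quadratic[OF \<theta> \<mu> \<nu> fp _ quadratic_le_taxi(2)]) measurable
  also have "\<dots> = (\<integral>v. (1 - v) ^ 3 \<partial>beta1 \<theta>) * moment_WT \<mu> + ((\<integral>v. v * (1 - v)\<^sup>2 \<partial>beta1 \<theta>) * moment_TT \<mu> + ((\<integral>v. v ^ 3 \<partial>beta1 \<theta>) * moment_WT \<nu>
      + ((\<integral>v. v\<^sup>2 * (1 - v) \<partial>beta1 \<theta>) * moment_TT \<nu> + (\<integral>v. fst (limit_toll \<theta> v) * snd (limit_toll \<theta> v) \<partial>beta1 \<theta>))))"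
    using int by simp
  finally show WT: "moment_WT \<mu> = limit_WT"
    unfolding limit_WT_def TT by (rule solve) (rule q, simp)
  have "moment_WW \<mu> = (\<integral>v. (1 - v) ^ 4 * moment_WW \<mu> + (2 * v * (1 - v) ^ 3 * moment_WT \<mu> + (v\<^sup>2 * (1 - v)\<^sup>2 * moment_TT \<mu>
        + (v ^ 4 * moment_WW \<nu> + (2 * v ^ 3 * (1 - v) * moment_WT \<nu> + (v\<^sup>2 * (1 - v)\<^sup>2 * moment_TT \<nu> + (fst (limit_toll \<theta> v))\<^sup>2))))) \<partial>beta1 \<theta>)"
    unfolding affine_map_moments(3)[OF \<mu> \<nu>, symmetric] unfolding moment_WW_def
    by (rule hoppe_fixpoint_integral_quadratic[OF \<theta> \<mu> \<nu> fp _ quadratic_le_taxi(1)]) measurable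
  also have "\<dots> = (\<integral>v. (1 - v) ^ 4 \<partial>beta1 \<theta>) * moment_WW \<mu> + ((\<integral>v. 2 * v * (1 - v) ^ 3 \<partial>beta1 \<theta>) * moment_WT \<mu> + ((\<integral>v. v\<^sup>2 * (1 - v)\<^sup>2 \<partial>beta1 \<theta>) * moment_TT \<mu>
        + ((\<integral>v. v ^ 4 \<partial>beta1 \<theta>) * moment_WW \<nu> + ((\<integral>v. 2 * v ^ 3 * (1 - v) \<partial>beta1 \<theta>) * moment_WT \<nu> + ((\<integral>v. v\<^sup>2 * (1 - v)\<^sup>2 \<partial>beta1 \<theta>) * moment_TT \<nu>
        + (\<integral>v. (fst (limit_toll \<theta> v))\<^sup>2 \<partial>beta1 \<theta>))))))"
    using int by (simp del: Bochner_Integration.integral_mult_right_zero)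
  finally show "moment_WW \<mu> = limit_WW"
    unfolding limit_WW_def TT WT by (rule solve) (rule q, simp)
qed

end

text \<open>The coordinates are themselves 1-Lipschitz, so Wasserstein convergence carries the
  vanishing means of the finite laws to the limit.\<close>

lemma centered_L2_limit:
  assumes \<theta>: "\<theta> > 0" and N: "finite_mean N" and w: "(\<lambda>n. wasserstein (hoppe_law \<theta> n) N) \<longlonglongrightarrow> 0"
    and sq: "integrable N (\<lambda>x. (fst x)\<^sup>2)" "integrable N (\<lambda>x. (snd x)\<^sup>2)"
  shows "centered_L2 N"
proof -
  have zero: "(\<integral>x. f x \<partial>N) = 0" if f: "lip_taxi 1 f" "\<And>n. n > 0 \<Longrightarrow> (\<integral>x. f x \<partial>hoppe_law \<theta> n) = 0" for f
  proof -
    have "\<bar>\<integral>x. f x \<partial>N\<bar> \<le> wasserstein (hoppe_law \<theta> (Suc n)) N" for n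
      using wasserstein_upper[OF hoppe_law_finite_mean[OF \<theta>] N f(1), of "Suc n"] f(2)[of "Suc n"] by simp
    then have "\<bar>\<integral>x. f x \<partial>N\<bar> \<le> 0" using LIMSEQ_Suc[OF w] by (intro LIMSEQ_le_const) auto
    then show ?thesis by simp
  qed
  have "lip_taxi 1 fst" "lip_taxi 1 snd" by (auto simp: lip_taxi_def taxi_def)
  moreover have "(\<integral>x. fst x \<partial>hoppe_law \<theta> n) = 0" "(\<integral>x. snd x \<partial>hoppe_law \<theta> n) = 0" if "n > 0" for n
    using hoppe_law_centered[OF \<theta> that] by (auto simp: centered_L2_def)
  ultimately show ?thesis using N sq zero by (simp add: centered_L2_def finite_mean_def)
qed

text \<open>Convergent moments are eventually bounded, which is what the Fatou argument of
  \<open>weak_conv2_integrable\<close> asks for.\<close>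

lemma weak_limit_square_integrable:
  assumes \<theta>: "\<theta> > 0" and N: "prob_space N" "sets N = sets borel" and w: "weak_conv2 (hoppe_law \<theta>) N"
    and m: "(\<lambda>n. moment_WW (hoppe_law \<theta> n)) \<longlonglongrightarrow> a" "(\<lambda>n. moment_TT (hoppe_law \<theta> n)) \<longlonglongrightarrow> b"
  shows "integrable N (\<lambda>x. (fst x)\<^sup>2)" "integrable N (\<lambda>x. (snd x)\<^sup>2)"
proof -
  have "\<forall>\<^sub>F n in sequentially. moment_WW (hoppe_law \<theta> n) \<le> a + 1" "\<forall>\<^sub>F n in sequentially. moment_TT (hoppe_law \<theta> n) \<le> b + 1"
    by (rule eventually_mono[OF order_tendstoD(2)[OF m(1), of "a + 1"]] eventually_mono[OF order_tendstoD(2)[OF m(2), of "b + 1"]]; simp)+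
  moreover have "prob_space (hoppe_law \<theta> n) \<and> sets (hoppe_law \<theta> n) = sets borel \<and> integrable (hoppe_law \<theta> n) g"
    if "g \<in> borel_measurable borel" for n and g :: "real \<times> real \<Rightarrow> real"
    using that by (simp add: prob_space_hoppe_law integrable_hoppe_law[OF \<theta>])
  ultimately show "integrable N (\<lambda>x. (fst x)\<^sup>2)" "integrable N (\<lambda>x. (snd x)\<^sup>2)"
    by (auto intro!: weak_conv2_integrable(1)[OF _ N w] continuous_intros prob_space_hoppe_law simp: moment_WW_def moment_TT_def)
qed

theorem mainTheorem8:
  fixes \<theta> :: real and \<nu> :: "(real \<times> real) measure"
  assumes "\<theta> > 0"
    and "prob_space \<nu>" and "sets \<nu> = sets borel"
    and "conv_dist_2mom (hoppe_law 1) \<nu>"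
  shows "\<exists>\<mu>. centered_L2 \<mu> \<and> conv_dist_2mom (hoppe_law \<theta>) \<mu> \<and> hoppe_fixpoint \<theta> \<nu> \<mu> \<and>
             (\<forall>\<rho>. centered_L2 \<rho> \<and> hoppe_fixpoint \<theta> \<nu> \<rho> \<longrightarrow> \<rho> = \<mu>)"
proof -
  have w: "weak_conv2 (hoppe_law 1) \<nu>"
    and WW: "(\<lambda>n. moment_WW (hoppe_law 1 n)) \<longlonglongrightarrow> moment_WW \<nu>"
    and WT: "(\<lambda>n. moment_WT (hoppe_law 1 n)) \<longlonglongrightarrow> moment_WT \<nu>"
    and TT: "(\<lambda>n. moment_TT (hoppe_law 1 n)) \<longlonglongrightarrow> moment_TT \<nu>"
    using assms(4) by (auto simp: conv_dist_2mom_def moment_WW_def moment_WT_def moment_TT_def)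
  \<comment> \<open>Convergence of the second-moment integrals alone would not make the squares
    integrable under \<nu>, as a non-integrable function has integral 0; weak convergence closes
    this gap.\<close>
  note sq = weak_limit_square_integrable[OF zero_less_one assms(2,3) w WW TT]
  interpret N: prob_space \<nu> by fact
  note [measurable_cong] = assms(3)
  have tsq: "integrable \<nu> (\<lambda>x. (taxi x)\<^sup>2)"
    by (rule Bochner_Integration.integrable_bound[of _ "\<lambda>x. 2 * (fst x)\<^sup>2 + 2 * (snd x)\<^sup>2"]) (use sq taxi_square_le in auto)
  have "integrable \<nu> taxi"
  proof (rule Bochner_Integration.integrable_bound[of _ "\<lambda>x. 1 + (taxi x)\<^sup>2"])
    have "t \<le> 1 + t\<^sup>2" for t :: real
      using zero_le_power2[of "t - 1 / 2"] by (simp add: power2_eq_square algebra_simps)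
    then show "AE x in \<nu>. norm (taxi x) \<le> norm (1 + (taxi x)\<^sup>2)" by simp
  qed (use tsq in auto)
  then have \<nu>: "finite_mean \<nu>" using assms(2,3) by (intro finite_meanI)
  \<comment> \<open>The uniform second-moment bound makes the tails of the first moments uniformly
    small, which lifts weak convergence to Wasserstein convergence.\<close>
  obtain K where K: "\<And>n. (\<integral>x. (taxi x)\<^sup>2 \<partial>hoppe_law 1 n) \<le> K" "(\<integral>x. (taxi x)\<^sup>2 \<partial>\<nu>) \<le> K"
  proof -
    have "convergent (\<lambda>n. 2 * moment_WW (hoppe_law 1 n) + 2 * moment_TT (hoppe_law 1 n))"
      by (rule convergentI[OF tendsto_add[OF tendsto_mult[OF tendsto_const WW] tendsto_mult[OF tendsto_const TT]]])
    then obtain B where B: "\<And>n. \<bar>2 * moment_WW (hoppe_law 1 n) + 2 * moment_TT (hoppe_law 1 n)\<bar> \<le> B"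
      unfolding real_norm_def[symmetric] by (elim convergent_imp_Bseq[THEN BseqE]) blast
    have "(\<integral>x. (taxi x)\<^sup>2 \<partial>hoppe_law 1 n) \<le> max B (\<integral>x. (taxi x)\<^sup>2 \<partial>\<nu>)" for n
    proof -
      have "(\<integral>x. (taxi x)\<^sup>2 \<partial>hoppe_law 1 n) \<le> (\<integral>x. 2 * (fst x)\<^sup>2 + 2 * (snd x)\<^sup>2 \<partial>hoppe_law 1 n)"
        by (intro integral_mono integrable_hoppe_law taxi_square_le) auto
      also have "\<dots> = 2 * moment_WW (hoppe_law 1 n) + 2 * moment_TT (hoppe_law 1 n)"
        using integrable_hoppe_law[of 1 "\<lambda>x. (fst x)\<^sup>2" n] integrable_hoppe_law[of 1 "\<lambda>x. (snd x)\<^sup>2" n]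
        by (simp add: moment_WW_def moment_TT_def)
      finally show ?thesis using B[of n] by simp
    qed
    then show ?thesis by (intro that[of "max B (\<integral>x. (taxi x)\<^sup>2 \<partial>\<nu>)"]) auto
  qed
  have w1: "(\<lambda>n. wasserstein (hoppe_law 1 n) \<nu>) \<longlonglongrightarrow> 0"
    by (rule wasserstein_of_weak_conv2[OF _ assms(2,3) tsq hoppe_law_finite_mean \<nu> w K])
       (auto intro: prob_space_hoppe_law integrable_hoppe_law)
  have \<nu>c: "centered_L2 \<nu>" by (rule centered_L2_limit[OF zero_less_one \<nu> w1 sq])
  obtain \<mu> where \<mu>: "finite_mean \<mu>" and fp: "hoppe_fixpoint \<theta> \<nu> \<mu>"
    using hoppe_fixpoint_exists[OF assms(1) \<nu>] by blast
  have w2: "(\<lambda>n. wasserstein (hoppe_law \<theta> n) \<mu>) \<longlonglongrightarrow> 0"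
    by (rule wasserstein_hoppe_law_null[OF assms(1) \<nu> \<mu> fp w1])
  have wc: "weak_conv2 (hoppe_law \<theta>) \<mu>"
    by (rule weak_conv2_of_wasserstein[OF hoppe_law_finite_mean[OF assms(1)] \<mu> w2])
  note mom = hoppe_law_moments_tendsto[OF assms(1) TT WT WW]
  have \<mu>p: "prob_space \<mu>" "sets \<mu> = sets borel" using \<mu> by (auto simp: finite_mean_def)
  \<comment> \<open>The fixed point was constructed with finite mean only. Its second moments are
    finite because it is the weak limit of laws with convergent second moments; after that its
    moment equations apply and identify the limits.\<close>
  have \<mu>c: "centered_L2 \<mu>"
    by (rule centered_L2_limit[OF assms(1) \<mu> w2 weak_limit_square_integrable[OF assms(1) \<mu>p wc mom(3,1)]])
  have "conv_dist_2mom (hoppe_law \<theta>) \<mu>"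
    using wc mom unfolding fixpoint_moments[OF assms(1) \<mu>c \<nu>c fp, symmetric]
    by (simp add: conv_dist_2mom_def moment_WW_def moment_WT_def moment_TT_def)
  moreover have "\<rho> = \<mu>" if "centered_L2 \<rho>" "hoppe_fixpoint \<theta> \<nu> \<rho>" for \<rho>
    using hoppe_fixpoint_unique[OF assms(1) centered_L2_finite_mean[OF that(1)] \<mu> \<nu> that(2) fp] .
  ultimately show ?thesis using \<mu>c fp by blast
qed

end
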